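(* Let $a>0$, $b,c\in\mathbb R$, and let $\Pi$ be the parabola $y=\tfrac{a}{2}x^2+bx+c$. (1) Under the affine curve-shortening flow, $\Pi$ moves by vertical translation with constant velocity $a^{1/3}$; thus at time $T>0$ it is the parabola $\Pi^T\colon y=\tfrac a2x^2+bx+c+Ta^{1/3}$. (2) Fix $T>0$. For a positive integer $n$, apply $m=\lfloor c_{\mathrm g}Tn^{4/3}\rfloor$ steps of grid peeling to $\Pi$ with respect to the grid $\tfrac1n\mathbb Z^2$, where $$c_{\mathrm g}=\sqrt[3]{\frac{\pi^2}{2\zeta(3)}}\approx 1.6012.$$ Then, as $n\to\infty$, the vertical distance between the resulting grid polygon and $\Pi^T$ (the supremum over $x\in\mathbb R$ of the absolute difference of their $y$-values at abscissa $x$) is $$O\!\left(\frac{(Ta^{2/3}+a^{-2/3})\log\frac na}{n^{1/3}}\right).$$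
   Context: Affine curve-shortening flow (ACSF): a smooth curve evolves in time so that each point moves in the direction of the normal pointing to the concave side, with normal speed $\kappa^{1/3}$, where $\kappa$ is the current curvature at that point. Grid peeling with respect to a grid $G$ (here $G=\tfrac1n\mathbb Z^2$): one peeling step applied to a set $U\subseteq G$ removes from $U$ all vertices (extreme points) of the convex hull $\mathrm{conv}(U)$. Grid peeling of a convex curve that is the graph of a convex function starts from $U_0=$ the set of points of $G$ on or above the curve and sets $U_{k+1}=U_k\setminus\{\text{vertices of }\mathrm{conv}(U_k)\}$; the grid polygon after $m$ steps is the lower boundary of $\mathrm{conv}(U_m)$, viewed as the graph of a function of $x$. $\zeta$ is the Riemann zeta function. *)

theory Defs
  imports "HOL-Analysis.Analysis"
begin

definition zeta3 :: real where
  "zeta3 = (\<Sum>k. 1 / (real (Suc k)) ^ 3)"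

definition c_g :: real where
  "c_g = root 3 (pi ^ 2 / (2 * zeta3))"

text \<open>Affine curve-shortening flow for a family of graphs y = u t x, t \<ge> 0.
  The upward normal velocity is u_t / sqrt(1+u_x^2); the signed curvature w.r.t. the
  upward normal is u_xx/(1+u_x^2)^(3/2); the curve moves towards its concave side with
  speed |kappa|^(1/3), i.e. signed normal speed = real cube root of kappa.\<close>
definition acsf_graph_flow :: "(real \<Rightarrow> real \<Rightarrow> real) \<Rightarrow> (real \<Rightarrow> real) \<Rightarrow> bool" where
  "acsf_graph_flow u f \<longleftrightarrow> (\<forall>x. u 0 x = f x) \<and>
     (\<forall>t\<ge>0. \<forall>x. \<exists>ut ux uxx.
        ((\<lambda>s. u s x) has_real_derivative ut) (at t within {0..}) \<and>
        (\<forall>y. (\<lambda>z. u t z) differentiable (at y)) \<and>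
        ((\<lambda>y. u t y) has_real_derivative ux) (at x) \<and>
        ((\<lambda>y. deriv (\<lambda>z. u t z) y) has_real_derivative uxx) (at x) \<and>
        ut / sqrt (1 + ux\<^sup>2) = root 3 (uxx / (1 + ux\<^sup>2) powr (3/2)))"

definition grid :: "nat \<Rightarrow> (real \<times> real) set" where
  "grid n = {(of_int i / real n, of_int j / real n) | i j. True}"

definition peel :: "(real \<times> real) set \<Rightarrow> (real \<times> real) set" where
  "peel U = U - {p. p extreme_point_of (convex hull U)}"

definition grid_epi :: "nat \<Rightarrow> (real \<Rightarrow> real) \<Rightarrow> (real \<times> real) set" where
  "grid_epi n f = {p \<in> grid n. snd p \<ge> f (fst p)}"

definition grid_polygon :: "nat \<Rightarrow> (real \<Rightarrow> real) \<Rightarrow> nat \<Rightarrow> real \<Rightarrow> real" where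
  "grid_polygon n f m x = Inf {y. (x, y) \<in> convex hull ((peel ^^ m) (grid_epi n f))}"

end

theory Submission
  imports Defs "HOL-Computational_Algebra.Squarefree" "HOL-Real_Asymp.Real_Asymp"
begin

text \<open>
  For odd \<open>tau = 2 r + 1\<close> there is a lattice polygon whose peeling can be described exactly. Sort all
  primitive vectors \<open>(i, y)\<close> with \<open>0 < i \<le> tau\<close>, each repeated \<open>tau div i\<close> times, by slope and
  concatenate them; let \<open>V s\<close> be the vertex with tangent slope \<open>s\<close>. Sort the lattice points of the strip
  \<open>\<bar>x\<bar> \<le> r\<close> by their height above the line of slope \<open>s\<close>, and let \<open>w k s\<close> be the \<open>k\<close>-th one. Then the
  polygon with the vertices \<open>V s + w k s\<close> is convex, and peeling it once replaces \<open>k\<close> by \<open>k + 1\<close>; so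
  \<open>tau\<close> peeling steps translate it upwards by 1.

  An increase of the slope by 1 advances \<open>V\<close> horizontally by \<open>H = \<Sum>i\<le>tau. (tau div i) * i * \<phi>(i)\<close>,
  which is \<open>2 \<zeta>(3) / \<pi>\<^sup>2 * tau^3 + O(tau\<^sup>2 log tau)\<close>. The polygon therefore stays close to a parabola
  of curvature \<open>1 / H\<close>, and it moves at speed \<open>1 / tau\<close>.
  Peeling is monotone. In grid units the given parabola has curvature \<open>a / n\<close>; near any prescribed
  abscissa it is caught between translates of two such polygons, one of slightly larger and one
  of slightly smaller curvature, and so is everything that peeling produces from it.
\<close>

subsection \<open>Floors, slopes and extreme points\<close>

text \<open>Why \<open>tau div i\<close> copies: when the slope passes \<open>y / i\<close>, the
  order of the strip points on each line of that slope is reversed. Such a line carries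
  \<open>q\<close> strip points, \<open>q\<close> being \<open>tau div i\<close> or one more, so the
  \<open>k\<close>-th strip point jumps by between \<open>-(q - 1)\<close> and \<open>q - 1\<close>
  primitive vectors. The added copies keep all edges nonnegative, and the next point of the same
  line gives an edge shorter by two vectors, just as if both its endpoints were removed. Edges and
  sorting are nevertheless avoided below: a set is given by a lower bound on the depth of its points
  at all slopes, and all that matters is how the depth of a fixed point varies with the slope.
  Origin of \<open>c_g\<close>: in grid units the curvature \<open>a / n\<close> is matched by
  \<open>H = n / a\<close>, so with \<open>h = 2 * zeta3 / pi ^ 2\<close> the best
  \<open>tau\<close> is about \<open>root 3 (n / (a * h))\<close>. At speed \<open>1 / tau\<close>,
  a climb of \<open>T * n * a powr (1/3)\<close> grid units takes
  \<open>T * n powr (4/3) / root 3 h\<close> steps, and \<open>c_g = 1 / root 3 h\<close>. The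
  errors, at most of order \<open>tau ^ 2 * ln tau\<close>, are the deviation of \<open>Vx\<close>
  from linearity and the gaps between available values of \<open>H\<close>.\<close>

definition signed_sum :: "(int \<Rightarrow> int) \<Rightarrow> int \<Rightarrow> int" where
  "signed_sum f m = (\<Sum>y\<in>{0<..m}. f y) - (\<Sum>y\<in>{m<..0}. f y)"

lemma signed_sum_diff:
  assumes "a \<le> b"
  shows "signed_sum f b - signed_sum f a = (\<Sum>y\<in>{a<..b}. f y)"
proof -
  consider "0 \<le> a" | "a < 0" "0 \<le> b" | "b < 0" by linarith
  then show ?thesis
  proof cases
    case 1
    have "{0<..b} = {0<..a} \<union> {a<..b}" using 1 assms by auto
    then have "sum f {0<..b} = sum f {0<..a} + sum f {a<..b}"
      by (simp add: sum.union_disjoint)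
    then show ?thesis using 1 assms by (simp add: signed_sum_def)
  next
    case 2
    have "{a<..b} = {a<..0} \<union> {0<..b}" using 2 by auto
    then have "sum f {a<..b} = sum f {a<..0} + sum f {0<..b}"
      by (simp add: sum.union_disjoint)
    then show ?thesis using 2 by (simp add: signed_sum_def)
  next
    case 3
    have "{a<..0} = {a<..b} \<union> {b<..0}" using 3 assms by auto
    then have "sum f {a<..0} = sum f {a<..b} + sum f {b<..0}"
      by (simp add: sum.union_disjoint)
    then show ?thesis using 3 assms by (simp add: signed_sum_def)
  qed
qed

lemma exists_irrational_between:
  fixes a b :: real
  assumes "a < b"
  obtains x where "a < x" "x < b" "x \<notin> \<rat>"
proof -
  have "uncountable {a<..<b}" using assms by (simp add: uncountable_open_interval)
  then have "\<not> {a<..<b} \<subseteq> \<rat>" using countable_rat countable_subset by blast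
  then obtain x where "x \<in> {a<..<b}" "x \<notin> \<rat>" by blast
  then show thesis by (auto intro: that)
qed

lemma floor_right_constant:
  fixes x :: real and j :: int
  assumes "0 < j"
  shows "\<exists>d>0. \<forall>b. x \<le> b \<and> b < x + d \<longrightarrow> \<lfloor>b * j\<rfloor> = \<lfloor>x * j\<rfloor>"
proof (intro exI conjI allI impI)
  let ?d = "(of_int \<lfloor>x * j\<rfloor> + 1 - x * j) / j"
  have j: "0 < real_of_int j" using assms by simp
  have "0 < of_int \<lfloor>x * j\<rfloor> + 1 - x * j" by linarith
  then show "0 < ?d" using j by (rule divide_pos_pos)
  fix b assume b: "x \<le> b \<and> b < x + ?d"
  have "x * j \<le> b * j" using b j by simp
  moreover have "b * j < (x + ?d) * j" using b j by (meson mult_strict_right_mono)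
  moreover have "(x + ?d) * j = of_int \<lfloor>x * j\<rfloor> + 1" using assms by (simp only: distrib_right) simp
  ultimately show "\<lfloor>b * j\<rfloor> = \<lfloor>x * j\<rfloor>" by (intro floor_unique) linarith+
qed

lemma floor_left_constant:
  fixes x :: real and j :: int
  assumes "0 < j"
  shows "\<exists>d>0. \<forall>b. x - d < b \<and> b < x \<longrightarrow> \<lfloor>b * j\<rfloor> = \<lceil>x * j\<rceil> - 1"
proof (intro exI conjI allI impI)
  let ?d = "(x * j - (of_int \<lceil>x * j\<rceil> - 1)) / j"
  have j: "0 < real_of_int j" using assms by simp
  have "0 < x * j - (of_int \<lceil>x * j\<rceil> - 1)" by linarith
  then show "0 < ?d" using j by (rule divide_pos_pos)
  fix b assume b: "x - ?d < b \<and> b < x"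
  have "b * j < x * j" using b j by simp
  moreover have "(x - ?d) * j < b * j" using b j by (meson mult_strict_right_mono)
  moreover have "(x - ?d) * j = of_int \<lceil>x * j\<rceil> - 1" using assms by (simp only: left_diff_distrib) simp
  ultimately show "\<lfloor>b * j\<rfloor> = \<lceil>x * j\<rceil> - 1" by (intro floor_unique) linarith+
qed

lemma common_radius:
  fixes Q :: "'a \<Rightarrow> real \<Rightarrow> bool"
  assumes "finite A" "\<And>j. j \<in> A \<Longrightarrow> \<exists>d>0. \<forall>b. \<bar>b\<bar> < d \<longrightarrow> Q j b"
  shows "\<exists>d>0. \<forall>j\<in>A. \<forall>b. \<bar>b\<bar> < d \<longrightarrow> Q j b"
  using assms
proof (induction A rule: finite_induct)
  case empty show ?case by (intro exI[of _ 1]) auto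
next
  case (insert a A)
  obtain d where "d > 0" "\<forall>j\<in>A. \<forall>b. \<bar>b\<bar> < d \<longrightarrow> Q j b" using insert by blast
  moreover obtain e where "e > 0" "\<forall>b. \<bar>b\<bar> < e \<longrightarrow> Q a b" using insert by blast
  ultimately show ?case by (intro exI[of _ "min d e"]) auto
qed

text \<open>From the left the constant is \<open>\<lceil>x * j\<rceil> - 1\<close>, because a line
  turned slightly downwards drops below any integer point that it met. Bounding \<open>j\<close> by
  \<open>B\<close> leaves finitely many radii to intersect.\<close>

lemma floors_locally_constant:
  fixes x :: real and B :: int
  obtains d where "d > 0"
    "\<And>b j. x \<le> b \<Longrightarrow> b < x + d \<Longrightarrow> 0 < j \<Longrightarrow> j \<le> B \<Longrightarrow> \<lfloor>b * j\<rfloor> = \<lfloor>x * j\<rfloor>"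
    "\<And>b j. x - d < b \<Longrightarrow> b < x \<Longrightarrow> 0 < j \<Longrightarrow> j \<le> B \<Longrightarrow> \<lfloor>b * j\<rfloor> = \<lceil>x * j\<rceil> - 1"
proof -
  define Q where "Q = (\<lambda>(j::int) h. (0 \<le> h \<longrightarrow> \<lfloor>(x + h) * j\<rfloor> = \<lfloor>x * j\<rfloor>) \<and>
     (h < 0 \<longrightarrow> \<lfloor>(x + h) * j\<rfloor> = \<lceil>x * j\<rceil> - 1))"
  have "\<exists>d>0. \<forall>h. \<bar>h\<bar> < d \<longrightarrow> Q j h" if j: "j \<in> {0<..B}" for j
  proof -
    obtain d where d: "d > 0" "\<forall>b. x \<le> b \<and> b < x + d \<longrightarrow> \<lfloor>b * j\<rfloor> = \<lfloor>x * j\<rfloor>"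
      using floor_right_constant[of j x] j by auto
    obtain e where e: "e > 0" "\<forall>b. x - e < b \<and> b < x \<longrightarrow> \<lfloor>b * j\<rfloor> = \<lceil>x * j\<rceil> - 1"
      using floor_left_constant[of j x] j by auto
    have "Q j h" if "\<bar>h\<bar> < min d e" for h
      unfolding Q_def using that d(2)[rule_format, of "x + h"] e(2)[rule_format, of "x + h"] by linarith
    then show ?thesis using d(1) e(1) by (intro exI[of _ "min d e"]) simp
  qed
  then obtain d where d: "d > 0" "\<forall>j\<in>{0<..B}. \<forall>h. \<bar>h\<bar> < d \<longrightarrow> Q j h"
    using common_radius[of "{0<..B}" Q] by auto
  show thesis
  proof (rule that[OF d(1)])
    fix b and j :: int assume "x \<le> b" "b < x + d" "0 < j" "j \<le> B"
    then show "\<lfloor>b * j\<rfloor> = \<lfloor>x * j\<rfloor>" using d(2)[rule_format, of j "b - x"] by (simp add: Q_def)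
  next
    fix b and j :: int assume "x - d < b" "b < x" "0 < j" "j \<le> B"
    then show "\<lfloor>b * j\<rfloor> = \<lceil>x * j\<rceil> - 1" using d(2)[rule_format, of j "b - x"] by (simp add: Q_def)
  qed
qed

text \<open>This is what irrational slopes are for: distinct lattice points have distinct heights
  \<open>y - s * x\<close>, so no order by height needs a tie-break.\<close>

lemma irrational_collinear:
  fixes a b :: int and s :: real
  assumes "s \<notin> \<rat>" "of_int a = s * of_int b"
  shows "a = 0 \<and> b = 0"
proof -
  have "b = 0"
  proof (rule ccontr)
    assume "b \<noteq> 0"
    then have "s = of_int a / of_int b" using assms(2) by (simp add: field_simps)
    then have "s \<in> \<rat>" by (metis Rats_divide Rats_of_int)
    then show False using assms(1) by simp
  qed
  then show ?thesis using assms by simp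
qed

lemma slope_cases:
  fixes x :: real
  obtains (rat) y0 i0 :: int where "x = of_int y0 / of_int i0" "0 < i0" "coprime y0 i0"
  | (irrat) "\<And>i::int. 0 < i \<Longrightarrow> x * of_int i \<notin> \<int>"
proof (cases "x \<in> \<rat>")
  case True
  then obtain a b :: int where "b > 0" "coprime a b" "x = of_int a / of_int b"
    by (rule Rats_cases')
  then show thesis using rat by blast
next
  case False
  have "x * of_int i \<notin> \<int>" if "0 < i" for i :: int
  proof
    assume "x * of_int i \<in> \<int>"
    then obtain k :: int where "x * of_int i = of_int k" by (auto elim: Ints_cases)
    then have "x = of_int k / of_int i" using that by (simp add: field_simps)
    then show False using False by simp
  qed
  then show thesis using irrat by blast
qed

text \<open>The sets to be peeled are infinite and their hulls are not known to be closed. An open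
  half-plane together with the single boundary point \<open>p\<close> is still convex, so it
  contains the hull, which therefore meets the boundary line only in \<open>p\<close>.\<close>

lemma strictly_minimal_extreme:
  fixes a p :: "real \<times> real"
  assumes "p \<in> S" "\<And>q. q \<in> S \<Longrightarrow> q \<noteq> p \<Longrightarrow> a \<bullet> p < a \<bullet> q"
  shows "p extreme_point_of (convex hull S)"
proof -
  let ?T = "insert p {q. a \<bullet> p < a \<bullet> q}"
  have "convex ?T"
    unfolding convex_alt
  proof (intro ballI allI impI)
    fix x y and u :: real assume xy: "x \<in> ?T" "y \<in> ?T" and u: "0 \<le> u \<and> u \<le> 1"
    have le: "a \<bullet> p \<le> a \<bullet> x" "a \<bullet> p \<le> a \<bullet> y" using xy by auto
    show "(1 - u) *\<^sub>R x + u *\<^sub>R y \<in> ?T"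
    proof (cases "(x = p \<or> u = 1) \<and> (y = p \<or> u = 0)")
      case True
      then show ?thesis by (auto simp: algebra_simps)
    next
      case False
      have 1: "(1 - u) * (a \<bullet> p) \<le> (1 - u) * (a \<bullet> x)" "u * (a \<bullet> p) \<le> u * (a \<bullet> y)"
        using le u by (auto intro: mult_left_mono)
      have "(1 - u) * (a \<bullet> p) < (1 - u) * (a \<bullet> x) \<or> u * (a \<bullet> p) < u * (a \<bullet> y)"
        using False xy u by auto
      then have "(1 - u) * (a \<bullet> p) + u * (a \<bullet> p) < (1 - u) * (a \<bullet> x) + u * (a \<bullet> y)"
        using 1 by linarith
      then show ?thesis by (simp add: inner_add_right algebra_simps)
    qed
  qed
  then have hull: "convex hull S \<subseteq> ?T"
    using assms by (intro hull_minimal) auto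
  show ?thesis
  proof (rule extreme_point_of_Int_supporting_hyperplane_ge)
    show "convex hull S \<inter> {x. a \<bullet> x = a \<bullet> p} = {p}"
      using hull assms(1) hull_inc[of p S convex] by auto
    show "a \<bullet> p \<le> a \<bullet> x" if "x \<in> convex hull S" for x using hull that by auto
  qed
qed

lemma vertical_open_segment:
  fixes x y z w :: real
  assumes "z < y" "y < w"
  shows "(x, y) \<in> open_segment (x, z) (x, w)"
proof -
  define t where "t = (y - z) / (w - z)"
  have t: "0 < t" "t < 1" using assms by (auto simp: t_def)
  have "t * (w - z) = y - z" using assms by (simp add: t_def)
  then have "(x, y) = (1 - t) *\<^sub>R (x, z) + t *\<^sub>R (x, w)" by (simp add: algebra_simps)
  then show ?thesis unfolding in_segment using t assms by auto
qed

text \<open>The last assumption says, with denominators cleared, that the chord passes through or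
  below \<open>(x, y)\<close>. Then \<open>(x, y)\<close> lies on the chord itself or strictly
  between a chord point and \<open>(x, y + 1)\<close>.\<close>

lemma above_segment_not_extreme:
  fixes x1 x2 x y1 y2 y :: real
  assumes "(x1, y1) \<in> C" "(x2, y2) \<in> C" "(x, y + 1) \<in> C" "convex C"
    and "x1 < x" "x < x2" "(y2 - y) * (x - x1) + (y1 - y) * (x2 - x) \<le> 0"
  shows "\<not> (x, y) extreme_point_of C"
proof
  assume ext: "(x, y) extreme_point_of C"
  define t where "t = (x - x1) / (x2 - x1)"
  have t: "0 < t" "t < 1" using assms by (auto simp: t_def)
  define z where "z = (1 - t) * y1 + t * y2"
  have x12: "x2 - x1 > 0" using assms by simp
  have tx: "t * (x2 - x1) = x - x1" using x12 by (simp add: t_def)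
  then have x_eq: "(1 - t) * x1 + t * x2 = x" by (simp add: algebra_simps)
  have seg: "(x, z) = (1 - t) *\<^sub>R (x1, y1) + t *\<^sub>R (x2, y2)" using x_eq by (simp add: z_def)
  have "(z - y) * (x2 - x1) = (y1 - y) * (x2 - x1) + t * (x2 - x1) * (y2 - y1)"
    by (simp add: z_def algebra_simps)
  also have "\<dots> = (y2 - y) * (x - x1) + (y1 - y) * (x2 - x)" unfolding tx by (simp add: algebra_simps)
  finally have "(z - y) * (x2 - x1) \<le> 0" using assms(7) by simp
  then have zy: "z \<le> y" using x12 by (simp add: mult_le_0_iff)
  have "(x, z) \<in> open_segment (x1, y1) (x2, y2)"
    unfolding in_segment using seg t assms by auto
  show False
  proof (cases "z = y")
    case True
    then show False using ext \<open>(x, z) \<in> open_segment _ _\<close> assms(1,2) unfolding extreme_point_of_def by blast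
  next
    case False
    have zC: "(x, z) \<in> C" unfolding seg using assms(1,2,4) t by (intro convexD_alt) auto
    have "(x, y) \<in> open_segment (x, z) (x, y + 1)"
      using zy False by (intro vertical_open_segment) auto
    then show False using ext zC assms(3) unfolding extreme_point_of_def by blast
  qed
qed

subsection \<open>The depth of a lattice point\<close>

locale strip =
  fixes r :: int
  assumes r_nonneg: "0 \<le> r"
begin

definition tau :: int where "tau = 2 * r + 1"

lemma tau_pos: "0 < tau" using r_nonneg by (simp add: tau_def)

text \<open>
  A function \<open>m\<close> on the integers stands for a slope \<open>s\<close> approached from the right (\<open>rgerm\<close>) or from the
  left (\<open>lgerm\<close>): \<open>m j\<close> is the largest integer below the line of that slope at abscissa \<open>j > 0\<close>.
  \<open>(VX m, VY m)\<close> is the vertex with this tangent slope on the polygon that is composed of all primitive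
  vectors \<open>(i, y)\<close>, \<open>0 < i \<le> tau\<close>, each repeated \<open>tau div i\<close> times, in the order of slope.
  Up to a constant, \<open>depth m X Y\<close> counts the lattice points in the strip \<open>\<bar>x\<bar> \<le> r\<close> that lie on or below the
  line with this slope through \<open>(X - VX m, Y - VY m)\<close>.
\<close>

definition VX :: "(int \<Rightarrow> int) \<Rightarrow> int" where
  "VX m = (\<Sum>i\<in>{0<..tau}. (tau div i) * i * signed_sum (\<lambda>y. if coprime y i then 1 else 0) (m i))"

definition VY :: "(int \<Rightarrow> int) \<Rightarrow> int" where
  "VY m = (\<Sum>i\<in>{0<..tau}. (tau div i) * signed_sum (\<lambda>y. if coprime y i then y else 0) (m i))"

text \<open>The least integer on or above the infinitesimally turned line through the origin at
  abscissa \<open>j\<close>. Reflection in the origin exchanges floor and ceiling, hence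
  \<open>- m (- j)\<close> for negative \<open>j\<close>; at \<open>j = 0\<close> the origin itself
  lies on the line.\<close>

definition germ_ceiling :: "(int \<Rightarrow> int) \<Rightarrow> int \<Rightarrow> int" where
  "germ_ceiling m j = (if 0 < j then m j + 1 else if j < 0 then - m (- j) else 0)"

definition depth :: "(int \<Rightarrow> int) \<Rightarrow> int \<Rightarrow> int \<Rightarrow> int" where
  "depth m X Y = tau * (Y - VY m) - (\<Sum>j\<in>{X - VX m - r..X - VX m + r}. germ_ceiling m j)"

definition rgerm :: "real \<Rightarrow> int \<Rightarrow> int" where "rgerm s j = \<lfloor>s * j\<rfloor>"
definition lgerm :: "real \<Rightarrow> int \<Rightarrow> int" where "lgerm s j = \<lceil>s * j\<rceil> - 1"

abbreviation "Vx s \<equiv> VX (rgerm s)"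
abbreviation "Vy s \<equiv> VY (rgerm s)"
abbreviation "N s \<equiv> depth (rgerm s)"

lemma VX_cong: "(\<And>j. 0 < j \<Longrightarrow> j \<le> tau \<Longrightarrow> m j = m' j) \<Longrightarrow> VX m = VX m'"
  unfolding VX_def by (rule sum.cong) auto

lemma VY_cong: "(\<And>j. 0 < j \<Longrightarrow> j \<le> tau \<Longrightarrow> m j = m' j) \<Longrightarrow> VY m = VY m'"
  unfolding VY_def by (rule sum.cong) auto

lemma depth_cong:
  assumes "\<And>j. 0 < j \<Longrightarrow> j \<le> B \<Longrightarrow> m j = m' j" "tau \<le> B" "\<bar>X - VX m\<bar> + r \<le> B"
  shows "depth m X Y = depth m' X Y"
proof -
  have X: "VX m = VX m'" using assms(1,2) by (intro VX_cong) auto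
  have Y: "VY m = VY m'" using assms(1,2) by (intro VY_cong) auto
  have "(\<Sum>j\<in>{X - VX m - r..X - VX m + r}. germ_ceiling m j) = (\<Sum>j\<in>{X - VX m - r..X - VX m + r}. germ_ceiling m' j)"
  proof (rule sum.cong[OF refl])
    fix j assume "j \<in> {X - VX m - r..X - VX m + r}"
    then have "\<bar>j\<bar> \<le> B" using assms(3) by auto
    then show "germ_ceiling m j = germ_ceiling m' j"
      using assms(1)[of j] assms(1)[of "- j"] by (auto simp: germ_ceiling_def)
  qed
  then show ?thesis using X Y by (simp add: depth_def)
qed

text \<open>Passing from one slope to another appends exactly the primitive vectors with slopes in
  between. Monotonicity, jumps and the concavity of \<open>support\<close> are all read off from
  these sums.\<close>

lemma V_diff:
  assumes "\<And>i. 0 < i \<Longrightarrow> i \<le> tau \<Longrightarrow> m i \<le> m' i"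
  shows "VX m' - VX m = (\<Sum>i\<in>{0<..tau}. \<Sum>y | y \<in> {m i<..m' i} \<and> coprime y i. (tau div i) * i)"
    and "VY m' - VY m = (\<Sum>i\<in>{0<..tau}. \<Sum>y | y \<in> {m i<..m' i} \<and> coprime y i. (tau div i) * y)"
proof -
  have *: "(\<Sum>y | y \<in> {a<..b} \<and> coprime y i. c * f y) = c * (\<Sum>y\<in>{a<..b}. if coprime y i then f y else 0)"
    for a b i c :: int and f
    by (subst sum.inter_filter[symmetric]) (auto simp: sum_distrib_left)
  have "VX m' - VX m = (\<Sum>i\<in>{0<..tau}. (tau div i) * i *
     (signed_sum (\<lambda>y. if coprime y i then 1 else 0) (m' i) - signed_sum (\<lambda>y. if coprime y i then 1 else 0) (m i)))"
    by (simp add: VX_def sum_subtractf[symmetric] right_diff_distrib)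
  also have "\<dots> = (\<Sum>i\<in>{0<..tau}. \<Sum>y | y \<in> {m i<..m' i} \<and> coprime y i. (tau div i) * i)"
  proof (rule sum.cong[OF refl])
    fix i assume "i \<in> {0<..tau}"
    then have "m i \<le> m' i" using assms by auto
    then show "(tau div i) * i *
     (signed_sum (\<lambda>y. if coprime y i then 1 else 0) (m' i) - signed_sum (\<lambda>y. if coprime y i then 1 else 0) (m i))
      = (\<Sum>y | y \<in> {m i<..m' i} \<and> coprime y i. (tau div i) * i)"
      using *[where a = "m i" and b = "m' i" and i = i and c = "(tau div i) * i" and f = "\<lambda>_. 1"] by (simp only: signed_sum_diff mult_1_right)
  qed
  finally show "VX m' - VX m = (\<Sum>i\<in>{0<..tau}. \<Sum>y | y \<in> {m i<..m' i} \<and> coprime y i. (tau div i) * i)" .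
  have "VY m' - VY m = (\<Sum>i\<in>{0<..tau}. (tau div i) *
     (signed_sum (\<lambda>y. if coprime y i then y else 0) (m' i) - signed_sum (\<lambda>y. if coprime y i then y else 0) (m i)))"
    by (simp add: VY_def sum_subtractf[symmetric] right_diff_distrib)
  also have "\<dots> = (\<Sum>i\<in>{0<..tau}. \<Sum>y | y \<in> {m i<..m' i} \<and> coprime y i. (tau div i) * y)"
  proof (rule sum.cong[OF refl])
    fix i assume "i \<in> {0<..tau}"
    then have "m i \<le> m' i" using assms by auto
    then show "(tau div i) *
     (signed_sum (\<lambda>y. if coprime y i then y else 0) (m' i) - signed_sum (\<lambda>y. if coprime y i then y else 0) (m i))
      = (\<Sum>y | y \<in> {m i<..m' i} \<and> coprime y i. (tau div i) * y)"
      using *[where a = "m i" and b = "m' i" and i = i and c = "tau div i" and f = "\<lambda>y. y"] by (simp add: signed_sum_diff)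
  qed
  finally show "VY m' - VY m = (\<Sum>i\<in>{0<..tau}. \<Sum>y | y \<in> {m i<..m' i} \<and> coprime y i. (tau div i) * y)" .
qed

lemma Vx_mono: "s \<le> s' \<Longrightarrow> Vx s \<le> Vx s'"
proof -
  assume "s \<le> s'"
  then have "Vx s' - Vx s = (\<Sum>i\<in>{0<..tau}. \<Sum>y | y \<in> {rgerm s i<..rgerm s' i} \<and> coprime y i. (tau div i) * i)"
    by (intro V_diff) (auto simp: rgerm_def intro!: floor_mono mult_right_mono)
  also have "\<dots> \<ge> 0" by (intro sum_nonneg) (auto simp: pos_imp_zdiv_nonneg_iff)
  finally show ?thesis by simp
qed

text \<open>By coprimality \<open>(i0, y0)\<close> is the only primitive vector of slope
  \<open>x\<close>. If \<open>i0 > tau\<close>, it is not in the list, and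
  \<open>tau div i0 = 0\<close> makes the formula correct all the same.\<close>

lemma V_jump_rational:
  assumes x: "x = of_int y0 / of_int i0" and i0: "0 < i0" and cop: "coprime y0 i0"
  shows "VX (rgerm x) - VX (lgerm x) = (tau div i0) * i0"
    and "VY (rgerm x) - VY (lgerm x) = (tau div i0) * y0"
proof -
  have le: "lgerm x i \<le> rgerm x i" for i
    unfolding lgerm_def rgerm_def by linarith
  have S: "{y. y \<in> {lgerm x i<..rgerm x i} \<and> coprime y i} = (if i = i0 then {y0} else {})" if "0 < i" for i
  proof -
    have iff: "y \<in> {lgerm x i<..rgerm x i} \<longleftrightarrow> y * i0 = y0 * i" for y
    proof -
      have "y \<in> {lgerm x i<..rgerm x i} \<longleftrightarrow> real_of_int y = x * i"
        unfolding lgerm_def rgerm_def by (auto simp: le_floor_iff) linarith+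
      also have "\<dots> \<longleftrightarrow> real_of_int y * i0 = y0 * i"
        using i0 by (simp add: x field_simps)
      also have "\<dots> \<longleftrightarrow> y * i0 = y0 * i"
        by (metis of_int_eq_iff of_int_mult)
      finally show ?thesis .
    qed
    have "y = y0 \<and> i = i0" if e: "y * i0 = y0 * i" and c: "coprime y i" for y
    proof -
      have "i0 dvd i" using e cop by (metis coprime_commute coprime_dvd_mult_right_iff dvd_triv_right)
      moreover have "i dvd i0" using e c by (metis coprime_commute coprime_dvd_mult_right_iff dvd_triv_right)
      ultimately have "i = i0" using \<open>0 < i\<close> i0 by (simp add: zdvd_antisym_nonneg)
      then show ?thesis using e i0 by simp
    qed
    then show ?thesis using iff cop by (auto simp: mult.commute)
  qed
  have "VX (rgerm x) - VX (lgerm x) = (\<Sum>i\<in>{0<..tau}. \<Sum>y\<in>(if i = i0 then {y0} else {}). (tau div i) * i)"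
    by (subst V_diff(1)[OF le]) (intro sum.cong S, auto)
  also have "\<dots> = (\<Sum>i\<in>{0<..tau}. if i = i0 then (tau div i0) * i0 else 0)"
    by (rule sum.cong) auto
  also have "\<dots> = (tau div i0) * i0" using i0 tau_pos by (auto simp: sum.delta intro: div_pos_pos_trivial)
  finally show "VX (rgerm x) - VX (lgerm x) = (tau div i0) * i0" .
  have "VY (rgerm x) - VY (lgerm x) = (\<Sum>i\<in>{0<..tau}. \<Sum>y\<in>(if i = i0 then {y0} else {}). (tau div i) * y)"
    by (subst V_diff(2)[OF le]) (intro sum.cong S, auto)
  also have "\<dots> = (\<Sum>i\<in>{0<..tau}. if i = i0 then (tau div i0) * y0 else 0)"
    by (rule sum.cong) auto
  also have "\<dots> = (tau div i0) * y0" using i0 tau_pos by (auto simp: sum.delta intro: div_pos_pos_trivial)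
  finally show "VY (rgerm x) - VY (lgerm x) = (tau div i0) * y0" .
qed

lemma V_jump_irrational:
  assumes "\<And>i. 0 < i \<Longrightarrow> x * of_int i \<notin> \<int>"
  shows "VX (rgerm x) = VX (lgerm x)" "VY (rgerm x) = VY (lgerm x)"
    "depth (rgerm x) X Y = depth (lgerm x) X Y"
proof -
  have "rgerm x j = lgerm x j" if "0 < j" for j
    using assms[OF that] by (simp add: rgerm_def lgerm_def ceiling_altdef Ints_def) (metis rangeI)
  then show "VX (rgerm x) = VX (lgerm x)" "VY (rgerm x) = VY (lgerm x)"
    "depth (rgerm x) X Y = depth (lgerm x) X Y"
    by (auto intro!: VX_cong VY_cong depth_cong[OF _ order.trans[OF _ max.cobounded1] max.cobounded2])
qed

text \<open>The line of slope \<open>x\<close> meets integer points only above multiples of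
  \<open>i0\<close>. On the side where the turned line rises above such a point, the next integer
  takes its place.\<close>

lemma germ_ceiling_eq:
  assumes x: "x = of_int y0 / of_int i0" and i0: "0 < i0" and cop: "coprime y0 i0"
  shows "germ_ceiling (lgerm x) j = \<lceil>x * of_int j\<rceil> + (if i0 dvd j \<and> j < 0 then 1 else 0)"
    and "germ_ceiling (rgerm x) j = \<lceil>x * of_int j\<rceil> + (if i0 dvd j \<and> 0 < j then 1 else 0)"
proof -
  have int: "x * of_int j \<in> \<int> \<longleftrightarrow> i0 dvd j" for j
  proof
    assume "x * of_int j \<in> \<int>"
    then obtain k :: int where "x * of_int j = of_int k" by (auto elim: Ints_cases)
    then have "real_of_int (y0 * j) = of_int (k * i0)" using i0 by (simp add: x field_simps)
    then have "y0 * j = k * i0" by (simp only: of_int_eq_iff)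
    then show "i0 dvd j" using cop by (metis coprime_commute coprime_dvd_mult_right_iff dvd_triv_right)
  next
    assume "i0 dvd j"
    then obtain k where "j = i0 * k" ..
    then have "x * of_int j = of_int (y0 * k)" using i0 by (simp add: x)
    then show "x * of_int j \<in> \<int>" by (metis Ints_of_int)
  qed
  have ce: "\<lceil>x * of_int j\<rceil> = \<lfloor>x * of_int j\<rfloor> + (if i0 dvd j then 0 else 1)" for j :: int
    by (simp add: ceiling_altdef int[symmetric] Ints_def)
  have neg: "\<lfloor>x * of_int (- j)\<rfloor> = - \<lceil>x * of_int j\<rceil>" "\<lceil>x * of_int (- j)\<rceil> = - \<lfloor>x * of_int j\<rfloor>" for j :: int
    by (simp_all add: ceiling_def)
  show "germ_ceiling (lgerm x) j = \<lceil>x * of_int j\<rceil> + (if i0 dvd j \<and> j < 0 then 1 else 0)"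
    unfolding germ_ceiling_def lgerm_def neg by (auto simp: ce)
  show "germ_ceiling (rgerm x) j = \<lceil>x * of_int j\<rceil> + (if i0 dvd j \<and> 0 < j then 1 else 0)"
    unfolding germ_ceiling_def rgerm_def neg by (auto simp: ce)
qed

text \<open>The ordinary ceilings cancel: shifting the window by \<open>(tau div i0) * i0\<close>
  shifts each of them by the integer \<open>(tau div i0) * y0\<close>, which is balanced by the jump
  of \<open>VY\<close>. Only the corrections at multiples of \<open>i0\<close> survive.\<close>

lemma depth_jump:
  fixes X Y :: int
  assumes x: "x = of_int y0 / of_int i0" and i0: "0 < i0" and cop: "coprime y0 i0"
  defines "u \<equiv> X - VX (lgerm x)" and "u' \<equiv> X - VX (rgerm x)"
  shows "depth (rgerm x) X Y - depth (lgerm x) X Y =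
    int (card {j\<in>{u-r..u+r}. i0 dvd j \<and> j < 0}) - int (card {j\<in>{u'-r..u'+r}. i0 dvd j \<and> 0 < j})"
    and "u' = u - (tau div i0) * i0"
proof -
  let ?q = "tau div i0"
  show u': "u' = u - ?q * i0" using V_jump_rational(1)[OF assms(1-3)] by (simp add: u_def u'_def)
  have ci: "\<lceil>x * of_int (j - ?q * i0)\<rceil> = \<lceil>x * of_int j\<rceil> - ?q * y0" for j
  proof -
    have "x * of_int (j - ?q * i0) = x * of_int j - of_int (?q * y0)"
      using i0 by (simp add: x field_simps)
    then show ?thesis by (metis ceiling_diff_of_int)
  qed
  have card: "card {u-r..u+r} = nat tau" by (simp add: tau_def)
  have ind: "(\<Sum>j\<in>A. (if P j then 1 else 0::int)) = int (card {j\<in>A. P j})" if "finite A" for A and P :: "int \<Rightarrow> bool"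
    using that by (simp add: sum.inter_filter[symmetric])
  have "(\<Sum>j\<in>{u'-r..u'+r}. \<lceil>x * of_int j\<rceil>) = (\<Sum>j\<in>{u-r..u+r}. \<lceil>x * of_int (j - ?q * i0)\<rceil>)"
    by (rule sum.reindex_bij_witness[of _ "\<lambda>j. j - ?q * i0" "\<lambda>j. j + ?q * i0"]) (auto simp: u')
  also have "\<dots> = (\<Sum>j\<in>{u-r..u+r}. \<lceil>x * of_int j\<rceil>) - tau * (?q * y0)"
    using tau_pos by (simp only: ci sum_subtractf sum_constant card) simp
  finally have s: "(\<Sum>j\<in>{u'-r..u'+r}. \<lceil>x * of_int j\<rceil>) = (\<Sum>j\<in>{u-r..u+r}. \<lceil>x * of_int j\<rceil>) - tau * (?q * y0)" .
  have r: "(\<Sum>j\<in>{u'-r..u'+r}. germ_ceiling (rgerm x) j) = (\<Sum>j\<in>{u'-r..u'+r}. \<lceil>x * of_int j\<rceil>)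
      + int (card {j\<in>{u'-r..u'+r}. i0 dvd j \<and> 0 < j})"
    by (simp add: germ_ceiling_eq[OF assms(1-3)] sum.distrib ind)
  have l: "(\<Sum>j\<in>{u-r..u+r}. germ_ceiling (lgerm x) j) = (\<Sum>j\<in>{u-r..u+r}. \<lceil>x * of_int j\<rceil>)
      + int (card {j\<in>{u-r..u+r}. i0 dvd j \<and> j < 0})"
    by (simp add: germ_ceiling_eq[OF assms(1-3)] sum.distrib ind)
  have vy: "VY (rgerm x) = VY (lgerm x) + ?q * y0" using V_jump_rational(2)[OF assms(1-3)] by simp
  show "depth (rgerm x) X Y - depth (lgerm x) X Y =
    int (card {j\<in>{u-r..u+r}. i0 dvd j \<and> j < 0}) - int (card {j\<in>{u'-r..u'+r}. i0 dvd j \<and> 0 < j})"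
    unfolding depth_def u_def[symmetric] u'_def[symmetric] r l s vy by (simp add: algebra_simps)
qed

text \<open>
  Multiples of \<open>i0\<close> in a window of length \<open>tau\<close> are the only contributions to a jump, and one of
  the two counts vanishes unless the window has passed the strip. Hence, as a function of the slope,
  the depth of a point decreases until the window meets the strip and increases afterwards.
\<close>

lemma depth_germ_mono:
  "X - VX (lgerm x) \<le> r \<Longrightarrow> depth (lgerm x) X Y \<le> depth (rgerm x) X Y"
  "- r \<le> X - VX (rgerm x) \<Longrightarrow> depth (rgerm x) X Y \<le> depth (lgerm x) X Y"
proof (goal_cases)
  case 1
  show ?case
  proof (cases x rule: slope_cases)
    case irrat
    then show ?thesis using V_jump_irrational(3) by simp
  next
    case (rat y0 i0)
    let ?u = "X - VX (rgerm x)"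
    \<comment> \<open>After the jump the right end of the window is at most
      \<open>2 * r - (tau div i0) * i0\<close>, which is \<open>tau mod i0 - 1\<close>. So it stops
      short of \<open>i0\<close>, the first positive multiple. The other case is the mirror
      image.\<close>
    have "tau < (tau div i0 + 1) * i0" using rat(2)
      by (metis add.commute distrib_right mult.commute mult_1 mult_div_mod_eq pos_mod_bound add_less_cancel_left)
    then have "?u + r < i0"
      using 1 depth_jump(2)[OF rat, of X] by (simp add: tau_def algebra_simps)
    then have "{j\<in>{?u-r..?u+r}. i0 dvd j \<and> 0 < j} = {}" by (auto dest: zdvd_imp_le)
    then show ?thesis using depth_jump(1)[OF rat, of X Y] by (simp only:) simp
  qed
next
  case 2
  show ?case
  proof (cases x rule: slope_cases)
    case irrat
    then show ?thesis using V_jump_irrational(3) by simp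
  next
    case (rat y0 i0)
    let ?u = "X - VX (lgerm x)"
    have "tau < (tau div i0 + 1) * i0" using rat(2)
      by (metis add.commute distrib_right mult.commute mult_1 mult_div_mod_eq pos_mod_bound add_less_cancel_left)
    then have lt: "- i0 < ?u - r"
      using 2 depth_jump(2)[OF rat, of X] by (simp add: tau_def algebra_simps)
    have "\<not> (i0 dvd j \<and> j < 0)" if "?u - r \<le> j" for j
    proof
      assume "i0 dvd j \<and> j < 0"
      then have "i0 \<le> - j" by (intro zdvd_imp_le) auto
      then show False using lt that by simp
    qed
    then have "{j\<in>{?u-r..?u+r}. i0 dvd j \<and> j < 0} = {}" by auto
    then show ?thesis using depth_jump(1)[OF rat, of X Y] by (simp only:) simp
  qed
qed

lemma local_germs:
  fixes x :: real and X Y :: int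
  obtains d where "d > 0"
    "\<And>b. x \<le> b \<Longrightarrow> b < x + d \<Longrightarrow> Vx b = Vx x \<and> Vy b = Vy x \<and> N b X Y = N x X Y"
    "\<And>b. x - d < b \<Longrightarrow> b < x \<Longrightarrow> Vx b = VX (lgerm x) \<and> Vy b = VY (lgerm x) \<and> N b X Y = depth (lgerm x) X Y"
proof -
  define B where "B = tau + (\<bar>X - Vx x\<bar> + r) + (\<bar>X - VX (lgerm x)\<bar> + r)"
  have B: "tau \<le> B" "\<bar>X - Vx x\<bar> + r \<le> B" "\<bar>X - VX (lgerm x)\<bar> + r \<le> B"
    using r_nonneg tau_pos by (auto simp: B_def)
  obtain d where d: "d > 0"
    "\<And>b j. x \<le> b \<Longrightarrow> b < x + d \<Longrightarrow> 0 < j \<Longrightarrow> j \<le> B \<Longrightarrow> \<lfloor>b * j\<rfloor> = \<lfloor>x * j\<rfloor>"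
    "\<And>b j. x - d < b \<Longrightarrow> b < x \<Longrightarrow> 0 < j \<Longrightarrow> j \<le> B \<Longrightarrow> \<lfloor>b * j\<rfloor> = \<lceil>x * j\<rceil> - 1"
    using floors_locally_constant[of x B] by metis
  show thesis
  proof (rule that[OF d(1)])
    fix b assume b: "x \<le> b" "b < x + d"
    have e: "rgerm x j = rgerm b j" if "0 < j" "j \<le> B" for j
      using d(2)[OF b that] by (simp add: rgerm_def)
    show "Vx b = Vx x \<and> Vy b = Vy x \<and> N b X Y = N x X Y"
      using e B by (auto intro!: VX_cong VY_cong depth_cong[symmetric, OF e])
  next
    fix b assume b: "x - d < b" "b < x"
    have e: "lgerm x j = rgerm b j" if "0 < j" "j \<le> B" for j
      using d(3)[OF b that] by (simp add: rgerm_def lgerm_def)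
    show "Vx b = VX (lgerm x) \<and> Vy b = VY (lgerm x) \<and> N b X Y = depth (lgerm x) X Y"
      using e B by (auto intro!: VX_cong VY_cong depth_cong[symmetric, OF e])
  qed
qed

text \<open>\<open>local_germs\<close> turns the inequality between the two germs at a slope into
  monotonicity nearby, with a radius depending on the slope; bisection glues the pieces. The
  assumption persists to the right because \<open>Vx\<close> is monotone.\<close>

lemma N_increasing:
  assumes "a \<le> b" "X - Vx a \<le> r"
  shows "N a X Y \<le> N b X Y"
proof -
  have "X - Vx a \<le> r \<longrightarrow> N a X Y \<le> N b X Y"
    using assms(1)
  proof (induction a b rule: Bolzano)
    case (trans a b c)
    then show ?case using Vx_mono[of a b] by auto
  next
    case (local x)
    obtain d where d: "d > 0"
      "\<And>b. x \<le> b \<Longrightarrow> b < x + d \<Longrightarrow> Vx b = Vx x \<and> Vy b = Vy x \<and> N b X Y = N x X Y"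
      "\<And>b. x - d < b \<Longrightarrow> b < x \<Longrightarrow> Vx b = VX (lgerm x) \<and> Vy b = VY (lgerm x) \<and> N b X Y = depth (lgerm x) X Y"
      using local_germs[of x X Y] by metis
    have "X - Vx a \<le> r \<longrightarrow> N a X Y \<le> N b X Y" if "a \<le> x" "x \<le> b" "b - a < d" for a b
      using d(2)[of b] d(3)[of a] depth_germ_mono(1)[of X x Y] that by (cases "a = x") auto
    then show ?case using d(1) by blast
  qed
  then show ?thesis using assms by blast
qed

lemma N_decreasing:
  assumes "a \<le> b" "- r \<le> X - Vx b"
  shows "N b X Y \<le> N a X Y"
proof -
  have "- r \<le> X - Vx b \<longrightarrow> N b X Y \<le> N a X Y"
    using assms(1)
  proof (induction a b rule: Bolzano)
    case (trans a b c)
    then show ?case using Vx_mono[of b c] by auto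
  next
    case (local x)
    obtain d where d: "d > 0"
      "\<And>b. x \<le> b \<Longrightarrow> b < x + d \<Longrightarrow> Vx b = Vx x \<and> Vy b = Vy x \<and> N b X Y = N x X Y"
      "\<And>b. x - d < b \<Longrightarrow> b < x \<Longrightarrow> Vx b = VX (lgerm x) \<and> Vy b = VY (lgerm x) \<and> N b X Y = depth (lgerm x) X Y"
      using local_germs[of x X Y] by metis
    have "- r \<le> X - Vx b \<longrightarrow> N b X Y \<le> N a X Y" if "a \<le> x" "x \<le> b" "b - a < d" for a b
      using d(2)[of b] d(3)[of a] depth_germ_mono(2)[of X x Y] that by (cases "a = x") auto
    then show ?case using d(1) by blast
  qed
  then show ?thesis using assms by blast
qed

lemma N_minimal:
  assumes "\<bar>X - Vx s\<bar> \<le> r"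
  shows "N s X Y \<le> N s' X Y"
  using N_increasing[of s s' X Y] N_decreasing[of s' s X Y] assms by (cases "s \<le> s'") auto

subsection \<open>Peeling the sets of given depth\<close>

text \<open>The intercept of the supporting line through the vertex \<open>V s\<close>: up to sign
  the Legendre transform of the polygon, hence concave in \<open>s\<close>.\<close>

definition support :: "real \<Rightarrow> real" where "support s = real_of_int (Vy s) - s * real_of_int (Vx s)"

definition U :: "int \<Rightarrow> (int \<times> int) set" where
  "U k = {(X, Y). \<forall>s. k \<le> N s X Y}"

lemma N_shift: "N s X (Y + c) = N s X Y + tau * c"
  by (simp add: depth_def algebra_simps)

lemma sum_window_int: "(\<Sum>j\<in>{u - r..u + r}. f j) = (\<Sum>x\<in>{-r..r}. f (u - x))"
  by (rule sum.reindex_bij_witness[of _ "\<lambda>x. u - x" "\<lambda>j. u - j"]) auto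

lemma sum_symmetric: "(\<Sum>x\<in>{-r..r}. real_of_int x) = 0"
proof -
  have "(\<Sum>x\<in>{-r..r}. real_of_int x) = (\<Sum>x\<in>{-r..r}. - real_of_int x)"
    by (rule sum.reindex_bij_witness[of _ uminus uminus]) auto
  then show ?thesis by (simp add: sum_negf)
qed

lemma card_strip: "real (card {-r..r}) = tau"
  using r_nonneg by (simp add: tau_def)

lemma sum_window:
  fixes s c :: real
  shows "(\<Sum>j\<in>{u - r..u + r}. s * real_of_int j + c) = tau * (s * u + c)"
proof -
  have "(\<Sum>j\<in>{u - r..u + r}. s * real_of_int j + c) = (\<Sum>x\<in>{-r..r}. (s * u + c) - s * real_of_int x)"
    by (subst sum_window_int) (auto simp: algebra_simps)
  also have "\<dots> = real (card {-r..r}) * (s * u + c) - s * (\<Sum>x\<in>{-r..r}. real_of_int x)"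
    by (simp only: sum_subtractf sum_constant sum_distrib_left)
  finally show ?thesis using sum_symmetric card_strip by simp
qed

text \<open>Each of the \<open>tau\<close> ceilings exceeds the height of the line by at most 1, and
  over a window symmetric about its centre the linear parts add up to \<open>tau\<close> times the
  central value. So depth divided by \<open>tau\<close> is height above the supporting line up to 1,
  whence the speed \<open>1 / tau\<close>.\<close>

lemma N_bounds:
  shows "real_of_int (N s X Y) \<le> tau * (Y - s * X - support s)"
    and "tau * (Y - s * X - support s) - tau \<le> real_of_int (N s X Y)"
proof -
  have c: "s * of_int j \<le> of_int (germ_ceiling (rgerm s) j)" "of_int (germ_ceiling (rgerm s) j) \<le> s * of_int j + 1" for j
    unfolding germ_ceiling_def rgerm_def by (auto, linarith+)
  let ?W = "{X - Vx s - r..X - Vx s + r}"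
  have lo: "(\<Sum>j\<in>?W. s * of_int j + 0) \<le> (\<Sum>j\<in>?W. real_of_int (germ_ceiling (rgerm s) j))"
    by (rule sum_mono) (use c in auto)
  have hi: "(\<Sum>j\<in>?W. real_of_int (germ_ceiling (rgerm s) j)) \<le> (\<Sum>j\<in>?W. s * of_int j + 1)"
    by (rule sum_mono) (use c in auto)
  have N: "real_of_int (N s X Y) = tau * (real_of_int Y - Vy s) - (\<Sum>j\<in>?W. real_of_int (germ_ceiling (rgerm s) j))"
    by (simp add: depth_def)
  have e: "tau * (Y - s * X - support s) = tau * (real_of_int Y - Vy s) - tau * (s * (X - Vx s))"
    by (simp add: support_def algebra_simps)
  show "real_of_int (N s X Y) \<le> tau * (Y - s * X - support s)"
    using lo sum_window[where s = s and c = 0 and u = "X - Vx s"] N e by (simp only: add_0_right)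
  show "tau * (Y - s * X - support s) - tau \<le> real_of_int (N s X Y)"
    using hi sum_window[where s = s and c = 1 and u = "X - Vx s"] N e by (simp only: distrib_left mult_1_right)
qed

text \<open>Up to an additive constant, the number of lattice points \<open>(x, z)\<close> of the
  strip with \<open>z - s * x \<le> y\<close>. At an irrational slope the depth is this function of
  the height alone.\<close>

definition strip_count :: "real \<Rightarrow> real \<Rightarrow> int" where
  "strip_count s y = (\<Sum>x\<in>{-r..r}. \<lfloor>y + s * of_int x\<rfloor>)"

lemma N_irrational:
  assumes "s \<notin> \<rat>"
  shows "N s X Y = strip_count s (Y - s * X - support s)"
proof -
  have sj: "s * of_int j \<notin> \<int>" if "j \<noteq> 0" for j :: int
  proof
    assume "s * of_int j \<in> \<int>"
    then obtain k :: int where "s * of_int j = of_int k" by (auto elim: Ints_cases)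
    then have "s = of_int k / of_int j" using that by (simp add: field_simps)
    then show False using assms by simp
  qed
  have germ_ceiling: "germ_ceiling (rgerm s) j = \<lceil>s * of_int j\<rceil>" for j
    using sj[of j] unfolding germ_ceiling_def rgerm_def
    by (auto simp: ceiling_altdef floor_minus) (metis Ints_of_int)+
  have "N s X Y = (\<Sum>x\<in>{-r..r}. (Y - Vy s) - germ_ceiling (rgerm s) (X - Vx s - x))"
    unfolding depth_def sum_window_int using r_nonneg by (simp add: sum_subtractf tau_def)
  also have "\<dots> = strip_count s (Y - s * X - support s)"
    unfolding strip_count_def
  proof (rule sum.cong[OF refl])
    fix x
    have "Y - s * X - support s + s * of_int x = of_int (Y - Vy s) - s * of_int (X - Vx s - x)"
      by (simp add: support_def algebra_simps)
    then show "Y - Vy s - germ_ceiling (rgerm s) (X - Vx s - x) = \<lfloor>Y - s * X - support s + s * of_int x\<rfloor>"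
      unfolding germ_ceiling by (simp only: floor_diff_of_int ceiling_def) linarith
  qed
  finally show ?thesis .
qed

lemma strip_count_strict:
  assumes "\<bar>x\<bar> \<le> r" "y' < of_int z - s * of_int x"
  shows "strip_count s y' < strip_count s (of_int z - s * of_int x)"
  unfolding strip_count_def
proof (rule sum_strict_mono_ex1)
  show "\<forall>xa\<in>{- r..r}. \<lfloor>y' + s * of_int xa\<rfloor> \<le> \<lfloor>of_int z - s * of_int x + s * of_int xa\<rfloor>"
    using assms by (auto intro: floor_mono)
  have "\<lfloor>y' + s * of_int x\<rfloor> < \<lfloor>of_int z - s * of_int x + s * of_int x\<rfloor>"
    using assms(2) by (simp add: floor_less_iff)
  then show "\<exists>a\<in>{- r..r}. \<lfloor>y' + s * of_int a\<rfloor> < \<lfloor>of_int z - s * of_int x + s * of_int a\<rfloor>"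
    using assms(1) by (intro bexI[of _ x]) auto
qed simp

text \<open>Raising a point by 1 raises the count by \<open>tau\<close>, so it suffices to meet
  every residue modulo \<open>tau\<close>. The \<open>tau\<close> columns have distinct residues,
  since equal counts would put strip points of two columns at the same height; hence they meet all
  residues.\<close>

lemma strip_count_surj:
  assumes s: "s \<notin> \<rat>"
  obtains x z where "\<bar>x\<bar> \<le> r" "strip_count s (of_int z - s * of_int x) = k"
proof -
  have shift: "strip_count s (of_int z + y) = tau * z + strip_count s y" for z y
  proof -
    have "strip_count s (of_int z + y) = (\<Sum>x\<in>{-r..r}. z + \<lfloor>y + s * of_int x\<rfloor>)"
      unfolding strip_count_def by (rule sum.cong) (auto simp: add.assoc)
    then show ?thesis using r_nonneg by (simp add: sum.distrib strip_count_def tau_def)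
  qed
  define f where "f x = strip_count s (- s * of_int x) mod tau" for x
  have "inj_on f {-r..r}"
  proof (rule inj_onI)
    fix x x' assume xx: "x \<in> {-r..r}" "x' \<in> {-r..r}" and "f x = f x'"
    then have "tau dvd strip_count s (- s * of_int x') - strip_count s (- s * of_int x)"
      unfolding f_def by (metis mod_eq_dvd_iff)
    then obtain c where "strip_count s (- s * of_int x') - strip_count s (- s * of_int x) = tau * c" ..
    then have eq: "strip_count s (of_int 0 - s * of_int x') = strip_count s (of_int c - s * of_int x)"
      using shift[of c "- s * of_int x"] by simp
    have "\<bar>x\<bar> \<le> r" "\<bar>x'\<bar> \<le> r" using xx by auto
    then have "of_int 0 - s * of_int x' = of_int c - s * of_int x"
      using strip_count_strict[of x "of_int 0 - s * of_int x'" c s] strip_count_strict[of x' "of_int c - s * of_int x" 0 s] eq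
      by (cases "of_int 0 - s * of_int x'" "of_int c - s * of_int x" rule: linorder_cases) auto
    then have "of_int c = s * of_int (x - x')" by (simp add: algebra_simps)
    then show "x = x'" using irrational_collinear[OF s] by fastforce
  qed
  moreover have "f ` {-r..r} \<subseteq> {0..<tau}" using tau_pos by (auto simp: f_def)
  ultimately have "f ` {-r..r} = {0..<tau}"
    by (intro card_subset_eq) (auto simp: card_image tau_def)
  moreover have "k mod tau \<in> {0..<tau}" using tau_pos by simp
  ultimately obtain x where x: "x \<in> {-r..r}" "f x = k mod tau" by (metis imageE)
  then have "tau dvd k - strip_count s (- s * of_int x)" unfolding f_def by (metis mod_eq_dvd_iff)
  then obtain z where "k - strip_count s (- s * of_int x) = tau * z" ..
  then have "strip_count s (of_int z - s * of_int x) = k" using shift[of z "- s * of_int x"] by simp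
  then show thesis using that[of x z] x(1) by auto
qed

section \<open>Every abscissa lies in the translated strip of some irrational slope\<close>

lemma Vx_growth: assumes "a \<le> b" shows "\<lfloor>b\<rfloor> - \<lfloor>a\<rfloor> \<le> Vx b - Vx a"
proof -
  let ?h = "\<lambda>i. \<Sum>y | y \<in> {rgerm a i<..rgerm b i} \<and> coprime y i. (tau div i) * i"
  have eq: "Vx b - Vx a = (\<Sum>i\<in>{0<..tau}. ?h i)"
    using assms by (intro V_diff) (auto simp: rgerm_def intro!: floor_mono mult_right_mono)
  \<comment> \<open>The vectors \<open>(1, y)\<close> alone advance the vertex by \<open>tau\<close>
    per integer slope; this crude bound is enough for unboundedness.\<close>
  have le: "?h 1 \<le> (\<Sum>i\<in>{0<..tau}. ?h i)"
    using tau_pos by (intro member_le_sum) (auto intro!: sum_nonneg simp: pos_imp_zdiv_nonneg_iff)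
  have "{y. y \<in> {rgerm a 1<..rgerm b 1} \<and> coprime y 1} = {\<lfloor>a\<rfloor><..\<lfloor>b\<rfloor>}" by (auto simp: rgerm_def)
  then have "?h 1 = tau * (\<lfloor>b\<rfloor> - \<lfloor>a\<rfloor>)" using floor_mono[OF assms] by simp
  moreover have "1 * (\<lfloor>b\<rfloor> - \<lfloor>a\<rfloor>) \<le> tau * (\<lfloor>b\<rfloor> - \<lfloor>a\<rfloor>)"
    using tau_pos floor_mono[OF assms] by (intro mult_right_mono) auto
  ultimately have "\<lfloor>b\<rfloor> - \<lfloor>a\<rfloor> \<le> ?h 1" by (simp only: mult_1)
  then show ?thesis unfolding eq using le by (rule order_trans)
qed

lemma Vx_unbounded: obtains s and n :: nat where "s \<notin> \<rat>" "s \<le> 0" "Vx s \<le> c" "c' \<le> Vx (s + real n)"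
proof -
  define L where "L = - \<bar>c\<bar> - \<bar>Vx 0\<bar> - 1"
  obtain s :: real where s: "of_int L - 1 < s" "s < of_int L" "s \<notin> \<rat>"
    by (rule exists_irrational_between[of "of_int L - 1" "of_int L"]) simp
  have L: "L \<le> - 1" by (simp add: L_def)
  then have "real_of_int L \<le> - 1" by linarith
  then have s0: "s \<le> 0" using s by linarith
  have "\<lfloor>s\<rfloor> < L" using s(2) by (simp add: floor_less_iff)
  moreover have "\<lfloor>0::real\<rfloor> - \<lfloor>s\<rfloor> \<le> Vx 0 - Vx s" using s0 by (rule Vx_growth)
  ultimately have 1: "Vx s \<le> c" unfolding L_def by simp
  obtain n :: nat where n: "int n = \<bar>c'\<bar> + \<bar>Vx s\<bar>" by (metis abs_ge_zero add_nonneg_nonneg nonneg_int_cases)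
  have "\<lfloor>s + real n\<rfloor> - \<lfloor>s\<rfloor> \<le> Vx (s + real n) - Vx s" by (rule Vx_growth) simp
  moreover have "\<lfloor>s + real n\<rfloor> = \<lfloor>s\<rfloor> + int n" by (metis floor_add_int of_int_of_nat_eq)
  ultimately have "c' \<le> Vx (s + real n)" using n by linarith
  then show thesis using that s(3) s0 1 by blast
qed

text \<open>\<open>Vx\<close> cannot jump over the strip: a jump is at most \<open>tau\<close>,
  while the interval from \<open>X - r\<close> to \<open>X + r\<close> contains
  \<open>2 * r + 1 = tau\<close> integers. At the infimum of the slopes with
  \<open>X - r \<le> Vx s\<close> the vertex is therefore in range, and it stays put slightly to the
  right, where irrational slopes exist.\<close>

lemma strip_slope:
  obtains s where "s \<notin> \<rat>" "\<bar>X - Vx s\<bar> \<le> r"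
proof -
  define A where "A = {s. X - r \<le> Vx s}"
  obtain a n where a: "Vx a \<le> X - r - 1" "X - r \<le> Vx (a + real n)"
    using Vx_unbounded[of "X - r - 1" "X - r"] by metis
  have ne: "A \<noteq> {}" using a by (auto simp: A_def)
  have lb: "a \<le> s" if "s \<in> A" for s
    using that a(1) Vx_mono[of s a] by (force simp: A_def)
  then have bdd: "bdd_below A" by (auto simp: bdd_below_def)
  define x where "x = Inf A"
  obtain d where d: "d > 0"
    "\<And>b. x \<le> b \<Longrightarrow> b < x + d \<Longrightarrow> Vx b = Vx x \<and> Vy b = Vy x \<and> N b X 0 = N x X 0"
    "\<And>b. x - d < b \<Longrightarrow> b < x \<Longrightarrow> Vx b = VX (lgerm x) \<and> Vy b = VY (lgerm x) \<and> N b X 0 = depth (lgerm x) X 0"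
    using local_germs[of x X 0] by metis
  obtain s where s: "s \<in> A" "s < x + d"
    using cInf_lessD[OF ne, of "x + d"] d(1) x_def by auto
  have "x \<le> s" using s(1) bdd by (simp add: x_def cInf_lower)
  then have lo: "X - r \<le> Vx x" using d(2)[of s] s by (simp add: A_def)
  have "x - d / 2 \<notin> A" using d(1) bdd cInf_lower[of "x - d / 2" A] by (auto simp: x_def)
  then have "Vx (x - d / 2) < X - r" by (simp add: A_def)
  then have l: "VX (lgerm x) < X - r" using d(3)[of "x - d / 2"] d(1) by simp
  have "Vx x - VX (lgerm x) \<le> tau"
  proof (cases x rule: slope_cases)
    case irrat
    then show ?thesis using V_jump_irrational(1)[of x] tau_pos by simp
  next
    case (rat y0 i0)
    have "tau div i0 * i0 \<le> tau" using rat(2) by (metis div_mult_mod_eq le_add_same_cancel1 pos_mod_sign)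
    then show ?thesis using V_jump_rational(1)[OF rat] by simp
  qed
  then have hi: "Vx x \<le> X + r" using l by (simp add: tau_def)
  obtain t where t: "x < t" "t < x + d" "t \<notin> \<rat>"
    using exists_irrational_between[of x "x + d"] d(1) by auto
  then have "\<bar>X - Vx t\<bar> \<le> r" using lo hi d(2)[of t] by auto
  then show thesis using that t by blast
qed

abbreviation pt :: "int \<times> int \<Rightarrow> real \<times> real" where
  "pt p \<equiv> (real_of_int (fst p), real_of_int (snd p))"

text \<open>The depth of a point is smallest at a slope \<open>s\<close> whose translated strip
  contains it, so a point lost from \<open>U (k + 1)\<close> has depth exactly \<open>k\<close>
  there. As the count strictly increases at a strip point and heights at an irrational slope are
  distinct, it is the unique lowest point of \<open>U k\<close> in that direction.\<close>

lemma extreme_if_minimal_depth: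
  assumes "(X, Y) \<in> U k" "(X, Y) \<notin> U (k + 1)"
  shows "pt (X, Y) extreme_point_of (convex hull (pt ` U k))"
proof -
  obtain s0 where s0: "N s0 X Y < k + 1" using assms(2) by (auto simp: U_def not_le)
  obtain s where s: "s \<notin> \<rat>" "\<bar>X - Vx s\<bar> \<le> r" using strip_slope by blast
  have Nk: "N s X Y = k"
  proof -
    have "k \<le> N s X Y" using assms(1) by (simp add: U_def)
    then show ?thesis using N_minimal[OF s(2), of Y s0] s0 by linarith
  qed
  have eq: "Y - s * X - support s = of_int (Y - Vy s) - s * of_int (X - Vx s)"
    by (simp add: support_def algebra_simps)
  have "Y - s * X < Y' - s * X'" if q: "(X', Y') \<in> U k" "(X', Y') \<noteq> (X, Y)" for X' Y'
  proof (rule ccontr)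
    assume "\<not> Y - s * X < Y' - s * X'"
    then consider "Y' - s * X' < Y - s * X" | "Y' - s * X' = Y - s * X" by linarith
    then show False
    proof cases
      case 1
      then have "Y' - s * X' - support s < of_int (Y - Vy s) - s * of_int (X - Vx s)" using eq by simp
      from strip_count_strict[OF s(2) this] have "N s X' Y' < N s X Y"
        using N_irrational[OF s(1)] eq by metis
      moreover have "k \<le> N s X' Y'" using q(1) by (simp add: U_def)
      ultimately show False using Nk by linarith
    next
      case 2
      then have "of_int (Y' - Y) = s * of_int (X' - X)" by (simp add: algebra_simps)
      from irrational_collinear[OF s(1) this] show False using q(2) by auto
    qed
  qed
  then have lt: "(- s, 1) \<bullet> pt (X, Y) < (- s, 1) \<bullet> pt q" if "q \<in> U k" "q \<noteq> (X, Y)" for q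
    using that by (cases q) auto
  show ?thesis
  proof (rule strictly_minimal_extreme[where a = "(- s, 1)"])
    show "pt (X, Y) \<in> pt ` U k" using assms(1) by (rule imageI)
    show "(- s, 1) \<bullet> pt (X, Y) < (- s, 1) \<bullet> q" if "q \<in> pt ` U k" "q \<noteq> pt (X, Y)" for q
      using that lt by blast
  qed
qed

text \<open>
  Since the depth of a point is smallest at the slopes whose window meets the strip, the \<open>k\<close>-th strip
  point in the order of height above lines of slope \<open>s\<close>, shifted to \<open>(Vx s, Vy s)\<close>, has depth exactly \<open>k\<close>.
\<close>

lemma minimal_vertex:
  assumes s: "s \<notin> \<rat>"
  obtains X Y where "(X, Y) \<in> U k" "\<bar>X - Vx s\<bar> \<le> r" "N s X Y = k"
proof -
  obtain x z where xz: "\<bar>x\<bar> \<le> r" "strip_count s (of_int z - s * of_int x) = k" using strip_count_surj[OF s] by blast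
  have "real_of_int (Vy s + z) - s * real_of_int (Vx s + x) - support s = of_int z - s * of_int x"
    by (simp add: support_def algebra_simps)
  then have N: "N s (Vx s + x) (Vy s + z) = k"
    using N_irrational[OF s, of "Vx s + x" "Vy s + z"] xz(2) by metis
  have "k \<le> N s' (Vx s + x) (Vy s + z)" for s'
    using N_minimal[of "Vx s + x" s "Vy s + z" s'] xz(1) N by simp
  then show thesis using that[of "Vx s + x" "Vy s + z"] N xz(1) by (auto simp: U_def)
qed

lemma U_up: "(X, Y) \<in> U k \<Longrightarrow> (X, Y + 1) \<in> U k"
  using tau_pos by (auto simp: U_def N_shift) (smt (verit))

lemma U_mono: "k \<le> l \<Longrightarrow> U l \<subseteq> U k" by (auto simp: U_def) (meson order_trans)

text \<open>At every irrational slope, depth greater than \<open>k\<close> means lying strictly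
  above the vertex \<open>v s\<close> of depth \<open>k\<close>. What has to be found is one chord
  between two such vertices that passes through or below the point.\<close>

lemma not_extreme_if_deeper:
  assumes p: "(X, Y) \<in> U (k + 1)"
  shows "\<not> pt (X, Y) extreme_point_of (convex hull (pt ` U k))"
proof -
  have "\<exists>P. s \<notin> \<rat> \<longrightarrow> P \<in> U k \<and> \<bar>fst P - Vx s\<bar> \<le> r \<and> N s (fst P) (snd P) = k" for s
    using minimal_vertex[of s k] by (metis fst_conv snd_conv)
  then obtain v where v: "\<And>s. s \<notin> \<rat> \<Longrightarrow> v s \<in> U k \<and> \<bar>fst (v s) - Vx s\<bar> \<le> r \<and> N s (fst (v s)) (snd (v s)) = k"
    by metis
  have below: "real_of_int (snd (v s)) - s * real_of_int (fst (v s)) < real_of_int Y - s * real_of_int X"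
    if s: "s \<notin> \<rat>" for s :: real
  proof (rule ccontr)
    assume "\<not> ?thesis"
    then have "strip_count s (Y - s * X - support s) \<le> strip_count s (snd (v s) - s * fst (v s) - support s)"
      unfolding strip_count_def by (intro sum_mono floor_mono) simp
    then have "N s X Y \<le> k" using N_irrational[OF s] v[OF s] by simp
    moreover have "k + 1 \<le> N s X Y" using p by (simp add: U_def)
    ultimately show False by linarith
  qed
  have up: "pt (X, Y + 1) \<in> convex hull (pt ` U k)"
    using U_up[OF p] U_mono[of k "k + 1"] by (intro hull_inc imageI) auto
  \<comment> \<open>Walk through the slopes in small rational steps from vertices left of \<open>X\<close> to vertices right of \<open>X\<close>.
    The steps are so small that integrality puts \<open>(X, Y)\<close> on or above the segment at the crossing.\<close>
  obtain s0 n where s0: "s0 \<notin> \<rat>" "Vx s0 \<le> X - r - 1" "X + r + 1 \<le> Vx (s0 + real n)"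
    using Vx_unbounded[of "X - r - 1" "X + r + 1"] by metis
  define Bd where "Bd = \<bar>Vx s0\<bar> + \<bar>Vx (s0 + n)\<bar> + \<bar>X\<bar> + r"
  have Bd: "\<bar>fst (v s) - X\<bar> \<le> Bd" if "s0 \<le> s" "s \<le> s0 + n" "s \<notin> \<rat>" for s
    using v[OF that(3)] Vx_mono[OF that(1)] Vx_mono[OF that(2)] by (auto simp: Bd_def)
  have Bd0: "0 \<le> Bd" using r_nonneg by (simp add: Bd_def)
  \<comment> \<open>The chord can pass above the point by less than
    \<open>(s j - s i) * A * B\<close>, after clearing denominators, with horizontal distances
    \<open>A\<close>, \<open>B\<close> at most \<open>Bd\<close>. Slope steps \<open>1 / Q\<close>
    with \<open>Q > Bd * Bd\<close> push this below 1.\<close>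
  define Q where "Q = nat (Bd * Bd + 1)"
  have Q: "real Q = Bd * Bd + 1" "0 < Q" using Bd0 by (auto simp: Q_def)
  define s where "s j = s0 + real j / real Q" for j
  have s_irr: "s j \<notin> \<rat>" for j
  proof
    assume "s j \<in> \<rat>"
    then have "s j - real j / real Q \<in> \<rat>" by (intro Rats_diff Rats_divide) auto
    then show False using s0(1) by (simp add: s_def)
  qed
  have sn: "s (n * Q) = s0 + n" using Q(2) by (simp add: s_def)
  define j where "j = (LEAST j. X < fst (v (s j)))"
  have ex: "X < fst (v (s (n * Q)))"
    using v[OF s_irr, of "n * Q"] s0(3) unfolding sn by auto
  have j: "X < fst (v (s j))" unfolding j_def using ex by (rule LeastI)
  have j_le: "j \<le> n * Q" unfolding j_def using ex by (rule Least_le)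
  have s00: "s 0 = s0" by (simp add: s_def)
  have "fst (v s0) < X" using v[OF s0(1)] s0(2) by auto
  then have "j \<noteq> 0" using j s00 by (metis not_less_iff_gr_or_eq)
  then obtain i where i: "j = Suc i" by (cases j) auto
  have "\<not> X < fst (v (s i))" using not_less_Least[of i "\<lambda>j. X < fst (v (s j))"] i j_def by simp
  then consider "fst (v (s i)) = X" | "fst (v (s i)) < X" by linarith
  then show ?thesis
  proof cases
    case 1
    then have "snd (v (s i)) < Y" using below[OF s_irr, of i] by simp
    then have "pt (X, Y) \<in> open_segment (pt (v (s i))) (pt (X, Y + 1))"
      using vertical_open_segment[of "snd (v (s i))" Y "Y + 1" X] 1 by simp
    moreover have "pt (v (s i)) \<in> convex hull (pt ` U k)" using v[OF s_irr] by (intro hull_inc imageI) auto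
    ultimately show ?thesis using up unfolding extreme_point_of_def by blast
  next
    case 2
    let ?v1 = "v (s i)" and ?v2 = "v (s j)"
    have sji: "s j - s i = 1 / Q" by (simp add: s_def i diff_divide_distrib[symmetric])
    define A B where "A = fst ?v2 - X" and "B = X - fst ?v1"
    have AB: "0 < A" "0 < B" using j 2 by (auto simp: A_def B_def)
    have mono: "s a \<le> s b" if "a \<le> b" for a b using that by (simp add: s_def divide_right_mono)
    have ABd: "A \<le> Bd" "B \<le> Bd"
    proof -
      have "\<bar>fst ?v2 - X\<bar> \<le> Bd" "\<bar>fst ?v1 - X\<bar> \<le> Bd"
        using mono[of 0 j] mono[of 0 i] mono[of j "n*Q"] mono[of i "n*Q"] j_le i
        unfolding sn s00 by (simp_all add: Bd s_irr)
      then show "A \<le> Bd" "B \<le> Bd" by (auto simp: A_def B_def)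
    qed
    have b2: "real_of_int (snd ?v2) - Y < s j * A" and b1: "real_of_int (snd ?v1) - Y < - s i * B"
      using below[OF s_irr, of j] below[OF s_irr, of i] by (auto simp: A_def B_def algebra_simps)
    have "real_of_int ((snd ?v2 - Y) * B + (snd ?v1 - Y) * A) < s j * A * B + (- s i * B) * A"
    proof -
      have "(real_of_int (snd ?v2) - Y) * B < s j * A * B" using b2 AB by (intro mult_strict_right_mono) auto
      moreover have "(real_of_int (snd ?v1) - Y) * A < (- s i * B) * A" using b1 AB by (intro mult_strict_right_mono) auto
      ultimately show ?thesis by (simp only: of_int_add of_int_mult of_int_diff)
    qed
    also have "\<dots> = (s j - s i) * (A * B)" by (simp add: algebra_simps)
    also have "\<dots> \<le> (s j - s i) * (Bd * Bd)"
      using AB ABd Bd0 mono[of i j] i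
      by (intro mult_left_mono) (auto intro!: mult_mono simp flip: of_int_mult)
    also have "\<dots> < 1" unfolding sji using Q by (simp add: field_simps)
    finally have "real_of_int ((snd ?v2 - Y) * B + (snd ?v1 - Y) * A) < 1" .
    then have "(snd ?v2 - Y) * B + (snd ?v1 - Y) * A \<le> 0" by linarith
    then have le: "(real_of_int (snd ?v2) - Y) * (X - fst ?v1) + (real_of_int (snd ?v1) - Y) * (fst ?v2 - X) \<le> 0"
    proof -
      have "real_of_int ((snd ?v2 - Y) * B + (snd ?v1 - Y) * A) \<le> 0"
        using \<open>(snd ?v2 - Y) * B + (snd ?v1 - Y) * A \<le> 0\<close> by linarith
      then show ?thesis by (simp add: A_def B_def)
    qed
    show ?thesis
      using above_segment_not_extreme[of "of_int (fst ?v1)" "of_int (snd ?v1)" "convex hull (pt ` U k)"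
          "of_int (fst ?v2)" "of_int (snd ?v2)" "of_int X" "of_int Y"]
        v[OF s_irr, of i] v[OF s_irr, of j] up 2 j le
      by (auto intro!: hull_inc)
  qed
qed

lemma peel_U: "peel (pt ` U k) = pt ` U (k + 1)"
proof -
  have "pt p \<in> peel (pt ` U k) \<longleftrightarrow> p \<in> U (k + 1)" if "p \<in> U k" for p
    using that extreme_if_minimal_depth[of "fst p" "snd p" k] not_extreme_if_deeper[of "fst p" "snd p" k]
    by (auto simp: peel_def)
  moreover have "peel (pt ` U k) \<subseteq> pt ` U k" by (auto simp: peel_def)
  moreover have "U (k + 1) \<subseteq> U k" by (rule U_mono) simp
  ultimately show ?thesis by blast
qed

lemma peel_pow_U: "(peel ^^ n) (pt ` U k) = pt ` U (k + n)"
  by (induction n) (simp_all add: peel_U add.assoc add.commute[of 1])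

end

subsection \<open>The horizontal period\<close>

definition moebius :: "nat \<Rightarrow> int" where
  "moebius n = (if squarefree n then (- 1) ^ card (prime_factors n) else 0)"

lemma abs_moebius_le_1: "\<bar>moebius n\<bar> \<le> 1"
  by (simp add: moebius_def power_abs)

lemma moebius_1: "moebius (Suc 0) = 1"
  by (simp add: moebius_def)

lemma moebius_prime_mult:
  assumes "prime p" "\<not> p dvd d" "d > 0"
  shows "moebius (p * d) = - moebius d"
proof -
  have cop: "coprime p d" using assms by (simp add: prime_imp_coprime)
  have "squarefree (p * d) \<longleftrightarrow> squarefree d"
    using cop assms(1) by (meson squarefree_mult_coprime squarefree_multD(2) squarefree_prime)
  moreover have "prime_factors (p * d) = insert p (prime_factors d)"
    using assms by (simp add: prime_factors_product prime_prime_factors prime_gt_0_nat)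
  moreover have "p \<notin> prime_factors d" using assms by auto
  ultimately show ?thesis by (simp add: moebius_def)
qed

text \<open>Fix one prime \<open>p\<close> of \<open>n\<close> and pair each divisor
  \<open>d\<close> not divisible by \<open>p\<close> with \<open>p * d\<close>: the two terms
  cancel. The divisors left over are divisible by \<open>p ^ 2\<close> and contribute 0.\<close>

lemma sum_moebius_divisors:
  assumes "n > 0"
  shows "(\<Sum>d | d dvd n. moebius d) = (if n = 1 then 1 else 0)"
proof (cases "n = 1")
  case True
  then show ?thesis by (simp add: moebius_1)
next
  case False
  then obtain p where p: "prime p" "p dvd n" by (metis prime_factor_nat)
  let ?A = "{d. d dvd n \<and> \<not> p dvd d}"
  let ?B = "{d. d dvd n \<and> p dvd d}"
  let ?C = "{d. d dvd n \<and> p dvd d \<and> \<not> p * p dvd d}"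
  have fin: "finite {d. d dvd n}" using assms by simp
  have "(\<Sum>d | d dvd n. moebius d) = (\<Sum>d\<in>?A. moebius d) + (\<Sum>d\<in>?B. moebius d)"
    by (subst sum.union_disjoint[symmetric])
       (auto intro!: sum.cong intro: finite_subset[OF _ fin])
  also have "(\<Sum>d\<in>?B. moebius d) = (\<Sum>d\<in>?C. moebius d)"
  proof (rule sum.mono_neutral_right)
    show "finite ?B" by (rule finite_subset[OF _ fin]) auto
    show "?C \<subseteq> ?B" by auto
    show "\<forall>d\<in>?B - ?C. moebius d = 0"
    proof
      fix d assume "d \<in> ?B - ?C"
      then have "p ^ 2 dvd d" by (auto simp: power2_eq_square)
      moreover have "\<not> p dvd 1" using p(1) prime_nat_iff by auto
      ultimately have "\<not> squarefree d" by (rule not_squarefreeI)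
      then show "moebius d = 0" by (simp add: moebius_def)
    qed
  qed
  also have "(\<Sum>d\<in>?C. moebius d) = (\<Sum>d\<in>?A. moebius (p * d))"
  proof (rule sum.reindex_bij_witness[of _ "\<lambda>d. p * d" "\<lambda>d. d div p"])
    have p0: "p > 0" using p(1) prime_gt_0_nat by blast
    fix d assume d: "d \<in> ?C"
    then obtain e where e: "d = p * e" by (auto elim: dvdE)
    show "d div p \<in> ?A" using d e p0 by (auto dest: dvd_mult_right)
    show "p * (d div p) = d" using e p0 by simp
    show "moebius (p * (d div p)) = moebius d" using e p0 by simp
  next
    have p0: "p > 0" using p(1) prime_gt_0_nat by blast
    fix d assume d: "d \<in> ?A"
    show "p * d div p = d" using p0 by simp
    have "coprime p d" using d p(1) by (auto intro: prime_imp_coprime)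
    then have "p * d dvd n" using d p(2) by (auto intro: divides_mult)
    then show "p * d \<in> ?C" using d p0 by auto
  qed
  also have "\<dots> = (\<Sum>d\<in>?A. - moebius d)"
  proof (rule sum.cong[OF refl])
    fix d assume d: "d \<in> ?A"
    then have "d > 0" using assms by (auto intro: Nat.gr0I)
    then show "moebius (p * d) = - moebius d" using d p(1) by (intro moebius_prime_mult) auto
  qed
  finally show ?thesis using False by (simp add: sum_negf)
qed

lemma sum_divisors_swap:
  fixes F :: "nat \<Rightarrow> nat \<Rightarrow> 'a::comm_monoid_add"
  shows "(\<Sum>i\<in>{1..t}. \<Sum>e | e dvd i. F e (i div e)) = (\<Sum>e\<in>{1..t}. \<Sum>f\<in>{1..t div e}. F e f)"
proof -
  have "(\<Sum>i\<in>{1..t}. \<Sum>e | e dvd i. F e (i div e)) = (\<Sum>i\<in>{1..t}. \<Sum>e | e \<in> {1..t} \<and> e dvd i. F e (i div e))"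
  proof (intro sum.cong refl)
    fix i assume "i \<in> {1..t}"
    then show "{e. e dvd i} = {e. e \<in> {1..t} \<and> e dvd i}"
      by (auto intro: Nat.gr0I dest: dvd_imp_le simp: Suc_le_eq)
  qed
  also have "\<dots> = (\<Sum>e\<in>{1..t}. \<Sum>i | i \<in> {1..t} \<and> e dvd i. F e (i div e))"
    by (rule sum.swap_restrict) auto
  also have "\<dots> = (\<Sum>e\<in>{1..t}. \<Sum>f\<in>{1..t div e}. F e f)"
  proof (rule sum.cong[OF refl])
    fix e assume e: "e \<in> {1..t}"
    show "(\<Sum>i | i \<in> {1..t} \<and> e dvd i. F e (i div e)) = (\<Sum>f\<in>{1..t div e}. F e f)"
      by (rule sum.reindex_bij_witness[of _ "\<lambda>f. e * f" "\<lambda>i. i div e"])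
         (use e in \<open>auto simp: less_eq_div_iff_mult_less_eq mult.commute Suc_le_eq div_le_mono dvd_imp_le elim!: dvdE\<close>)
  qed
  finally show ?thesis .
qed

lemma harm_le_ln: "t > 0 \<Longrightarrow> harm t \<le> 1 + ln (real t)"
  using decseqD[OF decseq_harm_diff_ln, of 0 "t - 1"] by (simp add: harm_def)

lemma sum_card_divisors:
  "(\<Sum>i\<in>{1..t}. real (card {e. e dvd i})) \<le> real t * harm t"
proof -
  have "(\<Sum>i\<in>{1..t}. real (card {e. e dvd i})) = (\<Sum>i\<in>{1..t}. \<Sum>e | e dvd i. (1::real))" by simp
  also have "\<dots> = (\<Sum>e\<in>{1..t}. real (t div e))" by (subst sum_divisors_swap) simp
  also have "\<dots> \<le> (\<Sum>e\<in>{1..t}. real t / real e)" by (intro sum_mono) (metis of_nat_div_le_of_nat)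
  also have "\<dots> = real t * harm t" by (simp add: harm_def sum_distrib_left divide_inverse)
  finally show ?thesis .
qed

text \<open>Euler's totient in its Moebius form, the only form in which it occurs here.\<close>

definition phi :: "nat \<Rightarrow> real" where
  "phi i = (\<Sum>e | e dvd i. of_int (moebius e) * real (i div e))"

text \<open>The horizontal period: the advance of \<open>Vx\<close> when the slope grows by
  1.\<close>

definition width :: "nat \<Rightarrow> real" where
  "width t = (\<Sum>i\<in>{1..t}. real (t div i) * real i * phi i)"

definition layered_squares :: "nat \<Rightarrow> real" where
  "layered_squares m = (\<Sum>k\<in>{1..m}. \<Sum>f\<in>{1..m div k}. real f ^ 2)"

text \<open>With \<open>i = e * f\<close> a summand is \<open>moebius e * e * f ^ 2\<close> times
  \<open>t div (e * f)\<close>, and this last factor counts the \<open>k \<ge> 1\<close> with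
  \<open>k * f \<le> t div e\<close>. Summing over \<open>f\<close> inside gives layers of squares,
  which are easy to estimate.\<close>

lemma width_eq: "width t = (\<Sum>e\<in>{1..t}. of_int (moebius e) * real e * layered_squares (t div e))"
proof -
  let ?F = "\<lambda>e f. of_int (moebius e) * real e * (real (t div (e * f)) * real f ^ 2)"
  have "width t = (\<Sum>i\<in>{1..t}. \<Sum>e | e dvd i. ?F e (i div e))"
    unfolding width_def phi_def sum_distrib_left
    by (intro sum.cong refl) (auto simp: power2_eq_square elim!: dvdE)
  also have "\<dots> = (\<Sum>e\<in>{1..t}. \<Sum>f\<in>{1..t div e}. ?F e f)" by (rule sum_divisors_swap)
  also have "\<dots> = (\<Sum>e\<in>{1..t}. of_int (moebius e) * real e * layered_squares (t div e))"
  proof (rule sum.cong[OF refl])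
    fix e
    let ?m = "t div e"
    have "(\<Sum>f\<in>{1..?m}. real (t div (e * f)) * real f ^ 2) = (\<Sum>f\<in>{1..?m}. \<Sum>k | k \<in> {1..?m} \<and> k * f \<le> ?m. real f ^ 2)"
    proof (rule sum.cong[OF refl])
      fix f assume f: "f \<in> {1..?m}"
      have "{k. k \<in> {1..?m} \<and> k * f \<le> ?m} = {1..?m div f}"
        using f by (auto simp: less_eq_div_iff_mult_less_eq intro: order_trans[OF _ div_le_dividend])
          (metis Suc_le_eq div_le_dividend le_trans less_eq_div_iff_mult_less_eq)
      then show "real (t div (e * f)) * real f ^ 2 = (\<Sum>k | k \<in> {1..?m} \<and> k * f \<le> ?m. real f ^ 2)"
        by (simp add: div_mult2_eq)
    qed
    also have "\<dots> = (\<Sum>k\<in>{1..?m}. \<Sum>f | f \<in> {1..?m} \<and> k * f \<le> ?m. real f ^ 2)"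
      by (rule sum.swap_restrict) auto
    also have "\<dots> = layered_squares ?m"
      unfolding layered_squares_def
    proof (rule sum.cong[OF refl])
      fix k assume k: "k \<in> {1..?m}"
      have "{f. f \<in> {1..?m} \<and> k * f \<le> ?m} = {1..?m div k}"
        using k by (auto simp: less_eq_div_iff_mult_less_eq mult.commute intro: order_trans[OF _ div_le_dividend])
          (metis One_nat_def Suc_le_eq div_le_dividend le_trans less_eq_div_iff_mult_less_eq mult.commute)
      then show "(\<Sum>f | f \<in> {1..?m} \<and> k * f \<le> ?m. real f ^ 2) = (\<Sum>f\<in>{1..?m div k}. real f ^ 2)" by simp
    qed
    finally show "(\<Sum>f\<in>{1..?m}. ?F e f) = of_int (moebius e) * real e * layered_squares ?m"
      by (simp only: sum_distrib_left[symmetric])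
  qed
  finally show ?thesis .
qed

lemma sum_squares_bound:
  fixes y :: real
  assumes "1 \<le> y"
  shows "\<bar>(\<Sum>f\<in>{1..nat \<lfloor>y\<rfloor>}. real f ^ 2) - y ^ 3 / 3\<bar> \<le> y ^ 2"
proof -
  define n where "n = nat \<lfloor>y\<rfloor>"
  have n: "real n \<le> y" "y < real n + 1" "1 \<le> real n" using assms by (auto simp: n_def)
  have S: "(\<Sum>f\<in>{1..n}. real f ^ 2) = real n ^ 3 / 3 + real n ^ 2 / 2 + real n / 6"
    by (induction n) (simp_all add: power2_eq_square power3_eq_cube field_simps)
  have "real n ^ 3 \<le> y ^ 3" "real n ^ 2 \<le> y ^ 2" using n by (auto intro: power_mono)
  moreover have "real n \<le> y ^ 2" using n assms mult_mono[of 1 y "real n" y] by (simp add: power2_eq_square)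
  moreover have "y ^ 3 - real n ^ 3 \<le> 3 * y ^ 2"
  proof -
    have "y ^ 3 - real n ^ 3 = (y - real n) * (y ^ 2 + y * real n + real n ^ 2)"
      by (simp add: power2_eq_square power3_eq_cube algebra_simps)
    also have "\<dots> \<le> 1 * (y ^ 2 + y * real n + real n ^ 2)"
      using n assms by (intro mult_right_mono) auto
    also have "y * real n \<le> y ^ 2" using n assms by (simp add: power2_eq_square)
    finally show ?thesis using \<open>real n ^ 2 \<le> y ^ 2\<close> by simp
  qed
  moreover have "0 \<le> real n ^ 2" by simp
  ultimately show ?thesis using n(3) unfolding n_def[symmetric] S by linarith
qed

lemma inverse_square_tail:
  fixes g :: "nat \<Rightarrow> real"
  assumes "\<And>k. 0 \<le> g k" "\<And>k. g k \<le> 1 / real (Suc k) ^ 2" "g sums l"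
  shows "(\<Sum>k<m. g k) \<le> l" "m > 0 \<Longrightarrow> l - (\<Sum>k<m. g k) \<le> 1 / real m"
proof -
  show "(\<Sum>k<m. g k) \<le> l"
    using assms by (metis sum_le_suminf sums_iff finite_lessThan)
  assume m: "m > 0"
  have tail: "(\<lambda>k. g (k + m)) sums (l - (\<Sum>k<m. g k))"
    using assms(3) by (rule sums_split_initial_segment)
  have tel: "(\<lambda>k. 1 / real (k + m) - 1 / real (Suc k + m)) sums (1 / real (0 + m) - 0)"
    by (rule telescope_sums') (rule LIMSEQ_ignore_initial_segment[OF lim_1_over_n])
  have "l - (\<Sum>k<m. g k) \<le> 1 / real (0 + m) - 0"
  proof (rule sums_le[OF _ tail tel])
    fix k
    have "g (k + m) \<le> 1 / real (Suc (k + m)) ^ 2" using assms(2) by blast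
    also have "\<dots> \<le> 1 / (real (k + m) * real (Suc k + m))"
      using m by (intro divide_left_mono) (auto simp: power2_eq_square)
    also have "\<dots> = 1 / real (k + m) - 1 / real (Suc k + m)" using m by (simp add: field_simps)
    finally show "g (k + m) \<le> 1 / real (k + m) - 1 / real (Suc k + m)" .
  qed
  then show "l - (\<Sum>k<m. g k) \<le> 1 / real m" by simp
qed

lemma sum_inverse_powers_bounds:
  fixes m :: nat
  shows "(\<Sum>k\<in>{1..m}. 1 / real k ^ 2) \<le> pi ^ 2 / 6"
    and "m > 0 \<Longrightarrow> pi ^ 2 / 6 - (\<Sum>k\<in>{1..m}. 1 / real k ^ 2) \<le> 1 / real m"
    and "(\<Sum>k\<in>{1..m}. 1 / real k ^ 3) \<le> zeta3"
    and "m > 0 \<Longrightarrow> zeta3 - (\<Sum>k\<in>{1..m}. 1 / real k ^ 3) \<le> 1 / real m"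
    and "1 \<le> zeta3" "zeta3 \<le> 2"
proof -
  have s2: "(\<lambda>k. 1 / real (Suc k) ^ 2) sums (pi ^ 2 / 6)" using inverse_squares_sums by (simp add: add.commute)
  have le: "1 / real (Suc k) ^ 3 \<le> 1 / real (Suc k) ^ 2" for k
    by (intro divide_left_mono power_increasing) auto
  have sm: "summable (\<lambda>k. 1 / real (Suc k) ^ 3)"
    by (rule summable_comparison_test'[OF sums_summable[OF s2], of 0]) (use le in auto)
  then have s3: "(\<lambda>k. 1 / real (Suc k) ^ 3) sums zeta3"
    unfolding zeta3_def by (rule summable_sums)
  have re: "(\<Sum>k\<in>{1..m}. h k) = (\<Sum>k<m. h (Suc k))" for h :: "nat \<Rightarrow> real" and m
    by (rule sum.reindex_bij_witness[of _ Suc "\<lambda>k. k - 1"]) auto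
  show "(\<Sum>k\<in>{1..m}. 1 / real k ^ 2) \<le> pi ^ 2 / 6" unfolding re
    by (rule inverse_square_tail(1)[OF _ _ s2]) auto
  show "m > 0 \<Longrightarrow> pi ^ 2 / 6 - (\<Sum>k\<in>{1..m}. 1 / real k ^ 2) \<le> 1 / real m" unfolding re
    by (rule inverse_square_tail(2)[OF _ _ s2]) auto
  show 3: "(\<Sum>k\<in>{1..m}. 1 / real k ^ 3) \<le> zeta3" for m unfolding re
    by (rule inverse_square_tail(1)[OF _ le s3]) auto
  show 4: "m > 0 \<Longrightarrow> zeta3 - (\<Sum>k\<in>{1..m}. 1 / real k ^ 3) \<le> 1 / real m" for m unfolding re
    by (rule inverse_square_tail(2)[OF _ le s3]) auto
  show "1 \<le> zeta3" using 3[of 1] by simp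
  show "zeta3 \<le> 2" using 4[of 1] by simp
qed

text \<open>The \<open>k\<close>-th layer is \<open>(y / k) ^ 3 / 3\<close> up to
  \<open>(y / k) ^ 2\<close>. The cubes produce \<open>zeta3\<close> with a tail costing
  \<open>y ^ 2\<close>, the squares cost at most \<open>2 * y ^ 2\<close> because
  \<open>pi ^ 2 / 6 \<le> 2\<close>.\<close>

lemma layered_squares_bound:
  fixes y :: real
  assumes "1 \<le> y"
  shows "\<bar>layered_squares (nat \<lfloor>y\<rfloor>) - zeta3 * y ^ 3 / 3\<bar> \<le> 3 * y ^ 2"
proof -
  define m where "m = nat \<lfloor>y\<rfloor>"
  have m: "real m \<le> y" "y < real m + 1" "1 \<le> real m" using assms by (auto simp: m_def)
  let ?Z = "\<Sum>k\<in>{1..m}. 1 / real k ^ 3"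
  have "layered_squares m - y ^ 3 / 3 * ?Z = (\<Sum>k\<in>{1..m}. (\<Sum>f\<in>{1..m div k}. real f ^ 2) - (y / k) ^ 3 / 3)"
    by (simp add: layered_squares_def sum_subtractf sum_distrib_left power_divide mult.commute)
  then have "\<bar>layered_squares m - y ^ 3 / 3 * ?Z\<bar> \<le> (\<Sum>k\<in>{1..m}. \<bar>(\<Sum>f\<in>{1..m div k}. real f ^ 2) - (y / k) ^ 3 / 3\<bar>)"
    by (simp only: sum_abs)
  also have "\<dots> \<le> (\<Sum>k\<in>{1..m}. (y / k) ^ 2)"
  proof (rule sum_mono)
    fix k assume k: "k \<in> {1..m}"
    have "real k \<le> y" using k m(1) by (meson atLeastAtMost_iff le_trans of_nat_mono order_trans)
    then have "1 \<le> y / k" using k by simp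
    moreover have "m div k = nat \<lfloor>y / k\<rfloor>"
      using floor_divide_real_eq_div[of "int k" y] assms by (simp add: m_def nat_div_distrib)
    ultimately show "\<bar>(\<Sum>f\<in>{1..m div k}. real f ^ 2) - (y / k) ^ 3 / 3\<bar> \<le> (y / k) ^ 2"
      using sum_squares_bound by simp
  qed
  also have "\<dots> = y ^ 2 * (\<Sum>k\<in>{1..m}. 1 / real k ^ 2)" by (simp add: sum_distrib_left power_divide)
  also have "\<dots> \<le> y ^ 2 * 2"
  proof (rule mult_left_mono)
    have "pi ^ 2 / 6 \<le> 2" using sum_inverse_powers_bounds(2)[of 1] by simp
    then show "(\<Sum>k\<in>{1..m}. 1 / real k ^ 2) \<le> 2" using sum_inverse_powers_bounds(1)[of m] by linarith
  qed simp
  finally have 1: "\<bar>layered_squares m - y ^ 3 / 3 * ?Z\<bar> \<le> y ^ 2 * 2" .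
  have "0 \<le> zeta3 - ?Z" "zeta3 - ?Z \<le> 1 / real m" using sum_inverse_powers_bounds(3,4)[of m] m by auto
  moreover have "1 / real m \<le> 2 / y"
  proof -
    have "y \<le> 2 * real m" using m by linarith
    then have "2 / (2 * real m) \<le> 2 / y" using assms by (intro divide_left_mono) auto
    then show ?thesis by simp
  qed
  ultimately have z: "0 \<le> zeta3 - ?Z" "zeta3 - ?Z \<le> 2 / y" by auto
  have "0 \<le> y ^ 3 / 3 * (zeta3 - ?Z)" using z assms by simp
  moreover have "y ^ 3 / 3 * (zeta3 - ?Z) \<le> y ^ 3 / 3 * (2 / y)" using z assms by (intro mult_left_mono) auto
  moreover have "y ^ 3 / 3 * (2 / y) \<le> y ^ 2" using assms by (simp add: power3_eq_cube power2_eq_square)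
  moreover have "zeta3 * y ^ 3 / 3 = y ^ 3 / 3 * ?Z + y ^ 3 / 3 * (zeta3 - ?Z)" by (simp add: algebra_simps)
  ultimately show ?thesis using 1 unfolding m_def[symmetric] by linarith
qed

text \<open>A finite form of \<open>zeta(2) * (1 / zeta(2)) = 1\<close>: with the inner zeta sums
  truncated at \<open>t div e\<close>, the product is exactly 1. Completing the truncated sums to
  \<open>pi ^ 2 / 6\<close> costs at most \<open>1 / (t div e) \<le> 2 * e / t\<close> each.\<close>

lemma sum_moebius_square:
  assumes "t > 0"
  shows "\<bar>(\<Sum>e\<in>{1..t}. of_int (moebius e) / real e ^ 2) - 6 / pi ^ 2\<bar> \<le> 2 * harm t / real t"
proof -
  let ?z = "pi ^ 2 / 6 :: real"
  let ?Z = "\<lambda>m::nat. \<Sum>k\<in>{1..m}. 1 / real k ^ 2"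
  let ?M = "\<Sum>e\<in>{1..t}. of_int (moebius e) / real e ^ 2"
  have "(\<Sum>e\<in>{1..t}. of_int (moebius e) / real e ^ 2 * ?Z (t div e))
      = (\<Sum>e\<in>{1..t}. \<Sum>f\<in>{1..t div e}. of_int (moebius e) / real (e * f) ^ 2)"
    by (simp add: sum_distrib_left power_mult_distrib)
  also have "\<dots> = (\<Sum>i\<in>{1..t}. \<Sum>e | e dvd i. of_int (moebius e) / real (e * (i div e)) ^ 2)"
    by (rule sum_divisors_swap[symmetric])
  also have "\<dots> = (\<Sum>i\<in>{1..t}. of_int (\<Sum>e | e dvd i. moebius e) / real i ^ 2)"
    by (intro sum.cong refl) (simp add: sum_divide_distrib)
  also have "\<dots> = (\<Sum>i\<in>{1..t}. if i = 1 then 1 else 0)"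
    by (intro sum.cong refl) (simp add: sum_moebius_divisors)
  also have "\<dots> = 1" using assms by simp
  finally have one: "(\<Sum>e\<in>{1..t}. of_int (moebius e) / real e ^ 2 * ?Z (t div e)) = 1" .
  have "?z * ?M - (\<Sum>e\<in>{1..t}. of_int (moebius e) / real e ^ 2 * ?Z (t div e))
      = (\<Sum>e\<in>{1..t}. of_int (moebius e) / real e ^ 2 * (?z - ?Z (t div e)))"
    unfolding sum_distrib_left[of ?z] sum_subtractf[symmetric]
    by (intro sum.cong refl) (simp add: right_diff_distrib mult.commute)
  then have "\<bar>?z * ?M - 1\<bar> = \<bar>\<Sum>e\<in>{1..t}. of_int (moebius e) / real e ^ 2 * (?z - ?Z (t div e))\<bar>"
    unfolding one by (rule arg_cong)
  also have "\<dots> \<le> (\<Sum>e\<in>{1..t}. \<bar>of_int (moebius e) / real e ^ 2 * (?z - ?Z (t div e))\<bar>)" by (rule sum_abs)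
  also have "\<dots> \<le> (\<Sum>e\<in>{1..t}. 2 / real t * inverse (real e))"
  proof (rule sum_mono)
    fix e assume e: "e \<in> {1..t}"
    have d: "t div e > 0" using e by (simp add: div_greater_zero_iff)
    have "t < (t div e + 1) * e" using dividend_less_div_times[of e t] e by simp
    then have "real t < real (t div e + 1) * e" by (simp only: of_nat_less_iff of_nat_mult[symmetric])
    also have "\<dots> \<le> 2 * real (t div e) * e" using d e by (intro mult_right_mono) auto
    finally have "1 / real (t div e) \<le> 2 * e / t" using d e by (simp add: field_simps)
    then have z: "0 \<le> ?z - ?Z (t div e)" "?z - ?Z (t div e) \<le> 2 * e / t"
      using sum_inverse_powers_bounds(1,2)[of "t div e"] d by auto
    have "\<bar>of_int (moebius e) / real e ^ 2 * (?z - ?Z (t div e))\<bar> = \<bar>of_int (moebius e)\<bar> / real e ^ 2 * (?z - ?Z (t div e))"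
      using z by (simp add: abs_mult)
    also have "\<dots> \<le> 1 / real e ^ 2 * (2 * e / t)"
    proof (rule mult_mono)
      have "\<bar>real_of_int (moebius e)\<bar> \<le> 1" using abs_moebius_le_1[of e] by linarith
      then show "\<bar>real_of_int (moebius e)\<bar> / real e ^ 2 \<le> 1 / real e ^ 2" by (rule divide_right_mono) simp
    qed (use z in auto)
    also have "\<dots> = 2 / real t * inverse (real e)" using e by (simp add: power2_eq_square field_simps)
    finally show "\<bar>of_int (moebius e) / real e ^ 2 * (?z - ?Z (t div e))\<bar> \<le> 2 / real t * inverse (real e)" .
  qed
  also have "\<dots> = 2 * harm t / real t" by (simp add: harm_def sum_distrib_left sum_divide_distrib)
  finally have *: "\<bar>?z * ?M - 1\<bar> \<le> 2 * harm t / real t" .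
  have z1: "1 \<le> ?z" using sum_inverse_powers_bounds(1)[of 1] by simp
  have "\<bar>?M - 6 / pi ^ 2\<bar> \<le> ?z * \<bar>?M - 6 / pi ^ 2\<bar>" using mult_right_mono[OF z1, of "\<bar>?M - 6 / pi ^ 2\<bar>"] by simp
  also have "\<dots> = \<bar>?z * (?M - 6 / pi ^ 2)\<bar>" by (simp add: abs_mult)
  also have "?z * (?M - 6 / pi ^ 2) = ?z * ?M - 1" by (simp add: right_diff_distrib)
  finally show ?thesis using * by linarith
qed

text \<open>Of the factor 5, the layers account for 3 and replacing the Moebius sum by
  \<open>6 / pi ^ 2\<close> accounts for 2.\<close>

lemma width_bound:
  assumes "t > 0"
  shows "\<bar>width t - 2 * zeta3 / pi ^ 2 * real t ^ 3\<bar> \<le> 5 * real t ^ 2 * harm t"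
proof -
  let ?M = "\<Sum>e\<in>{1..t}. of_int (moebius e) / real e ^ 2"
  have "width t - zeta3 * real t ^ 3 / 3 * ?M
      = (\<Sum>e\<in>{1..t}. of_int (moebius e) * real e * (layered_squares (t div e) - zeta3 * (real t / e) ^ 3 / 3))"
    unfolding width_eq sum_distrib_left sum_subtractf[symmetric]
    by (intro sum.cong refl) (auto simp: field_simps power2_eq_square power3_eq_cube)
  then have "\<bar>width t - zeta3 * real t ^ 3 / 3 * ?M\<bar>
      \<le> (\<Sum>e\<in>{1..t}. \<bar>of_int (moebius e) * real e * (layered_squares (t div e) - zeta3 * (real t / e) ^ 3 / 3)\<bar>)"
    by (simp only: sum_abs)
  also have "\<dots> \<le> (\<Sum>e\<in>{1..t}. 3 * real t ^ 2 * inverse (real e))"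
  proof (rule sum_mono)
    fix e assume e: "e \<in> {1..t}"
    have y: "1 \<le> real t / e" using e by simp
    have "t div e = nat \<lfloor>real t / e\<rfloor>" by (simp add: floor_divide_of_nat_eq)
    then have T: "\<bar>layered_squares (t div e) - zeta3 * (real t / e) ^ 3 / 3\<bar> \<le> 3 * (real t / e) ^ 2"
      using layered_squares_bound[OF y] by simp
    have m: "\<bar>real_of_int (moebius e)\<bar> \<le> 1" using abs_moebius_le_1[of e] by linarith
    have "\<bar>of_int (moebius e) * real e * (layered_squares (t div e) - zeta3 * (real t / e) ^ 3 / 3)\<bar>
        = (\<bar>real_of_int (moebius e)\<bar> * real e) * \<bar>layered_squares (t div e) - zeta3 * (real t / e) ^ 3 / 3\<bar>"
      by (simp add: abs_mult)
    also have "\<dots> \<le> (1 * real e) * (3 * (real t / e) ^ 2)"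
      using m T by (intro mult_mono mult_right_mono) auto
    also have "\<dots> = 3 * real t ^ 2 * inverse (real e)" using e by (simp add: power2_eq_square field_simps)
    finally show "\<bar>of_int (moebius e) * real e * (layered_squares (t div e) - zeta3 * (real t / e) ^ 3 / 3)\<bar> \<le> 3 * real t ^ 2 * inverse (real e)" .
  qed
  also have "\<dots> = 3 * real t ^ 2 * harm t" by (simp add: harm_def sum_distrib_left)
  finally have 1: "\<bar>width t - zeta3 * real t ^ 3 / 3 * ?M\<bar> \<le> 3 * real t ^ 2 * harm t" .
  have "\<bar>zeta3 * real t ^ 3 / 3 * ?M - zeta3 * real t ^ 3 / 3 * (6 / pi ^ 2)\<bar>
      = zeta3 * real t ^ 3 / 3 * \<bar>?M - 6 / pi ^ 2\<bar>"
    unfolding right_diff_distrib[symmetric] abs_mult using sum_inverse_powers_bounds(5) by simp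
  also have "\<dots> \<le> (2 * real t ^ 3 / 3) * (2 * harm t / real t)"
    using sum_inverse_powers_bounds(5,6) sum_moebius_square[OF assms]
    by (intro mult_mono divide_right_mono mult_right_mono) auto
  also have "\<dots> = 4 / 3 * real t ^ 2 * harm t" using assms by (simp add: power3_eq_cube power2_eq_square)
  also have "\<dots> \<le> 2 * real t ^ 2 * harm t" by (intro mult_right_mono) (auto simp: harm_nonneg)
  finally have 2: "\<bar>zeta3 * real t ^ 3 / 3 * ?M - zeta3 * real t ^ 3 / 3 * (6 / pi ^ 2)\<bar> \<le> 2 * real t ^ 2 * harm t" .
  have "zeta3 * real t ^ 3 / 3 * (6 / pi ^ 2) = 2 * zeta3 / pi ^ 2 * real t ^ 3" by simp
  then show ?thesis using 1 2 by linarith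
qed

section \<open>Counting integers coprime to a modulus, with one rounding error per divisor\<close>

lemma coprime_indicator:
  fixes y :: int and i :: nat
  assumes "i > 0"
  shows "(if coprime y (int i) then 1 else 0) = (\<Sum>e | e dvd i. if int e dvd y then moebius e else 0)"
proof -
  have "(\<Sum>e | e dvd i. if int e dvd y then moebius e else 0) = (\<Sum>e | e dvd i \<and> int e dvd y. moebius e)"
    using assms by (subst sum.inter_filter[symmetric]) auto
  also have "{e. e dvd i \<and> int e dvd y} = {e. e dvd nat (gcd y (int i))}"
  proof (rule Collect_cong)
    fix e
    have "e dvd nat (gcd y (int i)) \<longleftrightarrow> int e dvd int (nat (gcd y (int i)))" by (simp only: int_dvd_int_iff)
    also have "\<dots> \<longleftrightarrow> int e dvd gcd y (int i)" by simp
    also have "\<dots> \<longleftrightarrow> int e dvd y \<and> int e dvd int i" by (rule gcd_greatest_iff)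
    finally show "e dvd i \<and> int e dvd y \<longleftrightarrow> e dvd nat (gcd y (int i))" by auto
  qed
  also have "(\<Sum>e\<in>\<dots>. moebius e) = (if nat (gcd y (int i)) = 1 then 1 else 0)"
    using assms by (intro sum_moebius_divisors) (simp add: gcd_pos_int)
  also have "nat (gcd y (int i)) = 1 \<longleftrightarrow> coprime y (int i)" by (simp add: nat_eq_iff coprime_iff_gcd_eq_1)
  finally show ?thesis by simp
qed

lemma signed_sum_unique:
  fixes F f :: "int \<Rightarrow> int"
  assumes "F 0 = 0" "\<And>m. F m - F (m - 1) = f m"
  shows "signed_sum f m = F m"
proof -
  have step: "signed_sum f m - signed_sum f (m - 1) = f m" for m
  proof -
    have "{m - 1<..m} = {m}" by auto
    then show ?thesis using signed_sum_diff[of "m - 1" m f] by simp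
  qed
  show ?thesis
  proof (induction m rule: int_induct[where k = 0])
    case base
    then show ?case using assms(1) by (simp add: signed_sum_def)
  next
    case (step1 i)
    then show ?case using step[of "i + 1"] assms(2)[of "i + 1"] by simp
  next
    case (step2 i)
    then show ?case using step[of i] assms(2)[of i] by simp
  qed
qed

text \<open>Both sides vanish at 0 and have the same increments. Since \<open>div\<close> rounds
  downwards, one formula serves positive and negative \<open>m\<close>, hence slopes of either
  sign.\<close>

lemma signed_sum_coprime:
  assumes "i > 0"
  shows "signed_sum (\<lambda>y. if coprime y (int i) then 1 else 0) m = (\<Sum>e | e dvd i. moebius e * (m div int e))"
proof (rule signed_sum_unique)
  fix m :: int
  have div: "m div int e - (m - 1) div int e = (if int e dvd m then 1 else 0)" if "e > 0" for e
  proof (cases "int e dvd m")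
    case True
    then obtain k where k: "m = int e * k" ..
    have "(m - 1) div int e = k - 1"
      using that by (intro int_div_pos_eq[where r = "int e - 1"]) (auto simp: k algebra_simps)
    then show ?thesis using True k that by simp
  next
    case False
    then have "m mod int e \<noteq> 0" by (simp add: dvd_eq_mod_eq_0)
    then have "0 < m mod int e" "m mod int e < int e"
      using that pos_mod_sign[of "int e" m] pos_mod_bound[of "int e" m] by linarith+
    then have "(m - 1) div int e = m div int e"
      by (intro int_div_pos_eq[where r = "m mod int e - 1"]) (auto simp: algebra_simps)
    then show ?thesis using False by simp
  qed
  have "(\<Sum>e | e dvd i. moebius e * (m div int e)) - (\<Sum>e | e dvd i. moebius e * ((m - 1) div int e))
      = (\<Sum>e | e dvd i. if int e dvd m then moebius e else 0)"
    unfolding sum_subtractf[symmetric] right_diff_distrib[symmetric]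
  proof (rule sum.cong[OF refl])
    fix e assume "e \<in> {e. e dvd i}"
    then have "e > 0" using assms by (auto intro: Nat.gr0I)
    then show "moebius e * (m div int e - (m - 1) div int e) = (if int e dvd m then moebius e else 0)"
      using div by simp
  qed
  then show "(\<Sum>e | e dvd i. moebius e * (m div int e)) - (\<Sum>e | e dvd i. moebius e * ((m - 1) div int e))
      = (if coprime m (int i) then 1 else 0)"
    using coprime_indicator[OF assms, of m] by simp
qed simp

lemma signed_sum_coprime_bound:
  fixes s :: real
  assumes "i > 0"
  shows "\<bar>real_of_int (signed_sum (\<lambda>y. if coprime y (int i) then 1 else 0) \<lfloor>s * real i\<rfloor>) - s * phi i\<bar>
    \<le> real (card {e. e dvd i})"
proof -
  have "real_of_int (signed_sum (\<lambda>y. if coprime y (int i) then 1 else 0) \<lfloor>s * real i\<rfloor>) - s * phi i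
      = (\<Sum>e | e dvd i. of_int (moebius e) * (of_int (\<lfloor>s * real i\<rfloor> div int e) - s * real (i div e)))"
    unfolding signed_sum_coprime[OF assms] phi_def sum_distrib_left
    by (simp add: sum_subtractf right_diff_distrib ac_simps)
  then have "\<bar>real_of_int (signed_sum (\<lambda>y. if coprime y (int i) then 1 else 0) \<lfloor>s * real i\<rfloor>) - s * phi i\<bar>
      \<le> (\<Sum>e | e dvd i. \<bar>of_int (moebius e) * (of_int (\<lfloor>s * real i\<rfloor> div int e) - s * real (i div e))\<bar>)"
    by (simp only: sum_abs)
  also have "\<dots> \<le> (\<Sum>e | e dvd i. 1)"
  proof (rule sum_mono)
    fix e assume e: "e \<in> {e. e dvd i}"
    then have "e > 0" using assms by (auto intro: Nat.gr0I)
    have "real (i div e) = real i / real e" using e by (simp add: real_of_nat_div)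
    then have "\<lfloor>s * real i\<rfloor> div int e = \<lfloor>s * real (i div e)\<rfloor>"
      using floor_divide_real_eq_div[of "int e" "s * real i"] by simp
    then have "\<bar>of_int (\<lfloor>s * real i\<rfloor> div int e) - s * real (i div e)\<bar> \<le> 1" by linarith
    moreover have "\<bar>real_of_int (moebius e)\<bar> \<le> 1" using abs_moebius_le_1[of e] by linarith
    ultimately show "\<bar>of_int (moebius e) * (of_int (\<lfloor>s * real i\<rfloor> div int e) - s * real (i div e))\<bar> \<le> 1"
      unfolding abs_mult by (intro mult_le_one) auto
  qed
  finally show ?thesis by simp
qed

subsection \<open>Comparison with a parabola\<close>

text \<open>The assumption makes \<open>- V a\<close> a supergradient, so increments of
  \<open>support\<close> are trapped without any differentiability. The difference \<open>F\<close>
  from the quadratic model then varies by at most \<open>M * (b - a)\<close> plus a term quadratic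
  in \<open>b - a\<close>, and subdivision makes the quadratic term negligible.\<close>

lemma concave_quadratic_estimate:
  fixes support V :: "real \<Rightarrow> real"
  assumes conc: "\<And>a b. support b \<le> support a - (b - a) * V a"
    and V: "\<And>a b. \<bar>V a - V b - H * (a - b)\<bar> \<le> M"
  shows "\<bar>support s - support s0 + V s0 * (s - s0) + H * (s - s0)\<^sup>2 / 2\<bar> \<le> M * \<bar>s - s0\<bar>"
proof -
  define F where "F x = support x + V s0 * (x - s0) + H * (x - s0)\<^sup>2 / 2" for x
  have loc: "\<bar>F b - F a\<bar> \<le> M * (b - a) + \<bar>H\<bar> / 2 * (b - a)\<^sup>2" if ab: "a \<le> b" for a b
  proof -
    have eq: "F b - F a = support b - support a + (b - a) * (V s0 + H * ((a + b) / 2 - s0))"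
      by (simp add: F_def power2_eq_square field_simps)
    have h: "\<bar>H * (b - a)\<^sup>2\<bar> = \<bar>H\<bar> * (b - a)\<^sup>2" by (simp add: abs_mult)
    have "V s0 - V a + H * (a - s0) \<le> M" using V[of s0 a] by (simp add: abs_le_iff algebra_simps)
    then have "(b - a) * (V s0 - V a + H * (a - s0)) \<le> (b - a) * M" using ab by (intro mult_left_mono) auto
    moreover have "F b - F a \<le> (b - a) * (V s0 - V a + H * (a - s0)) + H * (b - a)\<^sup>2 / 2"
      unfolding eq using conc[of b a] by (simp add: power2_eq_square field_simps)
    ultimately have up: "F b - F a \<le> M * (b - a) + \<bar>H\<bar> / 2 * (b - a)\<^sup>2"
      using h by (simp add: mult.commute)
    have "- M \<le> V s0 - V b + H * (b - s0)" using V[of s0 b] by (simp add: abs_le_iff algebra_simps)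
    then have "(b - a) * (- M) \<le> (b - a) * (V s0 - V b + H * (b - s0))" using ab by (intro mult_left_mono) auto
    moreover have "(b - a) * (V s0 - V b + H * (b - s0)) - H * (b - a)\<^sup>2 / 2 \<le> F b - F a"
      unfolding eq using conc[of a b] by (simp add: power2_eq_square field_simps)
    ultimately have "- (M * (b - a) + \<bar>H\<bar> / 2 * (b - a)\<^sup>2) \<le> F b - F a"
      using h by (simp add: mult.commute)
    then show ?thesis using up by linarith
  qed
  have lip: "\<bar>F b - F a\<bar> \<le> M * (b - a)" if ab: "a \<le> b" for a b
  proof (rule field_le_epsilon)
    fix e :: real assume e: "0 < e"
    define \<epsilon> where "\<epsilon> = e / (b - a + 1)"
    have \<epsilon>: "0 < \<epsilon>" using e ab by (simp add: \<epsilon>_def)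
    have "\<bar>F b - F a\<bar> \<le> (M + \<epsilon>) * (b - a)"
      using ab
    proof (induction a b rule: Bolzano)
      case (trans a b c)
      have "\<bar>F c - F a\<bar> \<le> \<bar>F c - F b\<bar> + \<bar>F b - F a\<bar>" by simp
      also have "\<dots> \<le> (M + \<epsilon>) * (c - b) + (M + \<epsilon>) * (b - a)" using trans by (intro add_mono) auto
      also have "\<dots> = (M + \<epsilon>) * (c - a)" by (simp add: algebra_simps)
      finally show ?case .
    next
      case (local x)
      let ?d = "\<epsilon> / (\<bar>H\<bar> / 2 + 1)"
      have d: "0 < ?d" using \<epsilon> by (simp add: add_pos_nonneg)
      have "\<bar>F b - F a\<bar> \<le> (M + \<epsilon>) * (b - a)" if "a \<le> x" "x \<le> b" "b - a < ?d" for a b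
      proof -
        have "(\<bar>H\<bar> / 2 + 1) * (b - a) \<le> \<epsilon>"
        proof -
          have p: "0 < \<bar>H\<bar> / 2 + 1" by (simp add: add_nonneg_pos)
          show ?thesis using that(3) p by (simp add: less_divide_eq mult.commute)
        qed
        moreover have "\<bar>H\<bar> / 2 * (b - a) \<le> (\<bar>H\<bar> / 2 + 1) * (b - a)" using that by (intro mult_right_mono) auto
        ultimately have "\<bar>H\<bar> / 2 * (b - a) \<le> \<epsilon>" by linarith
        then have "\<bar>H\<bar> / 2 * (b - a) * (b - a) \<le> \<epsilon> * (b - a)" using that by (intro mult_right_mono) auto
        moreover have "\<bar>F b - F a\<bar> \<le> M * (b - a) + \<bar>H\<bar> / 2 * (b - a) * (b - a)"
          using loc[of a b] that by (simp add: power2_eq_square mult.assoc)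
        ultimately show ?thesis by (simp only: distrib_right)
      qed
      then show ?case using d by blast
    qed
    also have "\<dots> = M * (b - a) + \<epsilon> * (b - a)" by (simp add: algebra_simps)
    also have "\<epsilon> * (b - a) \<le> \<epsilon> * (b - a + 1)" using \<epsilon> by (intro mult_left_mono) auto
    also have "\<epsilon> * (b - a + 1) = e" using ab by (simp add: \<epsilon>_def)
    finally show "\<bar>F b - F a\<bar> \<le> M * (b - a) + e" by simp
  qed
  have "F s - F s0 = support s - support s0 + V s0 * (s - s0) + H * (s - s0)\<^sup>2 / 2" by (simp add: F_def)
  then show ?thesis
    using lip[of s s0] lip[of s0 s] by (cases "s \<le> s0") (auto simp: abs_minus_commute)
qed

text \<open>For the comparisons \<open>M\<close> is \<open>err\<close>: a curvature margin
  \<open>err\<close> must beat the linear error \<open>err * \<bar>D\<bar>\<close> and the rounding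
  of the horizontal translation, at most \<open>\<bar>D\<bar>\<close>. The possible deficit
  \<open>2 * err\<close> is what the vertical translations compensate.\<close>

lemma quadratic_lower_bound:
  fixes M D :: real
  assumes "1 \<le> M"
  shows "- 2 * M \<le> M * D\<^sup>2 / 2 - (M + 1) * \<bar>D\<bar>"
proof -
  have "0 \<le> (M * \<bar>D\<bar> - (M + 1))\<^sup>2" by simp
  also have "\<dots> = 2 * M * (M * D\<^sup>2 / 2 - (M + 1) * \<bar>D\<bar>) + (M + 1)\<^sup>2"
    by (simp add: power2_eq_square algebra_simps)
  finally have "0 \<le> 2 * M * (M * D\<^sup>2 / 2 - (M + 1) * \<bar>D\<bar>) + (M + 1)\<^sup>2" .
  moreover have "(M + 1)\<^sup>2 \<le> (2 * M)\<^sup>2" using assms by (intro power_mono) auto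
  ultimately have "2 * M * (- 2 * M) \<le> 2 * M * (M * D\<^sup>2 / 2 - (M + 1) * \<bar>D\<bar>)"
    by (simp add: power2_eq_square)
  then show ?thesis using assms by (subst (asm) mult_le_cancel_left_pos) auto
qed

lemma convex_point_between:
  fixes C :: "(real \<times> real) set"
  assumes "convex C" "(x1, y1) \<in> C" "(x2, y2) \<in> C" "x1 \<le> x" "x \<le> x2"
    and "y1 - s * x1 \<le> B" "y2 - s * x2 \<le> B"
  obtains y where "(x, y) \<in> C" "y - s * x \<le> B"
proof (cases "x1 = x2")
  case True
  then show thesis using assms that[of y1] by auto
next
  case False
  define u where "u = (x - x1) / (x2 - x1)"
  have u: "0 \<le> u" "u \<le> 1" using assms False by (auto simp: u_def divide_le_eq)
  have "u * (x2 - x1) = x - x1" using False by (simp add: u_def)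
  then have x: "x = (1 - u) * x1 + u * x2" by (simp add: algebra_simps)
  define y where "y = (1 - u) * y1 + u * y2"
  have "(x, y) = (1 - u) *\<^sub>R (x1, y1) + u *\<^sub>R (x2, y2)" by (simp add: x y_def)
  moreover have "(1 - u) *\<^sub>R (x1, y1) + u *\<^sub>R (x2, y2) \<in> C"
    using assms(1-3) u by (intro convexD_alt) auto
  ultimately have "(x, y) \<in> C" by simp
  moreover have "y - s * x = (1 - u) * (y1 - s * x1) + u * (y2 - s * x2)"
    by (simp add: x y_def algebra_simps)
  then have "y - s * x \<le> (1 - u) * B + u * B"
    using assms u by (auto intro!: add_mono mult_left_mono)
  ultimately show thesis using that by (simp add: algebra_simps)
qed

context strip
begin

text \<open>The weight \<open>(tau div i) * i\<close> is at most \<open>tau\<close>, and each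
  divisor of \<open>i\<close> contributes one rounding error; the average number of divisors is
  logarithmic.\<close>

lemma Vx_linear:
  "\<bar>real_of_int (Vx s) - s * width (nat tau)\<bar> \<le> (real_of_int tau)\<^sup>2 * (1 + ln tau)"
proof -
  define t where "t = nat tau"
  have t: "tau = int t" "t > 0" using tau_pos by (auto simp: t_def)
  let ?S = "\<lambda>i. real_of_int (signed_sum (\<lambda>y. if coprime y (int i) then 1 else 0) \<lfloor>s * real i\<rfloor>)"
  have "Vx s = (\<Sum>i\<in>{1..t}. (int t div int i) * int i * signed_sum (\<lambda>y. if coprime y (int i) then 1 else 0) \<lfloor>s * real i\<rfloor>)"
    unfolding VX_def rgerm_def t(1)
    by (rule sum.reindex_bij_witness[of _ int nat]) auto
  then have "real_of_int (Vx s) = (\<Sum>i\<in>{1..t}. real (t div i) * real i * ?S i)"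
    by (simp flip: zdiv_int)
  then have "real_of_int (Vx s) - s * width t = (\<Sum>i\<in>{1..t}. real (t div i) * real i * (?S i - s * phi i))"
    by (simp add: width_def sum_distrib_left sum_subtractf right_diff_distrib ac_simps)
  then have "\<bar>real_of_int (Vx s) - s * width t\<bar> \<le> (\<Sum>i\<in>{1..t}. \<bar>real (t div i) * real i * (?S i - s * phi i)\<bar>)"
    by (simp only: sum_abs)
  also have "\<dots> \<le> (\<Sum>i\<in>{1..t}. real t * real (card {e. e dvd i}))"
  proof (rule sum_mono)
    fix i assume i: "i \<in> {1..t}"
    have "real (t div i) * real i \<le> real t"
      by (metis div_times_less_eq_dividend of_nat_le_iff of_nat_mult)
    moreover have "\<bar>?S i - s * phi i\<bar> \<le> real (card {e. e dvd i})" using i by (intro signed_sum_coprime_bound) auto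
    ultimately show "\<bar>real (t div i) * real i * (?S i - s * phi i)\<bar> \<le> real t * real (card {e. e dvd i})"
      unfolding abs_mult by (intro mult_mono) auto
  qed
  also have "\<dots> = real t * (\<Sum>i\<in>{1..t}. real (card {e. e dvd i}))" by (simp add: sum_distrib_left)
  also have "\<dots> \<le> real t * (real t * (1 + ln (real t)))"
  proof (rule mult_left_mono)
    have "real t * harm t \<le> real t * (1 + ln (real t))" using harm_le_ln[OF t(2)] by (intro mult_left_mono) auto
    then show "(\<Sum>i\<in>{1..t}. real (card {e. e dvd i})) \<le> real t * (1 + ln (real t))"
      using sum_card_divisors[of t] by linarith
  qed simp
  finally show ?thesis using t by (simp add: power2_eq_square mult.assoc)
qed

text \<open>Twice the bound of \<open>Vx_linear\<close>, because two slopes are compared.\<close>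

definition err :: real where "err = 2 * (real_of_int tau)\<^sup>2 * (1 + ln tau)"

abbreviation "H \<equiv> width (nat tau)"

lemma Vx_diff: "\<bar>real_of_int (Vx a) - real_of_int (Vx b) - H * (a - b)\<bar> \<le> err"
  using Vx_linear[of a] Vx_linear[of b] by (simp add: err_def algebra_simps abs_le_iff)

lemma tau_ge_1: "1 \<le> real_of_int tau" using tau_pos by linarith

lemma err_bounds: "1 \<le> err" "real_of_int r \<le> err" "real_of_int tau \<le> err"
proof -
  have "1 \<le> 1 + ln (real_of_int tau)" using tau_ge_1 by simp
  then have "2 * (real_of_int tau)\<^sup>2 * 1 \<le> err" unfolding err_def by (intro mult_left_mono) auto
  moreover have "real_of_int tau * 1 \<le> (real_of_int tau)\<^sup>2"
    unfolding power2_eq_square using tau_ge_1 by (intro mult_left_mono) auto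
  moreover have "real_of_int r \<le> tau" using r_nonneg by (simp add: tau_def)
  ultimately show "1 \<le> err" "real_of_int r \<le> err" "real_of_int tau \<le> err" using tau_ge_1 by linarith+
qed

text \<open>The right-hand side is \<open>Vy a - b * Vx a\<close>, so the claim is that the vertex
  \<open>V a\<close> lies on or above the supporting line of slope \<open>b\<close>. Vectors between
  the two slopes are at most as steep as \<open>b\<close> if \<open>a \<le> b\<close> and steeper
  otherwise, which fixes the sign of every term.\<close>

lemma support_concave: "support b \<le> support a - (b - a) * Vx a"
proof (cases "a \<le> b")
  case True
  then have le: "rgerm a i \<le> rgerm b i" if "0 < i" for i
    using that by (auto simp: rgerm_def intro!: floor_mono mult_right_mono)
  have "real_of_int (Vy b - Vy a) - b * real_of_int (Vx b - Vx a)
     = (\<Sum>i\<in>{0<..tau}. \<Sum>y | y \<in> {rgerm a i<..rgerm b i} \<and> coprime y i. real_of_int (tau div i) * (real_of_int y - b * real_of_int i))"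
    using le by (subst V_diff, simp, subst V_diff, simp)
       (simp add: sum_distrib_left sum_subtractf right_diff_distrib ac_simps)
  also have "\<dots> \<le> 0"
  proof (intro sum_nonpos)
    fix i y assume i: "i \<in> {0<..tau}" and y: "y \<in> {y. y \<in> {rgerm a i<..rgerm b i} \<and> coprime y i}"
    have "real_of_int y \<le> b * i" using y by (auto simp: rgerm_def le_floor_iff)
    moreover have "0 \<le> tau div i" using i by (simp add: pos_imp_zdiv_nonneg_iff)
    ultimately show "real_of_int (tau div i) * (real_of_int y - b * real_of_int i) \<le> 0"
      by (intro mult_nonneg_nonpos) auto
  qed
  finally show ?thesis by (simp add: support_def algebra_simps)
next
  case False
  then have le: "rgerm b i \<le> rgerm a i" if "0 < i" for i
    using that by (auto simp: rgerm_def intro!: floor_mono mult_right_mono)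
  have "0 \<le> (\<Sum>i\<in>{0<..tau}. \<Sum>y | y \<in> {rgerm b i<..rgerm a i} \<and> coprime y i. real_of_int (tau div i) * (real_of_int y - b * real_of_int i))"
  proof (intro sum_nonneg)
    fix i y assume i: "i \<in> {0<..tau}" and y: "y \<in> {y. y \<in> {rgerm b i<..rgerm a i} \<and> coprime y i}"
    have "b * i < real_of_int y" using y by (auto simp: rgerm_def floor_less_iff)
    moreover have "0 \<le> tau div i" using i by (simp add: pos_imp_zdiv_nonneg_iff)
    ultimately show "0 \<le> real_of_int (tau div i) * (real_of_int y - b * real_of_int i)"
      by (intro mult_nonneg_nonneg) auto
  qed
  also have "\<dots> = real_of_int (Vy a - Vy b) - b * real_of_int (Vx a - Vx b)"
    using le by (subst V_diff, simp, subst V_diff, simp)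
       (simp add: sum_distrib_left sum_subtractf right_diff_distrib ac_simps)
  finally show ?thesis by (simp add: support_def algebra_simps)
qed

lemma support_estimate:
  fixes s s0 :: real
  shows "\<bar>support s - support s0 + real_of_int (Vx s0) * (s - s0) + H * (s - s0)\<^sup>2 / 2\<bar> \<le> err * \<bar>s - s0\<bar>"
  using support_concave Vx_diff by (rule concave_quadratic_estimate)

lemma U_height:
  assumes "(X, Y) \<in> U m"
  shows "support s + m / tau \<le> real_of_int Y - s * real_of_int X"
proof -
  have "real_of_int m \<le> real_of_int (N s X Y)" using assms by (simp add: U_def)
  then have "real_of_int m \<le> tau * (Y - s * X - support s)" using N_bounds(1)[of s X Y] by linarith
  then show ?thesis using tau_pos by (simp add: field_simps)
qed

text \<open>The assumption on \<open>K - H\<close> makes the polygon more strongly curved than the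
  parabola, by enough to absorb all linear errors. The one on \<open>H\<close> lets a slope change
  of at most 1 carry a vertex past \<open>X0\<close>.\<close>

lemma inner_comparison:
  fixes K b c X0 :: real
  assumes K: "err \<le> K - H" and H: "err + r + 1 \<le> H"
  defines "F \<equiv> \<lambda>X. X\<^sup>2 / (2 * K) + b * X + c"
  obtains tX tY :: int where
    "\<And>X Y. (X, Y) \<in> U 0 \<Longrightarrow> F (real_of_int (X + tX)) \<le> real_of_int (Y + tY)"
    "\<And>m. \<exists>y. (X0, y) \<in> convex hull ((\<lambda>(X, Y). (real_of_int (X + tX), real_of_int (Y + tY))) ` U m)
        \<and> y \<le> F X0 + m / tau + 20 * err"
proof -
  have H0: "0 < H" using H err_bounds r_nonneg by linarith
  have K0: "0 < K" using K H0 err_bounds by linarith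
  define s0 where "s0 = b + X0 / K"
  define P where "P s = c - K * (s - b)\<^sup>2 / 2" for s
  have PF_eq: "P (b + X / K) + (b + X / K) * X = F X" for X
    using K0 by (simp add: F_def P_def power2_eq_square field_simps)
  have P_exp: "P s = P s0 - X0 * (s - s0) - K * (s - s0)\<^sup>2 / 2" for s
    using K0 by (simp add: P_def s0_def power2_eq_square field_simps)
  \<comment> \<open>\<open>P\<close> is the support function of the parabola. As its curvature is smaller than that of the strip
    polygon by a margin, a translate of the polygon that nearly touches at slope \<open>s0\<close> stays inside.\<close>
  define tX where "tX = \<lfloor>X0 - Vx s0\<rfloor>"
  define tY where "tY = \<lceil>P s0 - support s0 + s0 * tX + 2 * err\<rceil>"
  have tX: "0 \<le> X0 - Vx s0 - tX" "X0 - Vx s0 - tX \<le> 1" unfolding tX_def by linarith+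
  define C0 where "C0 = support s0 + tY - s0 * tX - P s0"
  have C0: "2 * err \<le> C0" "C0 \<le> 2 * err + 1" unfolding C0_def tY_def by linarith+
  have key: "P s \<le> support s + tY - s * tX" for s
  proof -
    define D where "D = s - s0"
    have "- err * \<bar>D\<bar> \<le> support s - support s0 + Vx s0 * D + H * D\<^sup>2 / 2"
      using support_estimate[of s s0] by (simp add: D_def)
    moreover have "support s + tY - s * tX - P s =
      C0 + (support s - support s0 + Vx s0 * D + H * D\<^sup>2 / 2) + (X0 - Vx s0 - tX) * D + (K - H) * D\<^sup>2 / 2"
      unfolding P_exp[of s] C0_def D_def by (simp add: field_simps)
    moreover have "- \<bar>D\<bar> \<le> (X0 - Vx s0 - tX) * D"
    proof -
      have "\<bar>(X0 - Vx s0 - tX) * D\<bar> \<le> 1 * \<bar>D\<bar>" unfolding abs_mult using tX by (intro mult_right_mono) auto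
      then show ?thesis by linarith
    qed
    moreover have "err * D\<^sup>2 / 2 \<le> (K - H) * D\<^sup>2 / 2" using K by (intro divide_right_mono mult_right_mono) auto
    moreover have "- 2 * err \<le> err * D\<^sup>2 / 2 - (err + 1) * \<bar>D\<bar>" using err_bounds by (intro quadratic_lower_bound)
    moreover have "(err + 1) * \<bar>D\<bar> = err * \<bar>D\<bar> + \<bar>D\<bar>" by (simp add: algebra_simps)
    ultimately show ?thesis using C0 by linarith
  qed
  have 1: "F (real_of_int (X + tX)) \<le> real_of_int (Y + tY)" if "(X, Y) \<in> U 0" for X Y
  proof -
    let ?s = "b + real_of_int (X + tX) / K"
    have "F (real_of_int (X + tX)) = P ?s + ?s * real_of_int (X + tX)" using PF_eq by simp
    also have "\<dots> \<le> support ?s + tY - ?s * tX + ?s * real_of_int (X + tX)" using key[of ?s] by linarith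
    also have "\<dots> = support ?s + tY + ?s * X"
    proof -
      have "support s + tY - s * tX + s * real_of_int (X + tX) = support s + tY + s * X" for s by (simp add: algebra_simps)
      then show ?thesis .
    qed
    also have "\<dots> \<le> real_of_int (Y + tY)" using U_height[OF that, of ?s] by simp
    finally show ?thesis .
  qed
  have 2: "\<exists>y. (X0, y) \<in> convex hull ((\<lambda>(X, Y). (real_of_int (X + tX), real_of_int (Y + tY))) ` U m)
        \<and> y \<le> F X0 + m / tau + 20 * err" for m
  proof -
    let ?h = "\<lambda>(X, Y). (real_of_int (X + tX), real_of_int (Y + tY))"
    \<comment> \<open>A slope change of \<open>\<delta>\<close> moves the vertex by at least
      \<open>H * \<delta> - err = r + 1\<close>: this covers the offset \<open>r\<close> inside the
      strip and the rounding of \<open>tX\<close>.\<close>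
    define \<delta> where "\<delta> = (err + r + 1) / H"
    have \<delta>: "0 < \<delta>" "\<delta> \<le> 1" "H * \<delta> = err + r + 1"
      using H H0 err_bounds r_nonneg by (auto simp: \<delta>_def)
    have height: "real_of_int (Y + tY) - s0 * real_of_int (X + tX) \<le> P s0 + m / tau + 20 * err"
      if v: "\<bar>X - Vx s\<bar> \<le> r" "N s X Y = m" and s: "\<bar>s - s0\<bar> \<le> 2 * \<delta>" for s X Y
    proof -
      have "tau * (Y - s * X - support s) \<le> m + tau" using N_bounds(2)[where s = s and X = X and Y = Y] v(2) by linarith
      then have a: "Y - s * X \<le> support s + m / tau + 1" using tau_pos by (simp add: field_simps)
      have b: "support s \<le> support s0 - (s - s0) * Vx s0" by (rule support_concave)
      have "\<bar>real_of_int X - Vx s\<bar> \<le> r" using v(1) by linarith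
      moreover have "\<bar>H * (s - s0)\<bar> \<le> 2 * (err + r + 1)"
      proof -
        have "\<bar>H * (s - s0)\<bar> = H * \<bar>s - s0\<bar>" using H0 by (simp add: abs_mult)
        also have "\<dots> \<le> H * (2 * \<delta>)" using s H0 by (intro mult_left_mono) auto
        also have "\<dots> = 2 * (err + r + 1)" using \<delta>(3) by simp
        finally show ?thesis .
      qed
      moreover have "\<bar>u + v + w\<bar> \<le> x + y + z" if "\<bar>u\<bar> \<le> x" "\<bar>v\<bar> \<le> y" "\<bar>w\<bar> \<le> z" for u v w x y z :: real
        using that by linarith
      ultimately have "\<bar>(real_of_int X - Vx s) + H * (s - s0) + (real_of_int (Vx s) - Vx s0 - H * (s - s0))\<bar>
          \<le> r + 2 * (err + r + 1) + err"
        using Vx_diff[of s s0] by blast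
      then have X: "\<bar>real_of_int X - Vx s0\<bar> \<le> 6 * err + 2"
        using err_bounds by simp
      have "(s - s0) * (real_of_int X - Vx s0) \<le> \<bar>s - s0\<bar> * \<bar>real_of_int X - Vx s0\<bar>"
        unfolding abs_mult[symmetric] by (rule abs_ge_self)
      also have "\<dots> \<le> 2 * (6 * err + 2)" using s X \<delta> err_bounds by (intro mult_mono) auto
      finally have c: "(s - s0) * (real_of_int X - Vx s0) \<le> 12 * err + 4" by simp
      have "real_of_int (Y + tY) - s0 * real_of_int (X + tX)
          = (Y - s * X) + (s - s0) * X + (C0 + P s0 - support s0)"
        by (simp add: C0_def algebra_simps)
      also have "\<dots> \<le> (support s0 - (s - s0) * Vx s0 + m / tau + 1) + (s - s0) * X + (C0 + P s0 - support s0)"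
        using a b by linarith
      also have "\<dots> = m / tau + 1 + (s - s0) * (real_of_int X - Vx s0) + C0 + P s0" by (simp add: algebra_simps)
      \<comment> \<open>The terms add up to \<open>1 + (12 * err + 4) + (2 * err + 1)\<close>, below
        \<open>20 * err\<close> since \<open>err \<ge> 1\<close>.\<close>
      finally show ?thesis using c C0 err_bounds by linarith
    qed
    \<comment> \<open>Vertices of depth \<open>m\<close> at irrational slopes on both sides of
      \<open>s0\<close> bracket \<open>X0\<close>, and both are low relative to the tangent at
      \<open>X0\<close>.\<close>
    obtain s2 where s2: "s0 + \<delta> < s2" "s2 < s0 + 2 * \<delta>" "s2 \<notin> \<rat>"
      by (rule exists_irrational_between[of "s0 + \<delta>" "s0 + 2 * \<delta>"]) (use \<delta>(1) in auto)
    obtain s1 where s1: "s0 - 2 * \<delta> < s1" "s1 < s0 - \<delta>" "s1 \<notin> \<rat>"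
      by (rule exists_irrational_between[of "s0 - 2 * \<delta>" "s0 - \<delta>"]) (use \<delta>(1) in auto)
    obtain X2 Y2 where v2: "(X2, Y2) \<in> U m" "\<bar>X2 - Vx s2\<bar> \<le> r" "N s2 X2 Y2 = m"
      by (rule minimal_vertex[OF s2(3), of m])
    obtain X1 Y1 where v1: "(X1, Y1) \<in> U m" "\<bar>X1 - Vx s1\<bar> \<le> r" "N s1 X1 Y1 = m"
      by (rule minimal_vertex[OF s1(3), of m])
    have "H * \<delta> \<le> H * (s2 - s0)" using s2 H0 by (intro mult_left_mono) auto
    moreover have "\<bar>real_of_int X2 - Vx s2\<bar> \<le> r" using v2(2) by linarith
    ultimately have X2: "X0 \<le> real_of_int (X2 + tX)" using Vx_diff[of s2 s0] tX \<delta>(3) by simp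
    have "H * (s1 - s0) \<le> H * (- \<delta>)" using s1 H0 by (intro mult_left_mono) auto
    moreover have "\<bar>real_of_int X1 - Vx s1\<bar> \<le> r" using v1(2) by linarith
    ultimately have X1: "real_of_int (X1 + tX) \<le> X0" using Vx_diff[of s1 s0] tX \<delta>(3) by simp
    have in1: "(real_of_int (X1 + tX), real_of_int (Y1 + tY)) \<in> convex hull (?h ` U m)"
      using v1(1) by (intro hull_inc image_eqI[of _ _ "(X1, Y1)"]) auto
    have in2: "(real_of_int (X2 + tX), real_of_int (Y2 + tY)) \<in> convex hull (?h ` U m)"
      using v2(1) by (intro hull_inc image_eqI[of _ _ "(X2, Y2)"]) auto
    have h1: "real_of_int (Y1 + tY) - s0 * real_of_int (X1 + tX) \<le> P s0 + m / tau + 20 * err"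
      using v1(2,3) s1 \<delta>(1) by (intro height[of X1 s1]) auto
    have h2: "real_of_int (Y2 + tY) - s0 * real_of_int (X2 + tX) \<le> P s0 + m / tau + 20 * err"
      using v2(2,3) s2 \<delta>(1) by (intro height[of X2 s2]) auto
    obtain y where y: "(X0, y) \<in> convex hull (?h ` U m)" "y - s0 * X0 \<le> P s0 + m / tau + 20 * err"
      using convex_point_between[OF convex_convex_hull in1 in2 X1 X2 h1 h2] by blast
    have "P s0 + s0 * X0 = F X0" using PF_eq[of X0] by (simp add: s0_def)
    then show ?thesis using y by (intro exI[of _ y]) auto
  qed
  show thesis using that[of tX tY] 1 2 by blast
qed

text \<open>Here the polygon is flatter than the parabola, so a translate slightly below contains
  all grid points above the parabola. For the height at \<open>X0\<close> one supporting line
  suffices, that of the tangent slope \<open>s0\<close>; as a linear inequality it passes to convex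
  hulls.\<close>

lemma outer_comparison:
  fixes K b c X0 :: real
  assumes K: "err \<le> H - K" "0 < K"
  defines "F \<equiv> \<lambda>X. X\<^sup>2 / (2 * K) + b * X + c"
  obtains tX tY :: int and s0 :: real where
    "\<And>X Y. F (real_of_int X) \<le> real_of_int Y \<Longrightarrow> (X - tX, Y - tY) \<in> U 0"
    "\<And>m X Y. (X, Y) \<in> U m \<Longrightarrow> F X0 + m / tau - 4 * err \<le> real_of_int (Y + tY) - s0 * (real_of_int (X + tX) - X0)"
proof -
  have K0: "0 < K" by fact
  define s0 where "s0 = b + X0 / K"
  define P where "P s = c - K * (s - b)\<^sup>2 / 2" for s
  have PF: "P s + s * X \<le> F X" for s X
  proof -
    have "F X - (P s + s * X) = (X - K * (s - b))\<^sup>2 / (2 * K)"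
      using K0 by (simp add: F_def P_def power2_eq_square field_simps)
    then show ?thesis using K0 by (smt (verit) divide_nonneg_pos zero_le_power2)
  qed
  have PF_eq: "P s0 + s0 * X0 = F X0"
    using K0 by (simp add: F_def P_def s0_def power2_eq_square field_simps)
  have P_exp: "P s = P s0 - X0 * (s - s0) - K * (s - s0)\<^sup>2 / 2" for s
    using K0 by (simp add: P_def s0_def power2_eq_square field_simps)
  define tX where "tX = \<lfloor>X0 - Vx s0\<rfloor>"
  \<comment> \<open>The additional 1 pays for the loss of \<open>tau\<close> in the lower bound of
    \<open>N_bounds\<close>: depth is guaranteed nonnegative only from height 1 on.\<close>
  define tY where "tY = \<lfloor>P s0 - support s0 + s0 * tX - 2 * err - 1\<rfloor>"
  have tX: "0 \<le> X0 - Vx s0 - tX" "X0 - Vx s0 - tX \<le> 1" unfolding tX_def by linarith+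
  define C0 where "C0 = P s0 - (support s0 + tY - s0 * tX)"
  have C0: "2 * err + 1 \<le> C0" "C0 \<le> 2 * err + 2" unfolding C0_def tY_def by linarith+
  have key: "support s + tY - s * tX + 1 \<le> P s" for s
  proof -
    define D where "D = s - s0"
    have "support s - support s0 + Vx s0 * D + H * D\<^sup>2 / 2 \<le> err * \<bar>D\<bar>"
      using support_estimate[of s s0] by (simp add: D_def)
    moreover have "P s - (support s + tY - s * tX) =
      C0 - (support s - support s0 + Vx s0 * D + H * D\<^sup>2 / 2) - (X0 - Vx s0 - tX) * D + (H - K) * D\<^sup>2 / 2"
      unfolding P_exp[of s] C0_def D_def by (simp add: field_simps)
    moreover have "(X0 - Vx s0 - tX) * D \<le> \<bar>D\<bar>"
    proof -
      have "\<bar>(X0 - Vx s0 - tX) * D\<bar> \<le> 1 * \<bar>D\<bar>" unfolding abs_mult using tX by (intro mult_right_mono) auto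
      then show ?thesis by linarith
    qed
    moreover have "err * D\<^sup>2 / 2 \<le> (H - K) * D\<^sup>2 / 2" using K by (intro divide_right_mono mult_right_mono) auto
    moreover have "- 2 * err \<le> err * D\<^sup>2 / 2 - (err + 1) * \<bar>D\<bar>" using err_bounds by (intro quadratic_lower_bound)
    moreover have "(err + 1) * \<bar>D\<bar> = err * \<bar>D\<bar> + \<bar>D\<bar>" by (simp add: algebra_simps)
    ultimately show ?thesis using C0 by linarith
  qed
  have 1: "(X - tX, Y - tY) \<in> U 0" if "F (real_of_int X) \<le> real_of_int Y" for X Y
  proof -
    have "0 \<le> N s (X - tX) (Y - tY)" for s
    proof -
      have "1 \<le> real_of_int (Y - tY) - s * real_of_int (X - tX) - support s"
        using key[of s] PF[of s X] that by (simp add: algebra_simps)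
      then have "real_of_int tau * 1 \<le> tau * (real_of_int (Y - tY) - s * real_of_int (X - tX) - support s)"
        using tau_pos by (intro mult_left_mono) auto
      then have "0 \<le> real_of_int (N s (X - tX) (Y - tY))"
        using N_bounds(2)[where s = s and X = "X - tX" and Y = "Y - tY"] by linarith
      then show ?thesis by simp
    qed
    then show ?thesis by (simp add: U_def)
  qed
  have 2: "F X0 + m / tau - 4 * err \<le> real_of_int (Y + tY) - s0 * (real_of_int (X + tX) - X0)"
    if "(X, Y) \<in> U m" for m X Y
  proof -
    have "real_of_int (Y + tY) - s0 * (real_of_int (X + tX) - X0)
       = (Y - s0 * X) + (P s0 + s0 * X0) - C0 - support s0"
      by (simp add: C0_def algebra_simps)
    then show ?thesis using U_height[OF that, of s0] C0 err_bounds PF_eq by linarith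
  qed
  show thesis using that[of tX tY s0] 1 2 by blast
qed

end

section \<open>Monotonicity and affine invariance of peeling, transfer to the grid\<close>

lemma peel_mono: "S \<subseteq> T \<Longrightarrow> peel S \<subseteq> peel T"
proof
  fix p assume ST: "S \<subseteq> T" and p: "p \<in> peel S"
  then have pS: "p \<in> S" "\<not> p extreme_point_of (convex hull S)" by (auto simp: peel_def)
  \<comment> \<open>A segment in the smaller hull with \<open>p\<close> in its interior also lies in
    the larger hull, so a point that survives in \<open>S\<close> survives in
    \<open>T\<close>.\<close>
  have "convex hull S \<subseteq> convex hull T" using ST by (rule hull_mono)
  moreover have "p \<in> convex hull S" using pS(1) by (rule hull_inc)
  ultimately have "\<not> p extreme_point_of (convex hull T)"
    using pS(2) unfolding extreme_point_of_def by blast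
  then show "p \<in> peel T" using pS ST by (auto simp: peel_def)
qed

lemma peel_pow_mono: "S \<subseteq> T \<Longrightarrow> (peel ^^ m) S \<subseteq> (peel ^^ m) T"
  by (induction m) (auto intro: peel_mono[THEN subsetD])

lemma peel_affine:
  fixes v :: "real \<times> real" and c :: real
  assumes "c \<noteq> 0"
  shows "peel ((\<lambda>p. v + c *\<^sub>R p) ` S) = (\<lambda>p. v + c *\<^sub>R p) ` peel S"
proof -
  let ?f = "\<lambda>p. v + c *\<^sub>R p"
  have inj: "inj ?f" using assms by (auto simp: inj_def)
  have ext: "?f p extreme_point_of (convex hull (?f ` S)) \<longleftrightarrow> p extreme_point_of (convex hull S)" for p
  proof -
    have "convex hull (?f ` S) = (\<lambda>x. v + x) ` ((*\<^sub>R) c ` (convex hull S))"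
      by (simp add: convex_hull_affinity image_image)
    then have "?f p extreme_point_of (convex hull (?f ` S)) \<longleftrightarrow> c *\<^sub>R p extreme_point_of ((*\<^sub>R) c ` (convex hull S))"
      by (simp add: extreme_point_of_translation_eq)
    also have "\<dots> \<longleftrightarrow> p extreme_point_of (convex hull S)"
    proof -
      have mem: "c *\<^sub>R x \<in> (*\<^sub>R) c ` A \<longleftrightarrow> x \<in> A" for x :: "real \<times> real" and A
        using assms by (intro inj_image_mem_iff) (auto simp: inj_def)
      have seg: "open_segment (c *\<^sub>R x) (c *\<^sub>R y) = (*\<^sub>R) c ` open_segment x y" for x y :: "real \<times> real"
        using assms by (intro open_segment_linear_image) (auto simp: inj_def)
      show ?thesis by (simp add: extreme_point_of_def mem seg)
    qed
    finally show ?thesis .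
  qed
  show ?thesis
    unfolding peel_def using ext inj by (auto dest: injD)
qed

lemma peel_pow_affine:
  fixes v :: "real \<times> real" and c :: real
  assumes "c \<noteq> 0"
  shows "(peel ^^ m) ((\<lambda>p. v + c *\<^sub>R p) ` S) = (\<lambda>p. v + c *\<^sub>R p) ` (peel ^^ m) S"
  by (induction m) (simp_all add: peel_affine[OF assms])

text \<open>Multiplying the grid by \<open>n\<close> divides the curvature by \<open>n\<close>;
  \<open>n / a\<close> is the parameter to be compared with the period \<open>H\<close>.\<close>

lemma grid_epi_parabola:
  assumes "n > 0" "a > 0"
  shows "grid_epi n (\<lambda>x. a / 2 * x\<^sup>2 + b * x + c) =
    (\<lambda>(X::int, Y::int). (real_of_int X / n, real_of_int Y / n)) `
      {(X, Y). (real_of_int X)\<^sup>2 / (2 * (n / a)) + b * X + c * n \<le> Y}"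
proof -
  have "a / 2 * (real_of_int X / n)\<^sup>2 + b * (real_of_int X / n) + c \<le> real_of_int Y / n \<longleftrightarrow>
      (real_of_int X)\<^sup>2 / (2 * (n / a)) + b * X + c * n \<le> Y" for X Y :: int
  proof -
    have "(a / 2 * (real_of_int X / n)\<^sup>2 + b * (real_of_int X / n) + c) * n
        = (real_of_int X)\<^sup>2 / (2 * (n / a)) + b * X + c * n"
      using assms by (simp add: power2_eq_square field_simps)
    then show ?thesis using assms by (simp add: le_divide_eq)
  qed
  then show ?thesis unfolding grid_epi_def grid_def by force
qed

context strip
begin

lemma peel_pow_image:
  fixes n :: nat
  assumes "n > 0"
  shows "(peel ^^ m) ((\<lambda>(X, Y). (real_of_int (X + tX) / n, real_of_int (Y + tY) / n)) ` U 0)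
    = (\<lambda>(X, Y). (real_of_int (X + tX) / n, real_of_int (Y + tY) / n)) ` U (int m)"
proof -
  let ?v = "(real_of_int tX / n, real_of_int tY / n)" and ?c = "1 / real n"
  have h: "(\<lambda>(X, Y). (real_of_int (X + tX) / n, real_of_int (Y + tY) / n)) ` A = (\<lambda>p. ?v + ?c *\<^sub>R p) ` pt ` A" for A
    unfolding image_image by (intro image_cong) (auto simp: add_divide_distrib)
  show ?thesis unfolding h using assms by (subst peel_pow_affine) (auto simp: peel_pow_U)
qed

text \<open>A point of the hull is produced instead of a bound on the infimum: it also shows that
  the set under the infimum is nonempty, while \<open>peeled_hull_ge\<close> bounds it from
  below.\<close>

lemma grid_polygon_le_witness:
  fixes n m :: nat and a b c x :: real
  assumes n: "n > 0" and a: "a > 0" and K: "err \<le> n / a - H" "err + r + 1 \<le> H"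
  shows "\<exists>y. (x, y) \<in> convex hull ((peel ^^ m) (grid_epi n (\<lambda>x. a / 2 * x\<^sup>2 + b * x + c)))
    \<and> y \<le> a / 2 * x\<^sup>2 + b * x + c + (m / tau + 20 * err) / n"
proof -
  let ?F = "\<lambda>X::real. X\<^sup>2 / (2 * (n / a)) + b * X + c * n"
  let ?f = "\<lambda>x. a / 2 * x\<^sup>2 + b * x + c"
  obtain tX tY where t: "\<And>X Y. (X, Y) \<in> U 0 \<Longrightarrow> ?F (real_of_int (X + tX)) \<le> real_of_int (Y + tY)"
    "\<And>m. \<exists>y. (n * x, y) \<in> convex hull ((\<lambda>(X, Y). (real_of_int (X + tX), real_of_int (Y + tY))) ` U m)
        \<and> y \<le> ?F (n * x) + m / tau + 20 * err"
    using inner_comparison[OF K, of b "c * n" "n * x"] by metis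
  let ?h = "\<lambda>(X, Y). (real_of_int (X + tX) / n, real_of_int (Y + tY) / n)"
  have "?h ` U 0 \<subseteq> grid_epi n ?f"
  proof
    fix q assume "q \<in> ?h ` U 0"
    then obtain X Y where XY: "(X, Y) \<in> U 0" "q = (real_of_int (X + tX) / n, real_of_int (Y + tY) / n)" by auto
    then show "q \<in> grid_epi n ?f"
      unfolding grid_epi_parabola[OF n a] using t(1)[OF XY(1)]
      by (intro image_eqI[of _ _ "(X + tX, Y + tY)"]) auto
  qed
  then have sub: "?h ` U (int m) \<subseteq> (peel ^^ m) (grid_epi n ?f)"
    using peel_pow_mono[of "?h ` U 0" "grid_epi n ?f" m] peel_pow_image[OF n, of m tX tY] by simp
  obtain y where y: "(n * x, y) \<in> convex hull ((\<lambda>(X, Y). (real_of_int (X + tX), real_of_int (Y + tY))) ` U (int m))"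
    "y \<le> ?F (n * x) + m / tau + 20 * err" using t(2)[of "int m"] by auto
  have "?h ` U (int m) = (*\<^sub>R) (1 / real n) ` ((\<lambda>(X, Y). (real_of_int (X + tX), real_of_int (Y + tY))) ` U (int m))"
    unfolding image_image by (intro image_cong) auto
  then have "convex hull (?h ` U (int m)) = (*\<^sub>R) (1 / real n) ` (convex hull ((\<lambda>(X, Y). (real_of_int (X + tX), real_of_int (Y + tY))) ` U (int m)))"
    by (simp only: convex_hull_scaling)
  then have "(1 / real n) *\<^sub>R (n * x, y) \<in> convex hull (?h ` U (int m))" using y(1) by blast
  then have "(x, y / n) \<in> convex hull ((peel ^^ m) (grid_epi n ?f))"
    using n hull_mono[OF sub, of convex] by auto
  moreover have "y / n \<le> ?f x + (m / tau + 20 * err) / n"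
  proof -
    have "?F (n * x) = n * ?f x" using n a by (simp add: power2_eq_square field_simps)
    then have "y / n \<le> (n * ?f x + (m / tau + 20 * err)) / n" using y(2) by (intro divide_right_mono) auto
    also have "\<dots> = ?f x + (m / tau + 20 * err) / n" using n by (simp add: add_divide_distrib)
    finally show ?thesis .
  qed
  ultimately show ?thesis by blast
qed

lemma peeled_hull_ge:
  fixes n m :: nat and a b c x y :: real
  assumes n: "n > 0" and a: "a > 0" and K: "err \<le> H - n / a"
    and y: "(x, y) \<in> convex hull ((peel ^^ m) (grid_epi n (\<lambda>x. a / 2 * x\<^sup>2 + b * x + c)))"
  shows "a / 2 * x\<^sup>2 + b * x + c + (m / tau - 4 * err) / n \<le> y"
proof -
  let ?F = "\<lambda>X::real. X\<^sup>2 / (2 * (n / a)) + b * X + c * n"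
  let ?f = "\<lambda>x. a / 2 * x\<^sup>2 + b * x + c"
  have K0: "0 < n / a" using n a by simp
  obtain tX tY s0 where t: "\<And>X Y. ?F (real_of_int X) \<le> real_of_int Y \<Longrightarrow> (X - tX, Y - tY) \<in> U 0"
    "\<And>m X Y. (X, Y) \<in> U m \<Longrightarrow> ?F (n * x) + m / tau - 4 * err \<le> real_of_int (Y + tY) - s0 * (real_of_int (X + tX) - n * x)"
    using outer_comparison[OF K K0, of b "c * n" "n * x"] by metis
  let ?h = "\<lambda>(X, Y). (real_of_int (X + tX) / n, real_of_int (Y + tY) / n)"
  have "grid_epi n ?f \<subseteq> ?h ` U 0"
  proof
    fix q assume "q \<in> grid_epi n ?f"
    then obtain X Y :: int where XY: "?F X \<le> Y" "q = (real_of_int X / n, real_of_int Y / n)"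
      unfolding grid_epi_parabola[OF n a] by auto
    then show "q \<in> ?h ` U 0"
      using t(1)[OF XY(1)] by (intro image_eqI[of _ _ "(X - tX, Y - tY)"]) auto
  qed
  then have sub: "(peel ^^ m) (grid_epi n ?f) \<subseteq> ?h ` U (int m)"
    using peel_pow_mono[of "grid_epi n ?f" "?h ` U 0" m] peel_pow_image[OF n, of m tX tY] by simp
  let ?B = "?f x + (m / tau - 4 * err) / n - s0 * x"
  have "?h ` U (int m) \<subseteq> {q. (- s0, 1) \<bullet> q \<ge> ?B}"
  proof
    fix q assume "q \<in> ?h ` U (int m)"
    then obtain X Y where XY: "(X, Y) \<in> U (int m)" "q = (real_of_int (X + tX) / n, real_of_int (Y + tY) / n)" by auto
    have "?F (n * x) = n * ?f x" using n a by (simp add: power2_eq_square field_simps)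
    then have "(n * ?f x + (m / tau - 4 * err)) / n \<le> (real_of_int (Y + tY) - s0 * (real_of_int (X + tX) - n * x)) / n"
      using t(2)[OF XY(1)] by (intro divide_right_mono) auto
    also have "(n * ?f x + (m / tau - 4 * err)) / n = ?f x + (m / tau - 4 * err) / n"
      using n by (simp add: add_divide_distrib)
    also have "(real_of_int (Y + tY) - s0 * (real_of_int (X + tX) - n * x)) / n
        = real_of_int (Y + tY) / n - s0 * (real_of_int (X + tX) / n) + s0 * x"
      using n by (simp add: diff_divide_distrib right_diff_distrib)
    finally have "?B \<le> real_of_int (Y + tY) / n - s0 * (real_of_int (X + tX) / n)" by linarith
    then show "q \<in> {q. (- s0, 1) \<bullet> q \<ge> ?B}" by (simp add: XY(2))
  qed
  then have "convex hull ((peel ^^ m) (grid_epi n ?f)) \<subseteq> {q. (- s0, 1) \<bullet> q \<ge> ?B}"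
    using sub by (intro hull_minimal convex_halfspace_ge) auto
  then have "(- s0, 1) \<bullet> (x, y) \<ge> ?B" using y by blast
  then show ?thesis by simp
qed

end

subsection \<open>Choice of the period\<close>

definition odd_err :: "nat \<Rightarrow> real" where
  "odd_err r = 2 * (2 * real r + 1)\<^sup>2 * (1 + ln (2 * real r + 1))"

text \<open>\<open>root 3 (K / h)\<close> is the ideal real value of \<open>tau\<close>. Its cube
  differs from that of \<open>2 * r + 1\<close> by a multiple of \<open>odd_err r\<close>, and
  dividing by the square leaves a logarithmic difference; a constant fraction of \<open>tau\<close>
  bounds it, so the two are comparable.\<close>

lemma widths_near:
  fixes h :: real
  defines "h \<equiv> 2 * zeta3 / pi ^ 2"
  obtains R :: nat and C :: real where
    "\<And>r K. R \<le> r \<Longrightarrow> 0 < K \<Longrightarrow> \<bar>K - width (2 * r + 1)\<bar> \<le> 124 * odd_err r \<Longrightarrow>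
       odd_err r + real r + 1 \<le> width (2 * r + 1) \<and>
       \<bar>1 / (2 * real r + 1) - 1 / root 3 (K / h)\<bar> \<le> C * ln K / (root 3 (K / h))\<^sup>2 \<and>
       odd_err r \<le> C * (root 3 (K / h))\<^sup>2 * ln K \<and> 1 \<le> odd_err r"
proof -
  have h: "0 < h" unfolding h_def using sum_inverse_powers_bounds(5) by simp
  \<comment> \<open>127 is 124 from the distance between \<open>K\<close> and the width plus 3 from
    the distance between the width and \<open>h * t ^ 3\<close>.\<close>
  define A where "A = 127 / h"
  have A: "0 < A" using h by (simp add: A_def)
  \<comment> \<open>Of the three conditions for large \<open>r\<close>, this one keeps
    \<open>k\<close> between \<open>t / 2\<close> and \<open>3 / 2 * t\<close>, the next bounds
    \<open>ln t\<close> by \<open>ln K\<close>, and the last leaves room for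
    \<open>odd_err r + r + 1\<close> below the width.\<close>
  have "eventually (\<lambda>r::nat. 2 * A * (1 + ln (2 * real r + 1)) \<le> (2 * real r + 1) / 2) at_top"
    by real_asymp
  moreover have "eventually (\<lambda>r::nat. 1 + ln (2 * real r + 1) \<le> ln (h / 8) + 3 * ln (2 * real r + 1)) at_top"
    by real_asymp
  moreover have "eventually (\<lambda>r::nat. 4 * (2 * (2 * real r + 1)\<^sup>2 * (1 + ln (2 * real r + 1))) + real r + 1 \<le> h * (2 * real r + 1) ^ 3) at_top"
    using h by real_asymp
  ultimately have "eventually (\<lambda>r::nat. 2 * A * (1 + ln (2 * real r + 1)) \<le> (2 * real r + 1) / 2 \<and>
      1 + ln (2 * real r + 1) \<le> ln (h / 8) + 3 * ln (2 * real r + 1) \<and>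
      4 * (2 * (2 * real r + 1)\<^sup>2 * (1 + ln (2 * real r + 1))) + real r + 1 \<le> h * (2 * real r + 1) ^ 3) at_top"
    by eventually_elim auto
  then obtain R where R: "\<And>r::nat. r \<ge> R \<Longrightarrow> 2 * A * (1 + ln (2 * real r + 1)) \<le> (2 * real r + 1) / 2 \<and>
      1 + ln (2 * real r + 1) \<le> ln (h / 8) + 3 * ln (2 * real r + 1) \<and>
      4 * (2 * (2 * real r + 1)\<^sup>2 * (1 + ln (2 * real r + 1))) + real r + 1 \<le> h * (2 * real r + 1) ^ 3"
    by (auto simp: eventually_at_top_linorder)
  define C where "C = 3 * A + 8"
  show thesis
  proof (rule that[of R C])
    fix r :: nat and K :: real
    assume r: "R \<le> r" and K: "0 < K" and near: "\<bar>K - width (2 * r + 1)\<bar> \<le> 124 * odd_err r"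
    define t where "t = 2 * real r + 1"
    define L where "L = 1 + ln t"
    define e where "e = 2 * t\<^sup>2 * L"
    define k where "k = root 3 (K / h)"
    have t1: "1 \<le> t" by (simp add: t_def)
    have L1: "1 \<le> L" using t1 by (simp add: L_def)
    have rt: "real (2 * r + 1) = t" by (simp add: t_def)
    have e1: "1 \<le> e"
    proof -
      have "1 * 1 \<le> t\<^sup>2 * L" using t1 L1 by (intro mult_mono) auto
      then show ?thesis unfolding e_def by linarith
    qed
    have R': "2 * A * L \<le> t / 2" "L \<le> ln (h / 8) + 3 * ln t" "4 * e + real r + 1 \<le> h * t ^ 3"
      using R[OF r] by (auto simp: t_def L_def e_def)
    have near': "\<bar>K - width (2 * r + 1)\<bar> \<le> 124 * e" using near by (simp add: t_def L_def e_def odd_err_def)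
    have W: "\<bar>width (2 * r + 1) - h * t ^ 3\<bar> \<le> 3 * e"
    proof -
      have "\<bar>width (2 * r + 1) - h * t ^ 3\<bar> \<le> 5 * t\<^sup>2 * harm (2 * r + 1)"
        using width_bound[of "2 * r + 1"] unfolding rt h_def by simp
      also have "\<dots> \<le> 5 * t\<^sup>2 * L"
        using harm_le_ln[of "2 * r + 1"] unfolding rt L_def by (intro mult_left_mono) auto
      also have "\<dots> \<le> 3 * e" using L1 by (simp add: e_def)
      finally show ?thesis .
    qed
    have k0: "0 < k" using K h by (simp add: k_def)
    have k3: "h * k ^ 3 = K" using K h by (simp add: k_def real_root_pow_pos2)
    have "h * \<bar>k ^ 3 - t ^ 3\<bar> = \<bar>h * k ^ 3 - h * t ^ 3\<bar>"
      using h by (simp add: right_diff_distrib[symmetric] abs_mult)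
    also have "\<dots> \<le> 127 * e" unfolding k3 using near' W by linarith
    finally have "\<bar>k ^ 3 - t ^ 3\<bar> \<le> A * e" using h by (simp add: A_def field_simps)
    moreover have "\<bar>k - t\<bar> * t\<^sup>2 \<le> \<bar>k ^ 3 - t ^ 3\<bar>"
    proof -
      have "k ^ 3 - t ^ 3 = (k - t) * (k\<^sup>2 + k * t + t\<^sup>2)" by (simp add: power2_eq_square power3_eq_cube algebra_simps)
      then have "\<bar>k ^ 3 - t ^ 3\<bar> = \<bar>k - t\<bar> * (k\<^sup>2 + k * t + t\<^sup>2)" using k0 t1 by (simp add: abs_mult)
      moreover have "\<bar>k - t\<bar> * t\<^sup>2 \<le> \<bar>k - t\<bar> * (k\<^sup>2 + k * t + t\<^sup>2)" using k0 t1 by (intro mult_left_mono) auto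
      ultimately show ?thesis by simp
    qed
    ultimately have "\<bar>k - t\<bar> * t\<^sup>2 \<le> (2 * A * L) * t\<^sup>2" by (simp add: e_def algebra_simps)
    then have kt: "\<bar>k - t\<bar> \<le> 2 * A * L" using t1 by (subst (asm) mult_le_cancel_right) auto
    then have kt2: "t / 2 \<le> k" "k \<le> 3 / 2 * t" using R'(1) by linarith+
    have LK: "L \<le> ln K"
    proof -
      have "(t / 2) ^ 3 \<le> k ^ 3" using kt2 t1 by (intro power_mono) auto
      then have "h * (t / 2) ^ 3 \<le> h * k ^ 3" using h by (intro mult_left_mono) auto
      then have "h / 8 * t ^ 3 \<le> K" unfolding k3 by (simp add: power_divide)
      moreover have "0 < h / 8 * t ^ 3" using h t1 by simp
      ultimately have "ln (h / 8 * t ^ 3) \<le> ln K" using K by simp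
      moreover have "ln (h / 8 * t ^ 3) = ln (h / 8) + 3 * ln t"
        using h t1 by (subst ln_mult_pos) (auto simp: ln_realpow)
      ultimately show ?thesis using R'(2) by linarith
    qed
    have lnK: "0 \<le> ln K" using LK L1 by linarith
    have "\<bar>1 / t - 1 / k\<bar> = \<bar>k - t\<bar> / (t * k)" using t1 k0 by (simp add: abs_divide divide_simps abs_mult)
    also have "\<dots> \<le> (2 * A * ln K) / (t * k)"
    proof (rule divide_right_mono)
      have "2 * A * L \<le> 2 * A * ln K" using LK A by (intro mult_left_mono) auto
      then show "\<bar>k - t\<bar> \<le> 2 * A * ln K" using kt by linarith
    qed (use t1 k0 in auto)
    also have "\<dots> \<le> (2 * A * ln K) / (2 / 3 * k * k)"
    proof (rule divide_left_mono)
      have "2 / 3 * k \<le> t" using kt2 by linarith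
      then show "2 / 3 * k * k \<le> t * k" using k0 by (intro mult_right_mono) auto
    qed (use A lnK t1 k0 in auto)
    also have "\<dots> = 3 * A * ln K / k\<^sup>2" by (simp add: power2_eq_square)
    also have "\<dots> \<le> C * ln K / k\<^sup>2"
      using lnK by (intro divide_right_mono mult_right_mono) (auto simp: C_def)
    finally have c1: "\<bar>1 / t - 1 / k\<bar> \<le> C * ln K / k\<^sup>2" .
    have "t\<^sup>2 \<le> (2 * k)\<^sup>2" using kt2 t1 by (intro power_mono) auto
    then have "2 * t\<^sup>2 * L \<le> 2 * (2 * k)\<^sup>2 * ln K" using LK L1 by (intro mult_mono) auto
    also have "\<dots> = 8 * (k\<^sup>2 * ln K)" by (simp add: power2_eq_square)
    also have "\<dots> \<le> C * (k\<^sup>2 * ln K)" using A lnK by (intro mult_right_mono) (auto simp: C_def)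
    finally have c2: "e \<le> C * k\<^sup>2 * ln K" by (simp add: e_def mult.assoc)
    have c3: "e + real r + 1 \<le> width (2 * r + 1)" using W R'(3) by linarith
    have "odd_err r = e" by (simp add: odd_err_def e_def L_def t_def)
    then show "odd_err r + real r + 1 \<le> width (2 * r + 1) \<and>
       \<bar>1 / (2 * real r + 1) - 1 / root 3 (K / h)\<bar> \<le> C * ln K / (root 3 (K / h))\<^sup>2 \<and>
       odd_err r \<le> C * (root 3 (K / h))\<^sup>2 * ln K \<and> 1 \<le> odd_err r"
      using c1 c2 c3 e1 unfolding t_def k_def by simp
  qed
qed

text \<open>The bound 97 is \<open>13 + 3 + 3 * 27\<close>: the growth of the main term and the two
  deviations from it, the later one expressed by the earlier error.\<close>

lemma odd_width_step:
  fixes r :: nat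
  shows "odd_err (Suc r) \<le> 27 * odd_err r" "width (2 * Suc r + 1) \<le> width (2 * r + 1) + 97 * odd_err r"
    "\<bar>width (2 * r + 1) - 2 * zeta3 / pi ^ 2 * (2 * real r + 1) ^ 3\<bar> \<le> 3 * odd_err r"
proof -
  define h where "h = 2 * zeta3 / pi ^ 2"
  have W: "\<bar>width (2 * r + 1) - h * (2 * real r + 1) ^ 3\<bar> \<le> 3 * odd_err r" for r
  proof -
    have rt: "real (2 * r + 1) = 2 * real r + 1" by simp
    have L: "0 \<le> 1 + ln (2 * real r + 1)" by (simp add: add_nonneg_nonneg)
    have "\<bar>width (2 * r + 1) - h * (2 * real r + 1) ^ 3\<bar> \<le> 5 * (2 * real r + 1)\<^sup>2 * harm (2 * r + 1)"
      using width_bound[of "2 * r + 1"] unfolding rt h_def by simp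
    also have "\<dots> \<le> 5 * (2 * real r + 1)\<^sup>2 * (1 + ln (2 * real r + 1))"
      using harm_le_ln[of "2 * r + 1"] unfolding rt by (intro mult_left_mono) auto
    also have "\<dots> \<le> 6 * (2 * real r + 1)\<^sup>2 * (1 + ln (2 * real r + 1))"
      using L by (intro mult_right_mono) auto
    finally show ?thesis by (simp add: odd_err_def)
  qed
  then show "\<bar>width (2 * r + 1) - 2 * zeta3 / pi ^ 2 * (2 * real r + 1) ^ 3\<bar> \<le> 3 * odd_err r" by (simp add: h_def)
  define t where "t = 2 * real r + 1"
  have t1: "1 \<le> t" by (simp add: t_def)
  have S: "2 * real (Suc r) + 1 = t + 2" by (simp add: t_def)
  have "ln (t + 2) \<le> ln (3 * t)" using t1 by simp
  also have "\<dots> = ln 3 + ln t" using t1 by (simp add: ln_mult_pos)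
  finally have "ln (t + 2) \<le> ln 3 + ln t" .
  moreover have "ln 3 \<le> (2::real)" using ln_le_minus_one[of "3::real"] by simp
  moreover have "0 \<le> ln t" using t1 by simp
  ultimately have "1 + ln (t + 2) \<le> 3 * (1 + ln t)" by (simp only: distrib_left)
  moreover have "(t + 2)\<^sup>2 \<le> (3 * t)\<^sup>2" using t1 by (intro power_mono) auto
  ultimately have "(t + 2)\<^sup>2 * (1 + ln (t + 2)) \<le> (3 * t)\<^sup>2 * (3 * (1 + ln t))"
    using t1 by (intro mult_mono) (auto intro!: add_nonneg_nonneg)
  also have "\<dots> = 27 * (t\<^sup>2 * (1 + ln t))" by (simp add: power2_eq_square)
  finally show e: "odd_err (Suc r) \<le> 27 * odd_err r" unfolding odd_err_def S t_def[symmetric]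
    by (simp only: mult.assoc)
  have h: "0 \<le> h" "h \<le> 1"
  proof -
    have "3 ^ 2 \<le> pi ^ 2" using pi_gt3 by (intro power_mono) auto
    then show "0 \<le> h" "h \<le> 1" using sum_inverse_powers_bounds(5,6) by (auto simp: h_def divide_le_eq)
  qed
  have "t \<le> t\<^sup>2" "1 \<le> t\<^sup>2" using t1 by (auto simp: self_le_power one_le_power)
  moreover have "(t + 2) ^ 3 - t ^ 3 = 6 * t\<^sup>2 + 12 * t + 8" by (simp add: power2_eq_square power3_eq_cube algebra_simps)
  ultimately have "(t + 2) ^ 3 - t ^ 3 \<le> 26 * t\<^sup>2" by linarith
  moreover have "26 * t\<^sup>2 \<le> 13 * odd_err r"
  proof -
    have "2 * t\<^sup>2 * 1 \<le> odd_err r" unfolding odd_err_def t_def[symmetric] using t1 by (intro mult_left_mono) auto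
    then show ?thesis by simp
  qed
  ultimately have d: "(t + 2) ^ 3 - t ^ 3 \<le> 13 * odd_err r" by linarith
  moreover have "0 \<le> (t + 2) ^ 3 - t ^ 3" using t1 by (auto intro!: power_mono)
  ultimately have "h * ((t + 2) ^ 3 - t ^ 3) \<le> 1 * (13 * odd_err r)" using h by (intro mult_mono) auto
  then have "h * (t + 2) ^ 3 - h * t ^ 3 \<le> 13 * odd_err r" by (simp add: right_diff_distrib)
  moreover have "\<bar>width (2 * r + 1) - h * t ^ 3\<bar> \<le> 3 * odd_err r" using W[of r] by (simp add: t_def)
  moreover have "\<bar>width (2 * Suc r + 1) - h * (t + 2) ^ 3\<bar> \<le> 3 * odd_err (Suc r)" using W[of "Suc r"] unfolding S .
  ultimately show "width (2 * Suc r + 1) \<le> width (2 * r + 1) + 97 * odd_err r" using e by linarith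
qed

text \<open>Widths are compared with \<open>K\<close> without monotonicity: the last
  \<open>r\<close> lying below \<open>K\<close> by its error and the first lying above by its error
  have neighbours that fail the condition, which bounds the gap. The worse bound is
  \<open>97 + 27 = 124\<close>.\<close>

lemma widths_approximate:
  fixes R :: nat
  shows "\<exists>K0. \<forall>K\<ge>K0. (\<exists>r\<ge>R. odd_err r \<le> K - width (2 * r + 1) \<and> K - width (2 * r + 1) \<le> 124 * odd_err r)
    \<and> (\<exists>r\<ge>R. odd_err r \<le> width (2 * r + 1) - K \<and> width (2 * r + 1) - K \<le> 124 * odd_err r)"
proof -
  define h where "h = 2 * zeta3 / pi ^ 2"
  have h: "0 < h" unfolding h_def using sum_inverse_powers_bounds(5) by simp
  let ?W = "\<lambda>r. width (2 * r + 1)"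
  have st: "odd_err (Suc r) \<le> 27 * odd_err r" "?W (Suc r) \<le> ?W r + 97 * odd_err r" "\<bar>?W r - h * (2 * real r + 1) ^ 3\<bar> \<le> 3 * odd_err r" for r
    unfolding h_def by (rule odd_width_step)+
  have e0: "0 \<le> odd_err r" for r by (simp add: odd_err_def add_nonneg_nonneg)
  have "filterlim (\<lambda>r::nat. h * (2 * real r + 1) ^ 3 - 4 * (2 * (2 * real r + 1)\<^sup>2 * (1 + ln (2 * real r + 1)))) at_top at_top"
    using h by real_asymp
  then have lim: "filterlim (\<lambda>r. h * (2 * real r + 1) ^ 3 - 4 * odd_err r) at_top at_top" by (simp add: odd_err_def)
  have large: "\<exists>r0. \<forall>r\<ge>r0. K < ?W r - odd_err r" for K
  proof -
    have "eventually (\<lambda>r. K < h * (2 * real r + 1) ^ 3 - 4 * odd_err r) at_top"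
      using lim by (simp add: filterlim_at_top_dense)
    then obtain r0 where r0: "\<And>r. r \<ge> r0 \<Longrightarrow> K < h * (2 * real r + 1) ^ 3 - 4 * odd_err r" by (auto simp: eventually_at_top_linorder)
    have "K < ?W r - odd_err r" if "r \<ge> r0" for r using r0[OF that] st(3)[of r] by linarith
    then show ?thesis by blast
  qed
  \<comment> \<open>Beyond this threshold every \<open>r \<le> R\<close> lies below \<open>K\<close>
    by more than its error, so both choices of \<open>r\<close> are at least
    \<open>R\<close>.\<close>
  define K0 where "K0 = (\<Sum>r\<le>R. \<bar>?W r\<bar> + odd_err r) + 1"
  have K0: "\<bar>?W r\<bar> + odd_err r < K0" if "r \<le> R" for r
  proof -
    have "\<bar>?W r\<bar> + odd_err r \<le> (\<Sum>r\<le>R. \<bar>?W r\<bar> + odd_err r)"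
      using that e0 by (intro member_le_sum[where f = "\<lambda>r. \<bar>?W r\<bar> + odd_err r"]) (auto intro: add_nonneg_nonneg)
    then show ?thesis by (simp add: K0_def)
  qed
  show ?thesis
  proof (intro exI[of _ K0] allI impI conjI)
    fix K assume K: "K0 \<le> K"
    obtain r0 where r0: "\<And>r. r \<ge> r0 \<Longrightarrow> K < ?W r - odd_err r" using large by blast
    let ?S = "{r. ?W r + odd_err r \<le> K}"
    have "r < r0" if "r \<in> ?S" for r
    proof (rule ccontr)
      assume "\<not> r < r0"
      then show False using r0[of r] that e0[of r] by simp
    qed
    then have fin: "finite ?S" by (intro finite_subset[of ?S "{..<r0}"]) auto
    have RS: "R \<in> ?S" using K0[of R] K by simp
    define r where "r = Max ?S"
    have rS: "r \<in> ?S" unfolding r_def using fin RS by (intro Max_in) auto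
    have rR: "R \<le> r" unfolding r_def using fin RS by (intro Max_ge)
    have "Suc r \<notin> ?S"
    proof
      assume "Suc r \<in> ?S"
      then have "Suc r \<le> r" unfolding r_def using fin by (intro Max_ge)
      then show False by simp
    qed
    then have "K - ?W r \<le> 124 * odd_err r" using st(1,2)[of r] by simp
    then show "\<exists>r\<ge>R. odd_err r \<le> K - ?W r \<and> K - ?W r \<le> 124 * odd_err r" using rS rR by (intro exI[of _ r]) auto
  next
    fix K assume K: "K0 \<le> K"
    obtain r0 where r0: "\<And>r. r \<ge> r0 \<Longrightarrow> K < ?W r - odd_err r" using large by blast
    define r where "r = (LEAST r. K \<le> ?W r - odd_err r)"
    have r: "K \<le> ?W r - odd_err r"
      unfolding r_def by (rule LeastI[of "\<lambda>r. K \<le> ?W r - odd_err r" r0]) (use r0[of r0] in linarith)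
    have "R < r"
    proof (rule ccontr)
      assume "\<not> R < r"
      then show False using K0[of r] K r e0[of r] by simp
    qed
    then obtain q where q: "r = Suc q" by (cases r) auto
    have "\<not> K \<le> ?W q - odd_err q" using not_less_Least[of q "\<lambda>r. K \<le> ?W r - odd_err r"] q r_def by simp
    then have "?W r - K \<le> 98 * odd_err q" using st(2)[of q] unfolding q by simp
    moreover have "odd_err q \<le> odd_err r" unfolding odd_err_def q by (intro mult_mono power_mono add_nonneg_nonneg) auto
    ultimately show "\<exists>r\<ge>R. odd_err r \<le> ?W r - K \<and> ?W r - K \<le> 124 * odd_err r"
      using r \<open>R < r\<close> e0[of r] by (intro exI[of _ r]) auto
  qed
qed

section \<open>The exact flow and the final estimate\<close>

lemma parabola_acsf:
  assumes "a > 0"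
  shows "acsf_graph_flow (\<lambda>t x. a / 2 * x\<^sup>2 + b * x + c + t * a powr (1/3)) (\<lambda>x. a / 2 * x\<^sup>2 + b * x + c)"
  unfolding acsf_graph_flow_def
proof (intro conjI allI impI)
  fix t x :: real assume "0 \<le> t"
  let ?u = "\<lambda>t x. a / 2 * x\<^sup>2 + b * x + c + t * a powr (1/3)"
  have d: "((\<lambda>z. ?u t z) has_real_derivative a * y + b) (at y)" for y
    by (auto intro!: derivative_eq_intros simp: field_simps)
  have "deriv (\<lambda>z. ?u t z) = (\<lambda>y. a * y + b)" using d by (auto intro!: DERIV_imp_deriv)
  then have dd: "((\<lambda>y. deriv (\<lambda>z. ?u t z) y) has_real_derivative a) (at x)"
    by (auto intro!: derivative_eq_intros)
  let ?q = "1 + (a * x + b)\<^sup>2"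
  have q: "0 < ?q" by (simp add: add_pos_nonneg)
  \<comment> \<open>The exponent \<open>1/3\<close> turns \<open>?q powr (3/2)\<close> into
    \<open>sqrt ?q\<close>, the same factor that converts vertical into normal speed; so the
    vertical speed does not depend on \<open>x\<close>.\<close>
  have "a powr (1/3) / sqrt ?q = (a / ?q powr (3/2)) powr (1/3)"
    using q assms by (simp add: powr_divide powr_powr powr_half_sqrt)
  also have "\<dots> = root 3 (a / ?q powr (3/2))" using q assms by (simp add: root_powr_inverse)
  finally have eq: "a powr (1/3) / sqrt ?q = root 3 (a / ?q powr (3/2))" .
  have dt: "((\<lambda>s. ?u s x) has_real_derivative a powr (1/3)) (at t within {0..})"
    by (auto intro!: derivative_eq_intros)
  have df: "\<forall>y. (\<lambda>z. ?u t z) differentiable (at y)" using d real_differentiable_def by blast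
  show "\<exists>ut ux uxx. ((\<lambda>s. ?u s x) has_real_derivative ut) (at t within {0..}) \<and>
      (\<forall>y. (\<lambda>z. ?u t z) differentiable (at y)) \<and>
      ((\<lambda>y. ?u t y) has_real_derivative ux) (at x) \<and>
      ((\<lambda>y. deriv (\<lambda>z. ?u t z) y) has_real_derivative uxx) (at x) \<and>
      ut / sqrt (1 + ux\<^sup>2) = root 3 (uxx / (1 + ux\<^sup>2) powr (3 / 2))"
    using dt df d[of x] dd eq by blast
qed simp

theorem theorem1:
  "\<exists>C::real. \<forall>(a::real) (b::real) (c::real) (T::real). a > 0 \<longrightarrow> T > 0 \<longrightarrow>
     acsf_graph_flow (\<lambda>t x. a / 2 * x\<^sup>2 + b * x + c + t * a powr (1/3))
                     (\<lambda>x. a / 2 * x\<^sup>2 + b * x + c) \<and>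
     (\<exists>N::nat. \<forall>n\<ge>N. \<forall>x::real.
        \<bar>grid_polygon n (\<lambda>x. a / 2 * x\<^sup>2 + b * x + c) (nat \<lfloor>c_g * T * real n powr (4/3)\<rfloor>) x
          - (a / 2 * x\<^sup>2 + b * x + c + T * a powr (1/3))\<bar>
        \<le> C * (T * a powr (2/3) + a powr (-2/3)) * ln (real n / a) / real n powr (1/3))"
proof -
  define h where "h = 2 * zeta3 / pi ^ 2"
  have h: "0 < h" unfolding h_def using sum_inverse_powers_bounds(5) by simp
  have g: "0 < c_g" using sum_inverse_powers_bounds(5) by (simp add: c_g_def)
  obtain R C where near: "\<And>r K. R \<le> r \<Longrightarrow> 0 < K \<Longrightarrow> \<bar>K - width (2 * r + 1)\<bar> \<le> 124 * odd_err r \<Longrightarrow>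
       odd_err r + real r + 1 \<le> width (2 * r + 1) \<and>
       \<bar>1 / (2 * real r + 1) - 1 / root 3 (K / h)\<bar> \<le> C * ln K / (root 3 (K / h))\<^sup>2 \<and>
       odd_err r \<le> C * (root 3 (K / h))\<^sup>2 * ln K \<and> 1 \<le> odd_err r"
    using widths_near[folded h_def] by blast
  obtain K0 where approx: "\<And>K. K \<ge> K0 \<Longrightarrow>
      (\<exists>r\<ge>R. odd_err r \<le> K - width (2 * r + 1) \<and> K - width (2 * r + 1) \<le> 124 * odd_err r)
    \<and> (\<exists>r\<ge>R. odd_err r \<le> width (2 * r + 1) - K \<and> width (2 * r + 1) - K \<le> 124 * odd_err r)"
    using widths_approximate[of R] by blast
  \<comment> \<open>After division by \<open>n\<close>, the error in the speed carries
    \<open>1 / c_g\<close> and the error in the position carries \<open>20 * c_g\<^sup>2\<close>;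
    their sum serves both terms.\<close>
  define C' where "C' = C * (1 / c_g + 20 * c_g\<^sup>2)"
  have main: "\<bar>grid_polygon n (\<lambda>x. a / 2 * x\<^sup>2 + b * x + c) (nat \<lfloor>c_g * T * real n powr (4/3)\<rfloor>) x
          - (a / 2 * x\<^sup>2 + b * x + c + T * a powr (1/3))\<bar>
        \<le> C' * (T * a powr (2/3) + a powr (-2/3)) * ln (real n / a) / real n powr (1/3)"
    if a: "0 < a" and T: "0 < T" and n: "0 < n" and K: "K0 \<le> n / a" for a b c T x :: real and n :: nat
  proof -
    let ?f = "\<lambda>x. a / 2 * x\<^sup>2 + b * x + c"
    define K where "K = n / a"
    have K_pos: "0 < K" using n a by (simp add: K_def)
    define p where "p = real n powr (1/3)"
    define \<alpha> where "\<alpha> = a powr (1/3)"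
    have pos: "0 < p" "0 < \<alpha>" using n a by (auto simp: p_def \<alpha>_def)
    have p3: "real n = p ^ 3" using n by (simp add: p_def powr_powr flip: powr_realpow)
    have p4: "real n powr (4/3) = p ^ 4" using n by (simp add: p_def powr_powr flip: powr_realpow)
    have a2: "a powr (2/3) = \<alpha>\<^sup>2" using a by (simp add: \<alpha>_def powr_powr flip: powr_realpow)
    have a2': "a powr (-2/3) = 1 / \<alpha>\<^sup>2" using a a2 powr_minus_divide[of a "2/3"] by simp
    \<comment> \<open>The ideal period; \<open>c_g\<close> is the cube root of \<open>1 / h\<close>,
      so it factors out of \<open>root 3 (K / h)\<close>.\<close>
    define k where "k = root 3 (K / h)"
    have k: "k = c_g * p / \<alpha>"
    proof -
      have "K / h = (pi ^ 2 / (2 * zeta3)) * (real n / a)" by (simp add: K_def h_def mult.commute)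
      then have "k = c_g * (root 3 n / root 3 a)"
        by (simp only: k_def c_g_def real_root_mult real_root_divide)
      also have "root 3 n = p" using n by (simp add: p_def root_powr_inverse)
      also have "root 3 a = \<alpha>" using a by (simp add: \<alpha>_def root_powr_inverse)
      finally show ?thesis by simp
    qed
    have k0: "0 < k" using g pos by (simp add: k)
    define M0 where "M0 = c_g * T * real n powr (4/3)"
    define m where "m = nat \<lfloor>M0\<rfloor>"
    have M0p: "M0 = c_g * T * p ^ 4" by (simp add: M0_def p4)
    have M00: "0 \<le> M0" using g T by (simp add: M0_def)
    then have m: "real m \<le> M0" "M0 - 1 \<le> real m" by (auto simp: m_def)
    \<comment> \<open>Two periods enclose \<open>K\<close>: \<open>r1\<close> gives a polygon of
      larger curvature inside the parabola, \<open>r2\<close> one of smaller curvature around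
      it.\<close>
    obtain r1 where r1: "r1 \<ge> R" "odd_err r1 \<le> K - width (2 * r1 + 1)" "K - width (2 * r1 + 1) \<le> 124 * odd_err r1"
      using approx[of K] K by (auto simp: K_def)
    obtain r2 where r2: "r2 \<ge> R" "odd_err r2 \<le> width (2 * r2 + 1) - K" "width (2 * r2 + 1) - K \<le> 124 * odd_err r2"
      using approx[of K] K by (auto simp: K_def)
    have e_nonneg: "0 \<le> odd_err r" for r by (simp add: odd_err_def add_nonneg_nonneg)
    have n1: "odd_err r1 + real r1 + 1 \<le> width (2 * r1 + 1)" "\<bar>1 / (2 * real r1 + 1) - 1 / k\<bar> \<le> C * ln K / k\<^sup>2"
      "odd_err r1 \<le> C * k\<^sup>2 * ln K" "1 \<le> odd_err r1"
      using near[OF r1(1) K_pos, folded k_def] r1 e_nonneg[of r1] by auto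
    have n2: "\<bar>1 / (2 * real r2 + 1) - 1 / k\<bar> \<le> C * ln K / k\<^sup>2" "odd_err r2 \<le> C * k\<^sup>2 * ln K" "1 \<le> odd_err r2"
      using near[OF r2(1) K_pos, folded k_def] r2 e_nonneg[of r2] by auto
    interpret s1: strip "int r1" by unfold_locales simp
    interpret s2: strip "int r2" by unfold_locales simp
    have t1: "s1.tau = int (2 * r1 + 1)" and t2: "s2.tau = int (2 * r2 + 1)" by (simp_all add: s1.tau_def s2.tau_def)
    have rt1: "real_of_int s1.tau = 2 * real r1 + 1" and rt2: "real_of_int s2.tau = 2 * real r2 + 1"
      by (simp_all add: t1 t2)
    have e1: "s1.err = odd_err r1" and e2: "s2.err = odd_err r2" unfolding s1.err_def s2.err_def odd_err_def rt1 rt2 by simp_all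
    have H1: "nat s1.tau = 2 * r1 + 1" and H2: "nat s2.tau = 2 * r2 + 1" unfolding t1 t2 by simp_all
    \<comment> \<open>In grid units: \<open>M0\<close> steps with the wrong speed, plus the fixed
      displacement of the enclosing polygons.\<close>
    define Z where "Z = M0 * (C * ln K / k\<^sup>2) + 20 * (C * k\<^sup>2 * ln K)"
    define S where "S = {y. (x, y) \<in> convex hull ((peel ^^ m) (grid_epi n ?f))}"
    \<comment> \<open>Here \<open>c_g\<close> is seen to be the right constant: \<open>M0\<close>
      steps at the ideal speed \<open>1 / k\<close> climb exactly \<open>T * \<alpha>\<close> in the
      original units.\<close>
    have P: "M0 / k = n * (T * \<alpha>)"
      unfolding M0p k p3 using g pos by (simp add: field_simps power3_eq_cube power4_eq_xxxx)
    obtain y where y: "y \<in> S" "y \<le> ?f x + (m / (2 * real r1 + 1) + 20 * odd_err r1) / n"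
      using s1.grid_polygon_le_witness[OF n a, of x m b c] r1(2) n1(1)
      unfolding e1 H1 rt1 K_def[symmetric] S_def by auto
    have "m / (2 * real r1 + 1) \<le> M0 * (1 / (2 * real r1 + 1))" using m(1) by (simp add: divide_right_mono)
    also have "\<dots> \<le> M0 * (1 / k + C * ln K / k\<^sup>2)" using n1(2) M00 by (intro mult_left_mono) linarith+
    finally have "m / (2 * real r1 + 1) + 20 * odd_err r1 \<le> n * (T * \<alpha>) + Z"
      using P n1(3) by (simp add: Z_def distrib_left)
    then have "(m / (2 * real r1 + 1) + 20 * odd_err r1) / n \<le> (n * (T * \<alpha>) + Z) / n" by (intro divide_right_mono) auto
    then have y': "y \<le> ?f x + T * \<alpha> + Z / n" using y(2) n by (simp add: add_divide_distrib)
    have low: "?f x + T * \<alpha> - Z / n \<le> y" if "y \<in> S" for y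
    proof -
      have "?f x + (m / (2 * real r2 + 1) - 4 * odd_err r2) / n \<le> y"
        using s2.peeled_hull_ge[OF n a, of x y m b c] r2(2) that
        unfolding e2 H2 rt2 K_def[symmetric] S_def by auto
      moreover have "n * (T * \<alpha>) - Z \<le> m / (2 * real r2 + 1) - 4 * odd_err r2"
      proof -
        have "M0 * (1 / k - C * ln K / k\<^sup>2) \<le> M0 * (1 / (2 * real r2 + 1))"
          using n2(1) M00 by (intro mult_left_mono) linarith+
        \<comment> \<open>Rounding \<open>M0\<close> down loses at most one step, that is at most 1
          in height; \<open>odd_err r2 \<ge> 1\<close> absorbs it in \<open>Z\<close>.\<close>
        moreover have "(M0 - 1) / (2 * real r2 + 1) \<le> m / (2 * real r2 + 1)" using m(2) by (intro divide_right_mono) auto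
        moreover have "(M0 - 1) / (2 * real r2 + 1) = M0 * (1 / (2 * real r2 + 1)) - 1 / (2 * real r2 + 1)"
          by (simp add: diff_divide_distrib)
        moreover have "1 / (2 * real r2 + 1) \<le> 1" by simp
        moreover have "M0 * (1 / k - C * ln K / k\<^sup>2) = n * (T * \<alpha>) - M0 * (C * ln K / k\<^sup>2)"
          using P by (simp add: right_diff_distrib)
        ultimately show ?thesis using n2(2,3) unfolding Z_def by linarith
      qed
      then have "(n * (T * \<alpha>) - Z) / n \<le> (m / (2 * real r2 + 1) - 4 * odd_err r2) / n" by (intro divide_right_mono) auto
      moreover have "(n * (T * \<alpha>) - Z) / n = T * \<alpha> - Z / n" using n by (simp add: diff_divide_distrib)
      ultimately show ?thesis by linarith
    qed
    \<comment> \<open>The infimum is a genuine one: \<open>S\<close> contains \<open>y\<close> and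
      is bounded below by \<open>low\<close>.\<close>
    have "Inf S \<le> y" using y(1) low by (intro cInf_lower) (auto simp: bdd_below_def)
    moreover have "?f x + T * \<alpha> - Z / n \<le> Inf S" using y(1) low by (intro cInf_greatest) auto
    ultimately have "\<bar>Inf S - (?f x + T * \<alpha>)\<bar> \<le> Z / n" using y' by linarith
    also have "Z / n = C * ln K * (T * \<alpha>\<^sup>2 * (1 / c_g) + 1 / \<alpha>\<^sup>2 * (20 * c_g\<^sup>2)) / p"
      unfolding Z_def M0p k p3 using g pos
      by (simp add: field_simps power2_eq_square power3_eq_cube power4_eq_xxxx)
    also have "\<dots> \<le> C * ln K * ((T * \<alpha>\<^sup>2 + 1 / \<alpha>\<^sup>2) * (1 / c_g + 20 * c_g\<^sup>2)) / p"
    proof (intro divide_right_mono mult_left_mono)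
      show "T * \<alpha>\<^sup>2 * (1 / c_g) + 1 / \<alpha>\<^sup>2 * (20 * c_g\<^sup>2) \<le> (T * \<alpha>\<^sup>2 + 1 / \<alpha>\<^sup>2) * (1 / c_g + 20 * c_g\<^sup>2)"
      proof -
        have "0 \<le> T * \<alpha>\<^sup>2 * (20 * c_g\<^sup>2)" "0 \<le> 1 / \<alpha>\<^sup>2 * (1 / c_g)" using T g by auto
        then show ?thesis by (simp only: distrib_left distrib_right)
      qed
      have "0 \<le> k\<^sup>2 * (C * ln K)" using n1(3,4) by (simp add: mult.commute mult.left_commute)
      then show "0 \<le> C * ln K" using k0 by (simp add: zero_le_mult_iff)
      show "0 \<le> p" using pos by simp
    qed
    also have "\<dots> = C' * (T * \<alpha>\<^sup>2 + 1 / \<alpha>\<^sup>2) * ln K / p" by (simp add: C'_def ac_simps)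
    finally show ?thesis
      unfolding grid_polygon_def S_def m_def M0_def a2 a2' K_def p_def[symmetric] \<alpha>_def[symmetric] .
  qed
  show ?thesis
  proof (intro exI[of _ C'] allI impI conjI)
    fix a b c T :: real assume a: "0 < a" and T: "0 < T"
    show "acsf_graph_flow (\<lambda>t x. a / 2 * x\<^sup>2 + b * x + c + t * a powr (1/3)) (\<lambda>x. a / 2 * x\<^sup>2 + b * x + c)"
      using a by (rule parabola_acsf)
    \<comment> \<open>\<open>C'\<close> was fixed before \<open>a\<close>, \<open>b\<close>,
      \<open>c\<close>, \<open>T\<close>; only the threshold depends on the parabola, through
      \<open>n / a \<ge> K0\<close>.\<close>
    obtain N :: nat where N: "a * K0 < N" using reals_Archimedean2 by blast
    have "0 < n \<and> K0 \<le> n / a" if "n \<ge> Suc N" for n :: nat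
    proof -
      have "a * K0 \<le> n" using N that by linarith
      then show ?thesis using that a by (simp add: le_divide_eq mult.commute)
    qed
    then show "\<exists>N::nat. \<forall>n\<ge>N. \<forall>x::real.
        \<bar>grid_polygon n (\<lambda>x. a / 2 * x\<^sup>2 + b * x + c) (nat \<lfloor>c_g * T * real n powr (4/3)\<rfloor>) x
          - (a / 2 * x\<^sup>2 + b * x + c + T * a powr (1/3))\<bar>
        \<le> C' * (T * a powr (2/3) + a powr (-2/3)) * ln (real n / a) / real n powr (1/3)"
      using main[OF a T] by blast
  qed
qed

end
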